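(* (Littlewood-Richardson rule) Let $\lambda$ and $\nu$ be dominant integral weights, and let $\mathcal{A}$ be the collection of admissible subsets corresponding to an arbitrary $\lambda$-chain $\{\beta_i\}_{i\in I}$. Then $$\chi(\lambda)\cdot\chi(\nu)=\sum\chi(\nu+\mu(J)),$$ where the summation is over all $J$ in $\mathcal{A}$ satisfying $\langle\nu+\mu(J),\alpha_p^\vee\rangle\ge M(J,p)$ for all $p=1,\ldots,r$.
   Context: Root system. Let $V$ be a finite-dimensional real vector space with a nondegenerate symmetric bilinear form $\langle\cdot,\cdot\rangle$, and let $\Phi\subset V$ be the set of real roots of a complex symmetrizable Kac-Moody algebra $\mathfrak{g}$, with simple roots $\alpha_1,\ldots,\alpha_r$. Put $\alpha^\vee=2\alpha/\langle\alpha,\alpha\rangle$ for $\alpha\in\Phi$, $s_\alpha(v)=v-\langle v,\alpha^\vee\rangle\alpha$ and $s_{\alpha,k}(v)=s_\alpha(v)+k\alpha$ ($k\in\mathbb{Z}$). Let $W\subset GL(V)$ be the Weyl group generated by the $s_\alpha$, $\alpha\in\Phi$, with length function $\ell$ with respect to the simple reflections $s_p=s_{\alpha_p}$. Thus: $\alpha_1,\dots,\alpha_r$ are linearly independent; $\langle\alpha_p,\alpha_p\rangle>0$; $\langle\alpha_p,\alpha_q^\vee\rangle\in\mathbb{Z}_{\le0}$ for $p\ne q$; and $\Phi=\bigcup_p W\alpha_p$. $\Phi^+$ is the set of roots in the nonnegative span of the simple roots, $\Phi=\Phi^+\sqcup(-\Phi^+)$; $\mathrm{sgn}(\alpha)=1$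 (we write $\alpha>0$) for $\alpha\in\Phi^+$ and $\mathrm{sgn}(\alpha)=-1$ ($\alpha<0$) for $\alpha\in-\Phi^+$. In Bruhat order, $w\lessdot ws_\alpha$ ($\alpha\in\Phi^+$) means $\ell(ws_\alpha)=\ell(w)+1$. Let $\Lambda=\{v\in V\mid\langle v,\alpha_p^\vee\rangle\in\mathbb{Z}\ \forall p\}$; $v\in\Lambda$ is dominant if $\langle v,\alpha^\vee\rangle\ge0$ for all $\alpha\in\Phi^+$. Fix $\rho\in\Lambda$ with $\langle\rho,\alpha_p^\vee\rangle=1$ for all $p$. Characters. Fix a linear map $\mathrm{ht}:V\to\mathbb{R}$ with $\mathrm{ht}(\alpha_p)=1$ for all $p$. $R$ is the ring of formal sums $\sum_{\nu\in\Lambda}c_\nu e^\nu$, $c_\nu\in\mathbb{Z}$, with finitely many $\nu$ with $c_\nu\ne0$ and $\mathrm{ht}(\nu)>h$ for every $h\in\mathbb{R}$; $e^\mu e^\nu=e^{\mu+\nu}$. For dominant $\lambda\in\Lambda$, $$\chi(\lambda)=\frac{\sum_{w\in W}(-1)^{\ell(w)}e^{w(\lambda+\rho)-\rho}}{\sum_{w\in W}(-1)^{\ell(w)}e^{w(\rho)-\rho}}\in R,$$ which is the character of the irreducible integrable $\mathfrak{g}$-module of highest weight $\lambda$. $\lambda$-chains. A $\lambda$-chain is a family $\{\beta_i\}_{i\in I}$ of positive roots indexed by a totally ordered set $I$ such that: (1) for each $\alpha\in\Phi^+$, $\#\{i\in I\mid\beta_i=\alpha\}=\langle\lambda,\alpha^\vee\rangle$;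 (2) for any roots $\alpha,\beta,\gamma\in\Phi$ with $\alpha\ne\pm\beta$ and $\gamma^\vee=\alpha^\vee+k\beta^\vee$ for some integer $k$, and any $i\in I$ with $\beta_i=\beta$, one has $N_i(\gamma)=N_i(\alpha)+kN_i(\beta)$. Here, for $\alpha\in\Phi^+$, $N_i(\alpha)=\#\{j<i\mid\beta_j=\alpha\}$ and $N_i(-\alpha)=1-N_i(\alpha)$. Admissible subsets. Put $r_i=s_{\beta_i}$, $l_i^\emptyset=\#\{j<i\mid\beta_j=\beta_i\}$, $\widehat r_i=s_{\beta_i,l_i^\emptyset}$. A finite (possibly empty) subset $J=\{j_1<\dots<j_s\}\subseteq I$ is admissible if $1\lessdot r_{j_1}\lessdot r_{j_1}r_{j_2}\lessdot\cdots\lessdot r_{j_1}\cdots r_{j_s}$. Its weight is $\mu(J)=\widehat r_{j_1}\cdots\widehat r_{j_s}(\lambda)$. $\mathcal{A}$ is the set of admissible subsets. Foldings. $\Gamma(\emptyset)=(\{(\beta_i,1)\}_{i\in I},\rho)$. For $\Gamma=(\{(\gamma_i,\varepsilon_i)\}_{i\in I},\gamma_\infty)$ with $\gamma_i\in\Phi$, $\varepsilon_i=\pm1$, $\gamma_\infty\in W\rho$, let $\phi_i(\Gamma)=(\{(\delta_j,\zeta_j)\}_{j\in I},s_{\gamma_i}(\gamma_\infty))$, where $(\delta_j,\zeta_j)$ is $(\gamma_j,\varepsilon_j)$ if $j<i$, $(\gamma_i,-\varepsilon_i)$ if $j=i$, and $(s_{\gamma_i}(\gamma_j),\varepsilon_j)$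 if $j>i$. For finite $J=\{j_1<\dots<j_s\}$, $\Gamma(J)=\phi_{j_1}\cdots\phi_{j_s}(\Gamma(\emptyset))$. For $\Gamma=\Gamma(J)=(\{(\gamma_i,\varepsilon_i)\},\gamma_\infty)$, the levels are $$l_i=\delta_i'+\sum_{j<i,\ \varepsilon_j=1,\ \gamma_j=\pm\gamma_i}\mathrm{sgn}(\gamma_j),\qquad\delta_i'=0\text{ if }\gamma_i>0,\quad\delta_i'=-1\text{ if }\gamma_i<0.$$ For $J\in\mathcal{A}$ and $p\in\{1,\ldots,r\}$, with $\Gamma(J)$ and its levels as defined here, let $I_{\alpha_p}=\{i\in I\mid\gamma_i=\pm\alpha_p\}$ (a finite set) and $M(J,p)=\max(\{l_i\mid i\in I_{\alpha_p}\}\cup\{\langle\mu(J),\alpha_p^\vee\rangle\})$. *)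

theory Defs
  imports "HOL-Analysis.Linear_Algebra" "HOL-Algebra.Ring"
begin

text \<open>
  A Kac--Moody root datum in a finite-dimensional real space with a nondegenerate symmetric
  form, together with the auxiliary choices (a Weyl vector and a height functional) that the
  definition of characters needs. The simple roots are \<open>\<alpha> p\<close> for \<open>p \<in> {1..r}\<close>; values of \<open>\<alpha>\<close>
  elsewhere are irrelevant.
\<close>

locale kac_moody_roots =
  fixes form :: "'v::real_vector \<Rightarrow> 'v \<Rightarrow> real"
    and r :: nat
    and \<alpha> :: "nat \<Rightarrow> 'v"
    and \<rho> :: 'v
    and ht :: "'v \<Rightarrow> real"
  assumes finite_dimensional: "\<exists>S :: 'v set. finite S \<and> span S = UNIV"
    and form_bilinear: "bilinear form"
    and form_symmetric: "form v w = form w v"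
    and form_nondegenerate: "(\<And>w. form v w = 0) \<Longrightarrow> v = 0"
    and simple_roots_independent: "inj_on \<alpha> {1..r}" "independent (\<alpha> ` {1..r})"
    and simple_root_norm_pos: "p \<in> {1..r} \<Longrightarrow> form (\<alpha> p) (\<alpha> p) > 0"
    and cartan_integers: "p \<in> {1..r} \<Longrightarrow> q \<in> {1..r} \<Longrightarrow> p \<noteq> q \<Longrightarrow>
      form (\<alpha> p) ((2 / form (\<alpha> q) (\<alpha> q)) *\<^sub>R \<alpha> q) \<in> \<int> \<and>
      form (\<alpha> p) ((2 / form (\<alpha> q) (\<alpha> q)) *\<^sub>R \<alpha> q) \<le> 0"
    and rho_pairing: "p \<in> {1..r} \<Longrightarrow> form \<rho> ((2 / form (\<alpha> p) (\<alpha> p)) *\<^sub>R \<alpha> p) = 1"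
    and ht_linear: "linear ht"
    and ht_simple: "p \<in> {1..r} \<Longrightarrow> ht (\<alpha> p) = 1"
begin

definition coroot :: "'v \<Rightarrow> 'v" where
  "coroot a = (2 / form a a) *\<^sub>R a"

definition reflection :: "'v \<Rightarrow> 'v \<Rightarrow> 'v" where
  "reflection a v = v - form v (coroot a) *\<^sub>R a"

definition affine_reflection :: "'v \<Rightarrow> int \<Rightarrow> 'v \<Rightarrow> 'v" where
  "affine_reflection a k v = reflection a v + real_of_int k *\<^sub>R a"

definition simple_word :: "nat list \<Rightarrow> 'v \<Rightarrow> 'v" where
  "simple_word ps = foldr (\<lambda>p w. reflection (\<alpha> p) \<circ> w) ps id"

text \<open>
  Products of simple reflections already form a group, since reflections are involutions.
  Generating \<open>weyl_group\<close> by the simple reflections instead of all reflections breaks the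
  circularity between \<open>W\<close> and \<open>\<Phi> = \<Union>\<^sub>p W \<alpha>\<^sub>p\<close>; the reflections in all roots belong to it by
  lemma \<open>reflection_in_weyl_group\<close> below.
\<close>

definition weyl_group :: "('v \<Rightarrow> 'v) set" where
  "weyl_group = simple_word ` lists {1..r}"

definition roots :: "'v set" where
  "roots = (\<Union>p\<in>{1..r}. (\<lambda>w. w (\<alpha> p)) ` weyl_group)"

definition pos_roots :: "'v set" where
  "pos_roots = {a \<in> roots. \<exists>c. (\<forall>p\<in>{1..r}. 0 \<le> c p) \<and> a = (\<Sum>p\<in>{1..r}. c p *\<^sub>R \<alpha> p)}"

text \<open>Only used for roots, where \<open>a \<notin> pos_roots\<close> means that \<open>- a\<close> is positive.\<close>

definition root_sgn :: "'v \<Rightarrow> int" where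
  "root_sgn a = (if a \<in> pos_roots then 1 else -1)"

definition wlength :: "('v \<Rightarrow> 'v) \<Rightarrow> nat" where
  "wlength w = (LEAST n. \<exists>ps \<in> lists {1..r}. length ps = n \<and> simple_word ps = w)"

definition bruhat_cover :: "('v \<Rightarrow> 'v) \<Rightarrow> ('v \<Rightarrow> 'v) \<Rightarrow> bool" where
  "bruhat_cover u w \<longleftrightarrow> (\<exists>a\<in>pos_roots. w = u \<circ> reflection a \<and> wlength w = wlength u + 1)"

definition weights :: "'v set" where
  "weights = {v. \<forall>p\<in>{1..r}. form v (coroot (\<alpha> p)) \<in> \<int>}"

definition dominant :: "'v \<Rightarrow> bool" where
  "dominant v \<longleftrightarrow> v \<in> weights \<and> (\<forall>a\<in>pos_roots. 0 \<le> form v (coroot a))"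

text \<open>
  The formal sum \<open>\<Sum>\<^sub>\<nu> c\<^sub>\<nu> e\<^sup>\<nu>\<close> is represented by its coefficient function. In the product, for fixed
  \<open>\<nu>\<close> only finitely many \<open>\<mu>\<close> contribute, because both factors have height bounded above and
  finitely many exponents above any height.
\<close>

definition char_ring :: "('v \<Rightarrow> int) ring" where
  "char_ring =
    \<lparr>carrier = {c. {\<nu>. c \<nu> \<noteq> 0} \<subseteq> weights \<and> (\<forall>h. finite {\<nu>. c \<nu> \<noteq> 0 \<and> ht \<nu> > h})},
     monoid.mult = (\<lambda>c d \<nu>. \<Sum>\<mu> | c \<mu> \<noteq> 0 \<and> d (\<nu> - \<mu>) \<noteq> 0. c \<mu> * d (\<nu> - \<mu>)),
     one = (\<lambda>\<nu>. if \<nu> = 0 then 1 else 0),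
     zero = (\<lambda>\<nu>. 0),
     add = (\<lambda>c d \<nu>. c \<nu> + d \<nu>)\<rparr>"

text \<open>
  \<open>alternant lam\<close> is \<open>\<Sum>\<^bsub>w\<in>W\<^esub> (-1)\<^bsup>\<ell>(w)\<^esup> e\<^bsup>w(lam+\<rho>)-\<rho>\<^esup>\<close>. For dominant \<open>lam\<close> the index set of the sum at
  each \<open>\<nu>\<close> has at most one element, as \<open>lam + \<rho>\<close> has trivial stabiliser; moreover
  \<open>alternant 0\<close> is \<open>1\<close> plus terms of height at most \<open>-1\<close>, hence a unit of \<open>char_ring\<close>.
\<close>

definition alternant :: "'v \<Rightarrow> 'v \<Rightarrow> int" where
  "alternant lam = (\<lambda>\<nu>. \<Sum>w | w \<in> weyl_group \<and> w (lam + \<rho>) - \<rho> = \<nu>. (-1) ^ wlength w)"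

definition character :: "'v \<Rightarrow> 'v \<Rightarrow> int" where
  "character lam = alternant lam \<otimes>\<^bsub>char_ring\<^esub> inv\<^bsub>char_ring\<^esub> (alternant 0)"

text \<open>
  A family \<open>{\<beta>\<^sub>i}\<^bsub>i\<in>I\<^esub>\<close> is given by a subset \<open>I\<close> of a linearly ordered type and a function whose
  values outside \<open>I\<close> play no role. \<open>chain_count\<close> is the function \<open>N\<^sub>i\<close> on roots.
\<close>

definition chain_count :: "'i::linorder set \<Rightarrow> ('i \<Rightarrow> 'v) \<Rightarrow> 'i \<Rightarrow> 'v \<Rightarrow> int" where
  "chain_count I \<beta> i a =
    (if a \<in> pos_roots then int (card {j \<in> I. j < i \<and> \<beta> j = a})
     else 1 - int (card {j \<in> I. j < i \<and> \<beta> j = - a}))"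

definition lambda_chain :: "'v \<Rightarrow> 'i::linorder set \<Rightarrow> ('i \<Rightarrow> 'v) \<Rightarrow> bool" where
  "lambda_chain lam I \<beta> \<longleftrightarrow>
    (\<forall>i\<in>I. \<beta> i \<in> pos_roots) \<and>
    (\<forall>a\<in>pos_roots. finite {i \<in> I. \<beta> i = a} \<and>
        real (card {i \<in> I. \<beta> i = a}) = form lam (coroot a)) \<and>
    (\<forall>a\<in>roots. \<forall>b\<in>roots. \<forall>c\<in>roots. \<forall>k::int. \<forall>i\<in>I.
        a \<noteq> b \<and> a \<noteq> - b \<and> coroot c = coroot a + real_of_int k *\<^sub>R coroot b \<and> \<beta> i = b \<longrightarrow>
        chain_count I \<beta> i c = chain_count I \<beta> i a + k * chain_count I \<beta> i b)"

text \<open>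
  A finite \<open>J = {j\<^sub>1 < \<dots> < j\<^sub>s}\<close> is traversed as \<open>sorted_list_of_set J = [j\<^sub>1, \<dots>, j\<^sub>s]\<close>;
  \<open>foldr\<close> composes from left to right, so the operator of index \<open>j\<^sub>s\<close> acts first.
\<close>

definition reflection_product :: "('i \<Rightarrow> 'v) \<Rightarrow> 'i list \<Rightarrow> 'v \<Rightarrow> 'v" where
  "reflection_product \<beta> js = foldr (\<lambda>j w. reflection (\<beta> j) \<circ> w) js id"

definition admissible :: "'i::linorder set \<Rightarrow> ('i \<Rightarrow> 'v) \<Rightarrow> 'i set \<Rightarrow> bool" where
  "admissible I \<beta> J \<longleftrightarrow> finite J \<and> J \<subseteq> I \<and>
    (\<forall>k < card J. bruhat_cover (reflection_product \<beta> (take k (sorted_list_of_set J)))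
                               (reflection_product \<beta> (take (Suc k) (sorted_list_of_set J))))"

definition reflection_hat :: "'i::linorder set \<Rightarrow> ('i \<Rightarrow> 'v) \<Rightarrow> 'i \<Rightarrow> 'v \<Rightarrow> 'v" where
  "reflection_hat I \<beta> i = affine_reflection (\<beta> i) (int (card {j \<in> I. j < i \<and> \<beta> j = \<beta> i}))"

definition subset_weight :: "'v \<Rightarrow> 'i::linorder set \<Rightarrow> ('i \<Rightarrow> 'v) \<Rightarrow> 'i set \<Rightarrow> 'v" where
  "subset_weight lam I \<beta> J = foldr (reflection_hat I \<beta>) (sorted_list_of_set J) lam"

text \<open>
  A folding \<open>({(\<gamma>\<^sub>i, \<epsilon>\<^sub>i)}\<^bsub>i\<in>I\<^esub>, \<gamma>\<^sub>\<infinity>)\<close> is a pair of a function \<open>i \<mapsto> (\<gamma>\<^sub>i, \<epsilon>\<^sub>i)\<close> and a vector.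
\<close>

definition fold_op ::
    "'i::linorder \<Rightarrow> ('i \<Rightarrow> 'v \<times> int) \<times> 'v \<Rightarrow> ('i \<Rightarrow> 'v \<times> int) \<times> 'v" where
  "fold_op i \<Gamma> =
    (let g = fst \<Gamma>; a = fst (g i) in
      (\<lambda>j. if j < i then g j
           else if j = i then (a, - snd (g i))
           else (reflection a (fst (g j)), snd (g j)),
       reflection a (snd \<Gamma>)))"

definition folding :: "('i::linorder \<Rightarrow> 'v) \<Rightarrow> 'i set \<Rightarrow> ('i \<Rightarrow> 'v \<times> int) \<times> 'v" where
  "folding \<beta> J = foldr fold_op (sorted_list_of_set J) (\<lambda>i. (\<beta> i, 1), \<rho>)"

definition level :: "'i::linorder set \<Rightarrow> ('i \<Rightarrow> 'v \<times> int) \<times> 'v \<Rightarrow> 'i \<Rightarrow> int" where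
  "level I \<Gamma> i =
    (let \<gamma> = (\<lambda>j. fst (fst \<Gamma> j)); \<epsilon> = (\<lambda>j. snd (fst \<Gamma> j)) in
      (if \<gamma> i \<in> pos_roots then 0 else -1) +
      (\<Sum>j | j \<in> I \<and> j < i \<and> \<epsilon> j = 1 \<and> (\<gamma> j = \<gamma> i \<or> \<gamma> j = - \<gamma> i). root_sgn (\<gamma> j)))"

definition simple_indices ::
    "'i::linorder set \<Rightarrow> ('i \<Rightarrow> 'v \<times> int) \<times> 'v \<Rightarrow> nat \<Rightarrow> 'i set" where
  "simple_indices I \<Gamma> p = {i \<in> I. fst (fst \<Gamma> i) = \<alpha> p \<or> fst (fst \<Gamma> i) = - \<alpha> p}"

definition max_level :: "'v \<Rightarrow> 'i::linorder set \<Rightarrow> ('i \<Rightarrow> 'v) \<Rightarrow> 'i set \<Rightarrow> nat \<Rightarrow> real" where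
  "max_level lam I \<beta> J p =
    Max ((\<lambda>i. real_of_int (level I (folding \<beta> J) i)) ` simple_indices I (folding \<beta> J) p
         \<union> {form (subset_weight lam I \<beta> J) (coroot (\<alpha> p))})"

lemma form_simps [simp]:
  "form (u + v) w = form u w + form v w" "form u (v + w) = form u v + form u w"
  "form (u - v) w = form u w - form v w" "form u (v - w) = form u v - form u w"
  "form (t *\<^sub>R u) w = t * form u w" "form u (t *\<^sub>R w) = t * form u w"
  using form_bilinear
  by (simp_all add: bilinear_ladd bilinear_radd bilinear_lsub bilinear_rsub bilinear_lmul bilinear_rmul)

lemma reflection_involutive:
  assumes "form a a \<noteq> 0"
  shows "reflection a (reflection a v) = v"
proof -
  have "form (reflection a v) (coroot a) = - form v (coroot a)"
    using assms by (simp add: reflection_def coroot_def)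
  then have "reflection a (reflection a v) = reflection a v + form v (coroot a) *\<^sub>R a"
    by (simp add: reflection_def[of a "reflection a v"])
  then show ?thesis
    by (simp add: reflection_def)
qed

lemma form_reflection:
  assumes "form a a \<noteq> 0"
  shows "form (reflection a u) (reflection a v) = form u v"
proof -
  have "form (reflection a u) (reflection a v) = form u v
      - (2 / form a a) * form v a * form u a - (2 / form a a) * form u a * form a v
      + (2 / form a a) * form u a * ((2 / form a a) * form v a) * form a a"
    by (simp add: reflection_def coroot_def right_diff_distrib)
  then show ?thesis
    using assms by (simp add: form_symmetric[of a v])
qed

lemma simple_word_append: "simple_word (ps @ qs) = simple_word ps \<circ> simple_word qs"
  by (induction ps) (simp_all add: simple_word_def o_assoc)

lemma simple_word_simps [simp]:
  "simple_word [] = id" "simple_word (p # ps) = reflection (\<alpha> p) \<circ> simple_word ps"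
  by (simp_all add: simple_word_def)

lemma reflection_linear: "reflection a (u - t *\<^sub>R v) = reflection a u - t *\<^sub>R reflection a v"
  by (simp add: reflection_def scaleR_diff_left scaleR_diff_right)

lemma reflection_simple_word:
  assumes "ps \<in> lists {1..r}"
  shows "reflection (simple_word ps a) = simple_word ps \<circ> reflection a \<circ> simple_word (rev ps)"
  using assms
proof (induction ps)
  case (Cons p ps)
  define b where "b = simple_word ps a"
  have pos: "form (\<alpha> p) (\<alpha> p) \<noteq> 0"
    using simple_root_norm_pos[of p] Cons by auto
  have "reflection (reflection (\<alpha> p) b) v = reflection (\<alpha> p) (reflection b (reflection (\<alpha> p) v))" for v
  proof -
    have "reflection (reflection (\<alpha> p) b) v =
        reflection (\<alpha> p) (reflection (\<alpha> p) v) - form v (coroot (reflection (\<alpha> p) b)) *\<^sub>R reflection (\<alpha> p) b"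
      by (simp add: reflection_involutive[OF pos] reflection_def[of "reflection (\<alpha> p) b"])
    also have "form v (coroot (reflection (\<alpha> p) b)) = form (reflection (\<alpha> p) v) (coroot b)"
      using form_reflection[OF pos, of "reflection (\<alpha> p) v" b] form_reflection[OF pos, of b b]
      by (simp add: coroot_def reflection_involutive[OF pos])
    finally show ?thesis
      by (simp add: reflection_linear[symmetric] reflection_def[of b])
  qed
  then have "reflection (reflection (\<alpha> p) b) = reflection (\<alpha> p) \<circ> reflection b \<circ> reflection (\<alpha> p)"
    by auto
  then show ?case
    using Cons by (simp add: b_def simple_word_append o_assoc)
qed simp

lemma reflection_in_weyl_group:
  assumes "a \<in> roots"
  shows "reflection a \<in> weyl_group"
proof -
  obtain p ps where p: "p \<in> {1..r}" and ps: "ps \<in> lists {1..r}" and a: "a = simple_word ps (\<alpha> p)"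
    using assms unfolding roots_def weyl_group_def by blast
  have "reflection a = simple_word (ps @ [p] @ rev ps)"
    by (simp add: a reflection_simple_word[OF ps] simple_word_append o_assoc)
  moreover have "ps @ [p] @ rev ps \<in> lists {1..r}"
    using p ps by auto
  ultimately show ?thesis
    unfolding weyl_group_def by blast
qed

end

text \<open>
  Coefficientwise summation of a family of formal sums: at every exponent only finitely many
  members of the family have a nonzero coefficient, and these add up to that of \<open>c\<close>.
\<close>

definition formal_sum_of :: "('v \<Rightarrow> int) \<Rightarrow> ('j \<Rightarrow> 'v \<Rightarrow> int) \<Rightarrow> 'j set \<Rightarrow> bool" where
  "formal_sum_of c F A \<longleftrightarrow>
    (\<forall>\<kappa>. finite {j \<in> A. F j \<kappa> \<noteq> 0} \<and> c \<kappa> = (\<Sum>j | j \<in> A \<and> F j \<kappa> \<noteq> 0. F j \<kappa>))"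

end

theory Submission
  imports Defs
begin

text \<open>
  An admissible subset \<open>J\<close> behaves like a path that crosses the walls of the simple roots, and the
  levels of its folded chain record the height of the path at these crossings. For a simple root
  \<open>\<alpha> p\<close> the crossings form a word of up, down and folded steps, and flipping two neighbouring
  steps at the last (first) maximum of the level defines operators \<open>e\<close>, \<open>f\<close> that move the weight
  by \<open>\<plusminus> \<alpha> p\<close> and are mutually inverse, as in a crystal. Reversing the \<open>e,f\<close>-strings shows that the
  multiset of weights \<open>\<mu>(J)\<close> is \<open>W\<close>-invariant, so that
  \<open>\<Sum>\<^sub>J e\<^bsup>\<mu>(J)\<^esup> \<cdot> \<Sum>\<^sub>w (-1)\<^bsup>\<ell>(w)\<^esup> e\<^bsup>w(\<nu>+\<rho>)-\<rho>\<^esup> = \<Sum>\<^sub>J\<^sub>,\<^sub>w (-1)\<^bsup>\<ell>(w)\<^esup> e\<^bsup>w(\<nu>+\<mu>(J)+\<rho>)-\<rho>\<^esup>\<close>.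
  If \<open>J\<close> violates \<open>\<langle>\<nu> + \<mu>(J), \<alpha>\<^sub>p\<^sup>\<or>\<rangle> \<ge> M(J, p)\<close> for some \<open>p\<close>, take the violating index that is furthest to
  the right; reversing a part of the string of \<open>J\<close> on its left reflects \<open>\<nu> + \<mu>(J) + \<rho>\<close> in
  \<open>\<alpha> p\<close> and keeps that index, so the violating terms cancel. For \<open>\<nu> = 0\<close> only \<open>J = {}\<close> survives,
  which identifies \<open>\<Sum>\<^sub>J e\<^bsup>\<mu>(J)\<^esup>\<close> with \<open>\<chi>(\<lambda>)\<close>; dividing by the Weyl denominator gives the rule.
\<close>

text \<open>Only Cartan data are given, and the Weyl group, the roots and the index set may all be
  infinite. So the sign of a root has to be derived by reduction to rank two, and every sum is
  controlled through \<open>ht\<close>: each letter of a reduced word and each folding lowers a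
  height by at least 1. Condition (2) on a chain enters through a single identity, which equates the
  pairing of an affine product with a coroot and a signed count of unfolded crossings. It shows that
  folding at a wall of \<open>\<alpha> p\<close> acts on weights as the affine reflection whose
  constant is the level of that wall. Flips use two neighbouring walls because their reflections are
  parallel: their product is a translation along \<open>\<alpha> p\<close>, and the linear parts
  cancel to the right of both. Hence a flip disturbs other foldings only in the strip between the
  walls, and a violation further right is kept, provided that levels are measured relative to the
  end at infinity. The part of a string cut off before reversal has
  \<open>\<langle>\<nu>, \<alpha>\<^sub>p\<^sup>\<or>\<rangle> + 1\<close> elements: the pairing of
  \<nu> because violating subsets are those with larger \<open>eps\<close>, and 1 because the weight
  is reflected after adding \<rho>.\<close>

context kac_moody_roots
begin

declare One_nat_def [simp del]

section \<open>The bilinear form and the Weyl group\<close>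

lemma form_uminus [simp]: "form (- u) v = - form u v" "form u (- v) = - form u v"
  using form_simps(5)[of "-1" u v] form_simps(6)[of u "-1" v] by simp_all

lemma form_zero [simp]: "form 0 v = 0" "form v 0 = 0"
  using form_simps(5)[of 0 0 v] form_simps(6)[of v 0 0] by simp_all

lemma form_sum_left: "form (sum f A) v = (\<Sum>x\<in>A. form (f x) v)"
  by (induction A rule: infinite_finite_induct) simp_all

lemma linear_reflection: "linear (reflection a)"
  by (rule linearI) (simp_all add: reflection_def algebra_simps)

lemma reflection_self: "form a a \<noteq> 0 \<Longrightarrow> reflection a a = - a"
  by (simp add: reflection_def coroot_def scaleR_2)

lemma reflection_uminus: "reflection (- a) = reflection a"
  by (rule ext) (simp add: reflection_def coroot_def)

lemma weyl_groupI: "ps \<in> lists {1..r} \<Longrightarrow> simple_word ps \<in> weyl_group"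
  by (simp add: weyl_group_def)

lemma id_in_weyl_group [simp]: "id \<in> weyl_group"
  using weyl_groupI[of "[]"] by simp

lemma simple_reflection_in_weyl_group: "p \<in> {1..r} \<Longrightarrow> reflection (\<alpha> p) \<in> weyl_group"
  using weyl_groupI[of "[p]"] by simp

lemma weyl_group_comp: 
  assumes "v \<in> weyl_group" "w \<in> weyl_group" shows "v \<circ> w \<in> weyl_group"
proof -
  obtain ps qs where "ps \<in> lists {1..r}" "v = simple_word ps" "qs \<in> lists {1..r}" "w = simple_word qs"
    using assms unfolding weyl_group_def by blast
  then show ?thesis
    using weyl_groupI[of "ps @ qs"] by (simp add: simple_word_append)
qed

lemma weyl_group_induct [consumes 1, case_names id step]:
  assumes "w \<in> weyl_group" and "P id"
    and "\<And>p w. p \<in> {1..r} \<Longrightarrow> w \<in> weyl_group \<Longrightarrow> P w \<Longrightarrow> P (reflection (\<alpha> p) \<circ> w)"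
  shows "P w"
proof -
  have "P (simple_word ps)" if "ps \<in> lists {1..r}" for ps
    using that
  proof (induction ps)
    case (Cons p ps)
    then have "p \<in> {1..r}" "ps \<in> lists {1..r}" "P (simple_word ps)"
      by simp_all
    then show ?case
      unfolding simple_word_simps(2) by (intro assms(3) weyl_groupI)
  qed (unfold simple_word_simps, rule assms(2))
  then show ?thesis
    using assms(1) by (auto simp: weyl_group_def)
qed

lemma simple_norm_nonzero: "p \<in> {1..r} \<Longrightarrow> form (\<alpha> p) (\<alpha> p) \<noteq> 0"
  using simple_root_norm_pos[of p] by simp

lemma weyl_group_linear: "w \<in> weyl_group \<Longrightarrow> linear w"
proof (induction rule: weyl_group_induct)
  case id
  show ?case by (rule linear_id)
next
  case (step p w)
  then show ?case
    using linear_compose[OF _ linear_reflection] by blast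
qed

lemma weyl_group_form: "w \<in> weyl_group \<Longrightarrow> form (w u) (w v) = form u v"
  by (induction rule: weyl_group_induct) (simp_all add: form_reflection simple_norm_nonzero)

lemma weyl_group_inverse:
  assumes "w \<in> weyl_group"
  obtains w' where "w' \<in> weyl_group" "w \<circ> w' = id" "w' \<circ> w = id"
proof -
  have "\<exists>w'\<in>weyl_group. w \<circ> w' = id \<and> w' \<circ> w = id"
    using assms
  proof (induction rule: weyl_group_induct)
    case id
    show ?case by (rule bexI[of _ id]) simp_all
  next
    case (step p w)
    then obtain w' where w': "w' \<in> weyl_group" "w \<circ> w' = id" "w' \<circ> w = id"
      by blast
    have "(reflection (\<alpha> p) \<circ> w) ((w' \<circ> reflection (\<alpha> p)) v) = v"
         "(w' \<circ> reflection (\<alpha> p)) ((reflection (\<alpha> p) \<circ> w) v) = v" for v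
      using w'(2,3) step(1) reflection_involutive[OF simple_norm_nonzero[OF step(1)]]
      by (simp_all add: fun_eq_iff)
    then have "(reflection (\<alpha> p) \<circ> w) \<circ> (w' \<circ> reflection (\<alpha> p)) = id"
      "(w' \<circ> reflection (\<alpha> p)) \<circ> (reflection (\<alpha> p) \<circ> w) = id"
      by (auto simp: fun_eq_iff)
    then show ?case
      using weyl_group_comp[OF w'(1) simple_reflection_in_weyl_group[OF step(1)]] by blast
  qed
  then show ?thesis
    using that by blast
qed

lemma weyl_group_inj: "w \<in> weyl_group \<Longrightarrow> w u = w v \<longleftrightarrow> u = v"
  by (metis weyl_group_inverse comp_apply id_apply)

lemma weyl_group_diff: "w \<in> weyl_group \<Longrightarrow> w (u - v) = w u - w v"
  using weyl_group_linear linear_diff by blast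

lemma weyl_group_add: "w \<in> weyl_group \<Longrightarrow> w (u + v) = w u + w v"
  using weyl_group_linear linear_add by blast

lemma weyl_group_uminus: "w \<in> weyl_group \<Longrightarrow> w (- v) = - w v"
  using weyl_group_linear linear_neg by blast

lemma weyl_group_scale: "w \<in> weyl_group \<Longrightarrow> w (c *\<^sub>R v) = c *\<^sub>R w v"
  using weyl_group_linear linear_scale by blast

lemma weyl_group_coroot: "w \<in> weyl_group \<Longrightarrow> coroot (w a) = w (coroot a)"
  by (simp add: coroot_def weyl_group_form weyl_group_scale)

lemma weyl_group_pairing: "w \<in> weyl_group \<Longrightarrow> form (w v) (coroot (w a)) = form v (coroot a)"
  by (simp add: weyl_group_coroot weyl_group_form)

lemma weyl_group_conjugate: "w \<in> weyl_group \<Longrightarrow> reflection (w a) (w v) = w (reflection a v)"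
  by (simp add: reflection_def weyl_group_pairing weyl_group_diff weyl_group_scale)

section \<open>Roots, the simple cone and the root lattice\<close>

lemma rootsE:
  assumes "a \<in> roots"
  obtains p w where "p \<in> {1..r}" "w \<in> weyl_group" "a = w (\<alpha> p)"
  using assms unfolding roots_def by blast

lemma weyl_group_roots: "w \<in> weyl_group \<Longrightarrow> a \<in> roots \<Longrightarrow> w a \<in> roots"
  unfolding roots_def using weyl_group_comp[of w] by (auto intro!: bexI image_eqI[of "w _" _ "w \<circ> _"])

lemma simple_roots: "p \<in> {1..r} \<Longrightarrow> \<alpha> p \<in> roots"
  unfolding roots_def using id_in_weyl_group by (intro UN_I image_eqI[of _ _ id]) simp_all

lemma root_norm_pos: "a \<in> roots \<Longrightarrow> form a a > 0"
  by (elim rootsE) (simp add: weyl_group_form simple_root_norm_pos)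

lemma uminus_roots: "a \<in> roots \<Longrightarrow> - a \<in> roots"
  using weyl_group_roots[OF reflection_in_weyl_group, of a a] reflection_self[of a] root_norm_pos[of a]
  by simp

lemma root_pairing_self: "a \<in> roots \<Longrightarrow> form a (coroot a) = 2"
  using root_norm_pos[of a] by (simp add: coroot_def)

lemma reflection_root_involutive: "a \<in> roots \<Longrightarrow> reflection a (reflection a v) = v"
  using root_norm_pos[of a] by (simp add: reflection_involutive)

lemma simple_coeff_unique:
  assumes "(\<Sum>p\<in>{1..r}. c p *\<^sub>R \<alpha> p) = (\<Sum>p\<in>{1..r}. d p *\<^sub>R \<alpha> p)" "p \<in> {1..r}"
  shows "c p = d p"
proof -
  have "(\<Sum>p\<in>{1..r}. (c p - d p) *\<^sub>R \<alpha> p) = 0"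
    using assms(1) by (simp add: scaleR_diff_left sum_subtractf)
  then have "(\<Sum>v\<in>\<alpha> ` {1..r}. (c (inv_into {1..r} \<alpha> v) - d (inv_into {1..r} \<alpha> v)) *\<^sub>R v) = 0"
    using simple_roots_independent(1) by (simp add: sum.reindex)
  then have "c (inv_into {1..r} \<alpha> (\<alpha> p)) - d (inv_into {1..r} \<alpha> (\<alpha> p)) = 0"
    using assms(2) by (intro independentD[OF simple_roots_independent(2) _ order_refl]) simp_all
  then show ?thesis
    using assms(2) simple_roots_independent(1) by simp
qed

text \<open>Positivity is split off from being a root, because the rank two reduction handles
  nonnegative combinations of images of simple roots before the sign of any root is known.\<close>

definition simple_cone :: "'v set" where
  "simple_cone = {v. \<exists>c. (\<forall>p\<in>{1..r}. 0 \<le> c p) \<and> v = (\<Sum>p\<in>{1..r}. c p *\<^sub>R \<alpha> p)}"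

text \<open>The coefficients stay real and are only required to lie in \<open>\<int>\<close>, so
  that these expansions can be compared with those of \<open>simple_cone\<close> by linear
  independence.\<close>

definition root_lattice :: "'v set" where
  "root_lattice = {v. \<exists>c. (\<forall>p\<in>{1..r}. c p \<in> \<int>) \<and> v = (\<Sum>p\<in>{1..r}. c p *\<^sub>R \<alpha> p)}"

lemma pos_roots_eq: "pos_roots = roots \<inter> simple_cone"
  by (auto simp: pos_roots_def simple_cone_def)

lemma simple_eq_sum: "p \<in> {1..r} \<Longrightarrow> \<alpha> p = (\<Sum>q\<in>{1..r}. (if q = p then 1 else 0) *\<^sub>R \<alpha> q)"
  by (simp add: if_distrib[of "\<lambda>x. x *\<^sub>R _"] cong: if_cong)

lemma simple_cone_simple: "p \<in> {1..r} \<Longrightarrow> \<alpha> p \<in> simple_cone"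
  unfolding simple_cone_def using simple_eq_sum[of p]
  by (intro CollectI exI[of _ "\<lambda>q. if q = p then 1 else 0"]) auto

lemma simple_cone_add:
  assumes "u \<in> simple_cone" "v \<in> simple_cone" shows "u + v \<in> simple_cone"
proof -
  obtain c d where "\<forall>p\<in>{1..r}. 0 \<le> c p" "u = (\<Sum>p\<in>{1..r}. c p *\<^sub>R \<alpha> p)"
    "\<forall>p\<in>{1..r}. 0 \<le> d p" "v = (\<Sum>p\<in>{1..r}. d p *\<^sub>R \<alpha> p)"
    using assms unfolding simple_cone_def by blast
  then show ?thesis
    unfolding simple_cone_def
    by (intro CollectI exI[of _ "\<lambda>p. c p + d p"]) (simp add: scaleR_add_left sum.distrib)
qed

lemma simple_cone_scale:
  assumes "t \<ge> 0" "v \<in> simple_cone" shows "t *\<^sub>R v \<in> simple_cone"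
proof -
  obtain d where "\<forall>p\<in>{1..r}. 0 \<le> d p" "v = (\<Sum>p\<in>{1..r}. d p *\<^sub>R \<alpha> p)"
    using assms unfolding simple_cone_def by blast
  then show ?thesis
    using assms(1) unfolding simple_cone_def
    by (intro CollectI exI[of _ "\<lambda>p. t * d p"]) (simp add: scaleR_sum_right)
qed

lemma simple_cone_pointed:
  assumes "v \<in> simple_cone" "- v \<in> simple_cone" shows "v = 0"
proof -
  obtain c d where c: "\<forall>p\<in>{1..r}. 0 \<le> c p" "v = (\<Sum>p\<in>{1..r}. c p *\<^sub>R \<alpha> p)"
    and d: "\<forall>p\<in>{1..r}. 0 \<le> d p" "- v = (\<Sum>p\<in>{1..r}. d p *\<^sub>R \<alpha> p)"
    using assms unfolding simple_cone_def by blast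
  have "v = (\<Sum>p\<in>{1..r}. (- d p) *\<^sub>R \<alpha> p)"
    using d(2) by (simp add: sum_negf) (metis minus_minus)
  then have "c p = - d p" if "p \<in> {1..r}" for p
    using simple_coeff_unique[of c "\<lambda>p. - d p" p] c(2) that by simp
  then have "c p = 0" if "p \<in> {1..r}" for p
    using c(1) d(1) that by force
  then show ?thesis
    using c(2) by simp
qed

lemma root_lattice_simple: "p \<in> {1..r} \<Longrightarrow> \<alpha> p \<in> root_lattice"
  unfolding root_lattice_def using simple_eq_sum[of p]
  by (intro CollectI exI[of _ "\<lambda>q. if q = p then 1 else 0"]) auto

lemma root_lattice_diff_scale:
  assumes "u \<in> root_lattice" "v \<in> root_lattice" "k \<in> \<int>" shows "u - k *\<^sub>R v \<in> root_lattice"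
proof -
  obtain c d where "\<forall>p\<in>{1..r}. c p \<in> \<int>" "u = (\<Sum>p\<in>{1..r}. c p *\<^sub>R \<alpha> p)"
    "\<forall>p\<in>{1..r}. d p \<in> \<int>" "v = (\<Sum>p\<in>{1..r}. d p *\<^sub>R \<alpha> p)"
    using assms unfolding root_lattice_def by blast
  then show ?thesis
    unfolding root_lattice_def using assms(3)
    by (intro CollectI exI[of _ "\<lambda>p. c p - k * d p"])
      (simp add: scaleR_diff_left sum_subtractf scaleR_sum_right)
qed

lemma simple_pairing_int:
  assumes "p \<in> {1..r}" "q \<in> {1..r}" shows "form (\<alpha> p) (coroot (\<alpha> q)) \<in> \<int>"
  using cartan_integers[OF assms] root_pairing_self[OF simple_roots[OF assms(1)]]
  by (cases "p = q") (simp_all add: coroot_def)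

lemma root_lattice_pairing:
  assumes "v \<in> root_lattice" "q \<in> {1..r}" shows "form v (coroot (\<alpha> q)) \<in> \<int>"
proof -
  obtain c where c: "\<forall>p\<in>{1..r}. c p \<in> \<int>" "v = (\<Sum>p\<in>{1..r}. c p *\<^sub>R \<alpha> p)"
    using assms unfolding root_lattice_def by blast
  then show ?thesis
    using simple_pairing_int[OF _ assms(2)] by (auto simp: form_sum_left intro!: Ints_sum Ints_mult)
qed

lemma weyl_group_root_lattice: "w \<in> weyl_group \<Longrightarrow> v \<in> root_lattice \<Longrightarrow> w v \<in> root_lattice"
proof (induction rule: weyl_group_induct)
  case (step p w)
  then show ?case
    using root_lattice_diff_scale[OF _ root_lattice_simple[of p] root_lattice_pairing[OF _ step(1)]]
    by (simp add: reflection_def)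
qed simp

lemma roots_in_root_lattice: "a \<in> roots \<Longrightarrow> a \<in> root_lattice"
  by (elim rootsE) (simp add: weyl_group_root_lattice root_lattice_simple)

text \<open>Pairings are invariant under the Weyl group, so \<open>b\<close> may be moved to a
  simple root, where the Cartan integers decide.\<close>

lemma root_pairing_int: 
  assumes "a \<in> roots" "b \<in> roots" shows "form a (coroot b) \<in> \<int>"
proof -
  obtain p w where w: "p \<in> {1..r}" "w \<in> weyl_group" "b = w (\<alpha> p)"
    using assms(2) by (rule rootsE)
  obtain w' where w': "w' \<in> weyl_group" "w \<circ> w' = id" "w' \<circ> w = id"
    using w(2) by (rule weyl_group_inverse)
  have "form a (coroot b) = form (w' a) (coroot (\<alpha> p))"
    using weyl_group_pairing[OF w'(1), of a b] w' w(3) by (simp add: fun_eq_iff)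
  then show ?thesis
    using root_lattice_pairing[OF _ w(1)] roots_in_root_lattice weyl_group_roots[OF w'(1) assms(1)] by simp
qed

subsection \<open>Length\<close>

lemma wlength_le: "ps \<in> lists {1..r} \<Longrightarrow> wlength (simple_word ps) \<le> length ps"
  unfolding wlength_def by (rule Least_le) blast

lemma reduced_word:
  assumes "w \<in> weyl_group"
  obtains ps where "ps \<in> lists {1..r}" "simple_word ps = w" "length ps = wlength w"
proof -
  have "\<exists>n. \<exists>ps\<in>lists {1..r}. length ps = n \<and> simple_word ps = w"
    using assms unfolding weyl_group_def by blast
  then have "\<exists>ps\<in>lists {1..r}. length ps = wlength w \<and> simple_word ps = w"
    unfolding wlength_def by (rule LeastI_ex)
  then show ?thesis
    using that by blast
qed

lemma wlength_comp_le:
  assumes "v \<in> weyl_group" "ps \<in> lists {1..r}"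
  shows "wlength (v \<circ> simple_word ps) \<le> wlength v + length ps"
proof -
  obtain qs where "qs \<in> lists {1..r}" "simple_word qs = v" "length qs = wlength v"
    using assms(1) by (rule reduced_word)
  then show ?thesis
    using wlength_le[of "qs @ ps"] assms(2) by (simp add: simple_word_append)
qed

lemma wlength_id [simp]: "wlength id = 0"
  using wlength_le[of "[]"] by simp

lemma wlength_eq_0: "w \<in> weyl_group \<Longrightarrow> wlength w = 0 \<longleftrightarrow> w = id"
  by (metis reduced_word length_0_conv simple_word_simps(1) wlength_id)

lemma wlength_simple_left:
  assumes "w \<in> weyl_group" "p \<in> {1..r}"
  shows "wlength (reflection (\<alpha> p) \<circ> w) \<le> wlength w + 1"
proof -
  obtain ps where "ps \<in> lists {1..r}" "simple_word ps = w" "length ps = wlength w"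
    using assms(1) by (rule reduced_word)
  then show ?thesis
    using wlength_le[of "p # ps"] assms(2) by simp
qed

subsection \<open>Rank two\<close>

text \<open>The alternating word of length \<open>k\<close> ending in \<open>q\<close>.\<close>

fun alternating :: "nat \<Rightarrow> nat \<Rightarrow> nat \<Rightarrow> nat list" where
  "alternating p q 0 = []"
| "alternating p q (Suc k) = (if even k then q else p) # alternating p q k"

lemma length_alternating [simp]: "length (alternating p q k) = k"
  by (induction k) simp_all

lemma alternating_add:
  "\<exists>us \<in> lists {p, q}. alternating p q (k + l) = us @ alternating p q l"
  by (induction k) auto

lemma alternating_snoc: "alternating p q (Suc k) = alternating q p k @ [q]"
proof -
  have "alternating p q (Suc k) = alternating q p k @ [q] \<and> alternating q p (Suc k) = alternating p q k @ [p]"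
    by (induction k) auto
  then show ?thesis by simp
qed

lemma reflection_simple_comb:
  assumes "p \<in> {1..r}"
  shows "reflection (\<alpha> p) (v + x *\<^sub>R \<alpha> p + y *\<^sub>R u) =
    v + (- form v (coroot (\<alpha> p)) - x - y * form u (coroot (\<alpha> p))) *\<^sub>R \<alpha> p + y *\<^sub>R u"
proof -
  have "form (v + x *\<^sub>R \<alpha> p + y *\<^sub>R u) (coroot (\<alpha> p)) =
      form v (coroot (\<alpha> p)) + 2 * x + y * form u (coroot (\<alpha> p))"
    using root_pairing_self[OF simple_roots[OF assms]] by simp
  then show ?thesis
    unfolding reflection_def by (simp only: scaleR_add_left scaleR_diff_left scaleR_minus_left mult_2) (simp add: algebra_simps)
qed

lemma reflection_simple_comb':
  assumes "p \<in> {1..r}"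
  shows "reflection (\<alpha> p) (v + y *\<^sub>R u + x *\<^sub>R \<alpha> p) =
    v + y *\<^sub>R u + (- form v (coroot (\<alpha> p)) - x - y * form u (coroot (\<alpha> p))) *\<^sub>R \<alpha> p"
  using reflection_simple_comb[OF assms, of v x y u] by (simp add: algebra_simps)

text \<open>Coordinates of \<open>u (\<alpha> p)\<close> with respect to \<open>\<alpha> p\<close> and \<open>\<alpha> q\<close> for the alternating word \<open>u\<close> ending in \<open>q\<close>.\<close>

fun rank_two_coeff :: "real \<Rightarrow> real \<Rightarrow> nat \<Rightarrow> real \<times> real" where
  "rank_two_coeff a b 0 = (1, 0)"
| "rank_two_coeff a b (Suc k) =
    (let (x, y) = rank_two_coeff a b k in if even k then (x, a * x - y) else (b * y - x, y))"

text \<open>This is the case of an infinite dihedral group. Nonnegativity alone does not propagate.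
  The third conjunct says that the vector pairs nonnegatively with the coroot of the simple root
  reflected in last (of \<open>\<alpha> p\<close> when \<open>k = 0\<close>), and
  \<open>a * b \<ge> 4\<close> carries this to the next step.\<close>

lemma rank_two_coeff_nonneg:
  assumes "a \<ge> 0" "b \<ge> 0" "a * b \<ge> 4"
  shows "(let (x, y) = rank_two_coeff a b k
    in 0 \<le> x \<and> 0 \<le> y \<and> (if even k then 2 * x \<ge> b * y else 2 * y \<ge> a * x))"
proof (induction k)
  case (Suc k)
  obtain x y where xy: "rank_two_coeff a b k = (x, y)"
    by fastforce
  show ?case
  proof (cases "even k")
    case True
    then have h: "0 \<le> x" "0 \<le> y" "2 * x \<ge> b * y"
      using Suc xy by auto
    have "2 * (a * x) \<ge> (a * b) * y"
      using mult_left_mono[OF h(3) assms(1)] by (simp add: algebra_simps)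
    moreover have "(a * b) * y \<ge> 4 * y"
      using mult_right_mono[OF assms(3) h(2)] .
    ultimately have "a * x \<ge> 2 * y"
      by linarith
    then show ?thesis
      using True xy h by simp
  next
    case False
    then have h: "0 \<le> x" "0 \<le> y" "2 * y \<ge> a * x"
      using Suc xy by auto
    have "2 * (b * y) \<ge> (a * b) * x"
      using mult_left_mono[OF h(3) assms(2)] by (simp add: algebra_simps)
    moreover have "(a * b) * x \<ge> 4 * x"
      using mult_right_mono[OF assms(3) h(1)] .
    ultimately have "b * y \<ge> 2 * x"
      by linarith
    then show ?thesis
      using False xy h by simp
  qed
qed simp

lemma alternating_word_simple:
  assumes "p \<in> {1..r}" "q \<in> {1..r}" "a = - form (\<alpha> p) (coroot (\<alpha> q))" "b = - form (\<alpha> q) (coroot (\<alpha> p))"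
  shows "simple_word (alternating p q k) (\<alpha> p) =
    fst (rank_two_coeff a b k) *\<^sub>R \<alpha> p + snd (rank_two_coeff a b k) *\<^sub>R \<alpha> q"
proof (induction k)
  case (Suc k)
  obtain x y where "rank_two_coeff a b k = (x, y)"
    by fastforce
  then show ?case
    using Suc reflection_simple_comb[OF assms(1), of 0 x y "\<alpha> q"] reflection_simple_comb'[OF assms(2), of 0 x "\<alpha> p" y]
    by (simp add: assms(3,4) algebra_simps)
qed simp

lemma alternating_numeral:
  "alternating p q 2 = [p, q]" "alternating p q 3 = [q, p, q]"
  "alternating p q 4 = [p, q, p, q]" "alternating p q 6 = [p, q, p, q, p, q]"
  using alternating.simps(2)[of p q 0] alternating.simps(2)[of p q 1] alternating.simps(2)[of p q 2]
    alternating.simps(2)[of p q 3] alternating.simps(2)[of p q 4] alternating.simps(2)[of p q 5]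
  by (simp_all flip: One_nat_def)

text \<open>The triples are the finite types of rank two: the product of the Cartan integers is 0,
  1, 2 or 3, and the product of the two reflections has order 2, 3, 4 or 6 accordingly.\<close>

lemma braid_relation:
  assumes p: "p \<in> {1..r}" and q: "q \<in> {1..r}"
    and a: "real na = - form (\<alpha> p) (coroot (\<alpha> q))" and b: "real nb = - form (\<alpha> q) (coroot (\<alpha> p))"
    and m: "(na, nb, m) \<in> {(0,0,2), (1,1,3), (1,2,4), (2,1,4), (1,3,6), (3,1,6)}"
  shows "simple_word (alternating p q m) = simple_word (alternating q p m)"
proof
  fix v
  \<comment> \<open>Both reflections move \<open>v\<close> only by multiples of the two simple
    roots, so recording the two coefficients turns each word into a computation in \<open>X\<close>
    and \<open>Y\<close>.\<close>
  define comb where "comb x y = v + x *\<^sub>R \<alpha> p + y *\<^sub>R \<alpha> q" for x y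
  define X Y where "X = form v (coroot (\<alpha> p))" and "Y = form v (coroot (\<alpha> q))"
  have sp: "reflection (\<alpha> p) (comb x y) = comb (- X - x + real nb * y) y" for x y
    using reflection_simple_comb[OF p, of v x y "\<alpha> q"] by (simp add: comb_def X_def b algebra_simps)
  have sq: "reflection (\<alpha> q) (comb x y) = comb x (- Y - y + real na * x)" for x y
    using reflection_simple_comb'[OF q, of v x "\<alpha> p" y] by (simp add: comb_def Y_def a algebra_simps)
  have "simple_word (alternating p q m) (comb 0 0) = simple_word (alternating q p m) (comb 0 0)"
    using m by (auto simp: alternating_numeral sp sq algebra_simps)
  then show "simple_word (alternating p q m) v = simple_word (alternating q p m) v"
    by (simp add: comb_def)
qed

text \<open>The hypothesis \<open>reduced\<close> stops the word before the braid relation. In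
  finite type this leaves \<open>k < m\<close>, and these few coefficients are computed; otherwise
  the product of the Cartan integers is at least 4.\<close>

lemma alternating_word_nonneg:
  assumes p: "p \<in> {1..r}" and q: "q \<in> {1..r}" and "p \<noteq> q"
    and reduced: "\<And>m. 1 \<le> m \<Longrightarrow> m \<le> k \<Longrightarrow> simple_word (alternating p q m) \<noteq> simple_word (alternating q p m)"
  shows "\<exists>x\<ge>0. \<exists>y\<ge>0. simple_word (alternating p q k) (\<alpha> p) = x *\<^sub>R \<alpha> p + y *\<^sub>R \<alpha> q"
proof -
  define a b where "a = - form (\<alpha> p) (coroot (\<alpha> q))" and "b = - form (\<alpha> q) (coroot (\<alpha> p))"
  have "a \<in> \<int>" "b \<in> \<int>" "a \<ge> 0" "b \<ge> 0"
    using cartan_integers[OF p q] cartan_integers[OF q p] \<open>p \<noteq> q\<close> unfolding a_def b_def coroot_def by auto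
  then obtain na nb where n: "a = real na" "b = real nb"
    by (metis Ints_cases nonneg_int_cases of_int_0_le_iff of_int_of_nat_eq)
  have zero: "na = 0 \<longleftrightarrow> nb = 0"
  proof -
    have "a = 0 \<longleftrightarrow> b = 0"
      using simple_norm_nonzero[OF p] simple_norm_nonzero[OF q] form_symmetric[of "\<alpha> p" "\<alpha> q"]
      by (simp add: a_def b_def coroot_def)
    then show ?thesis by (simp add: n)
  qed
  have "\<exists>x y. rank_two_coeff a b k = (x, y) \<and> 0 \<le> x \<and> 0 \<le> y"
  proof (cases "na * nb \<ge> 4")
    case True
    then have "a * b \<ge> 4"
      unfolding n by (metis of_nat_le_iff of_nat_mult of_nat_numeral)
    then show ?thesis
      using rank_two_coeff_nonneg[OF \<open>a \<ge> 0\<close> \<open>b \<ge> 0\<close>, of k] by (auto simp: Let_def split: prod.splits)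
  next
    case False
    \<comment> \<open>Both integers vanish together, so one of them being at least 4 would already
      force the product to be at least 4.\<close>
    have "na \<le> 3 \<and> nb \<le> 3"
    proof (rule ccontr)
      assume "\<not> ?thesis"
      then have "na \<ge> 4 \<and> nb \<ge> 1 \<or> nb \<ge> 4 \<and> na \<ge> 1"
        using zero by arith
      then have "na * nb \<ge> 4"
        using mult_le_mono[of 4 na 1 nb] mult_le_mono[of 1 na 4 nb] by auto
      then show False using False by simp
    qed
    then have "na \<in> {0, 1, 2, 3}" "nb \<in> {0, 1, 2, 3}"
      by auto
    then have "\<exists>m. (na, nb, m) \<in> {(0,0,2), (1,1,3), (1,2,4), (2,1,4), (1,3,6), (3,1,6::nat)}"
      using False zero by auto
    then obtain m :: nat where m: "(na, nb, m) \<in> {(0,0,2), (1,1,3), (1,2,4), (2,1,4), (1,3,6), (3,1,6)}"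
      by blast
    have "k < m"
    proof (rule ccontr)
      assume "\<not> k < m"
      then show False
        using reduced[of m] braid_relation[OF p q _ _ m] m by (auto simp: n[symmetric] a_def b_def)
    qed
    then have "k = 0 \<or> k = Suc 0 \<or> m \<ge> 3 \<and> k = Suc (Suc 0) \<or> m \<ge> 4 \<and> k = Suc (Suc (Suc 0)) \<or>
        m \<ge> 6 \<and> k = Suc (Suc (Suc (Suc 0))) \<or> m \<ge> 6 \<and> k = Suc (Suc (Suc (Suc (Suc 0))))"
      using m by auto
    then have "0 \<le> fst (rank_two_coeff a b k) \<and> 0 \<le> snd (rank_two_coeff a b k)"
      using m unfolding n by auto
    then show ?thesis
      by (metis prod.collapse)
  qed
  then show ?thesis
    using alternating_word_simple[OF p q a_def b_def, of k] by (metis fst_conv snd_conv)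
qed

section \<open>Ascents and the sign of a root\<close>

lemma alternatingI:
  assumes "us \<in> lists {p, q}" "\<forall>xs t ys. us \<noteq> xs @ [t, t] @ ys" "us \<noteq> [] \<Longrightarrow> last us = q"
  shows "us = alternating p q (length us)"
  using assms
proof (induction us rule: list.induct)
  case (Cons t us)
  have "\<forall>xs t ys. us \<noteq> xs @ [t, t] @ ys"
  proof (intro allI notI)
    fix xs t' ys
    assume "us = xs @ [t', t'] @ ys"
    then show False
      using Cons.prems(2)[rule_format, of "t # xs" t' ys] by simp
  qed
  then have IH: "us = alternating p q (length us)"
    using Cons by (auto split: if_splits)
  show ?case
  proof (cases "length us")
    case 0
    then show ?thesis using Cons.prems(3) by simp
  next
    case (Suc n)
    then have us: "us = (if even n then q else p) # alternating p q n"
      using IH by simp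
    have "t \<noteq> (if even n then q else p)"
      using Cons.prems(2)[rule_format, of "[]" t "alternating p q n"] us by auto
    then have "t = (if even (Suc n) then q else p)"
      using Cons.prems(1) by auto
    then show ?thesis
      using IH Suc by simp
  qed
qed simp

text \<open>The problem is moved to the dihedral group of \<open>p\<close> and \<open>q\<close>,
  where \<open>q\<close> is the last letter of a reduced word of \<open>w\<close>. Splitting off the
  longest possible right factor from that group, with lengths adding, leaves a \<open>v\<close> that
  neither reflection shortens. Induction puts \<open>v (\<alpha> p)\<close> and
  \<open>v (\<alpha> q)\<close> in the cone, and the right factor sends \<open>\<alpha> p\<close> to
  a nonnegative combination of the two simple roots.\<close>

lemma ascent_simple_cone:
  assumes "w \<in> weyl_group" "p \<in> {1..r}" "wlength w \<le> wlength (w \<circ> reflection (\<alpha> p))"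
  shows "w (\<alpha> p) \<in> simple_cone"
  using assms
proof (induction "wlength w" arbitrary: w p rule: less_induct)
  case less
  show ?case
  proof (cases "w = id")
    case True
    then show ?thesis using less.prems simple_cone_simple by simp
  next
    case False
    obtain ps where ps: "ps \<in> lists {1..r}" "simple_word ps = w" "length ps = wlength w"
      using less.prems(1) by (rule reduced_word)
    then have "ps \<noteq> []" using False by auto
    then obtain qs q where qs: "ps = qs @ [q]"
      by (metis rev_exhaust)
    have q: "q \<in> {1..r}" and qs_lists: "qs \<in> lists {1..r}"
      using ps(1) qs by auto
    have w_qs: "w = simple_word qs \<circ> reflection (\<alpha> q)"
      using ps(2) qs by (simp add: simple_word_append)
    then have "w \<circ> reflection (\<alpha> q) = simple_word qs"
      using reflection_involutive[OF simple_norm_nonzero[OF q]] by (auto simp: fun_eq_iff)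
    then have "wlength (w \<circ> reflection (\<alpha> q)) < wlength w"
      using wlength_le[OF qs_lists] ps(3) qs by simp
    then have "p \<noteq> q" using less.prems(3) by auto
    \<comment> \<open>Pairs of a left factor and a word in \<open>p\<close> and \<open>q\<close>
      that factor \<open>w\<close> with lengths adding; one with the longest word is chosen
      below.\<close>
    define good where "good x \<longleftrightarrow> fst x \<in> weyl_group \<and> snd x \<in> lists {p, q} \<and>
      w = fst x \<circ> simple_word (snd x) \<and> wlength (fst x) + length (snd x) = wlength w" for x
    have "wlength w \<le> wlength (simple_word qs) + 1"
      using wlength_comp_le[OF weyl_groupI[OF qs_lists], of "[q]"] q w_qs by simp
    then have "good (simple_word qs, [q])"
      using w_qs wlength_le[OF qs_lists] ps(3) qs by (simp add: good_def weyl_groupI[OF qs_lists])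
    moreover have "\<forall>x. good x \<longrightarrow> length (snd x) \<le> wlength w"
      by (auto simp: good_def)
    ultimately have "\<exists>x. good x \<and> (\<forall>y. good y \<longrightarrow> length (snd y) \<le> length (snd x))"
      using ex_has_greatest_nat[of good "(simple_word qs, [q])" "\<lambda>x. length (snd x)" "wlength w + 1"] by force
    then obtain x where x: "good x" "\<And>y. good y \<Longrightarrow> length (snd y) \<le> length (snd x)"
      by auto
    define v us where "v = fst x" and "us = snd x"
    have v: "v \<in> weyl_group" and us: "us \<in> lists {p, q}" and w: "w = v \<circ> simple_word us"
      and len: "wlength v + length us = wlength w"
      using x(1) unfolding good_def v_def us_def by auto
    have us_r: "zs \<in> lists {1..r}" if "zs \<in> lists {p, q}" for zs
      using that less.prems(2) q by auto
    have "length us \<ge> 1"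
      using x(2)[OF \<open>good (simple_word qs, [q])\<close>] by (simp add: us_def)
    \<comment> \<open>If \<open>t\<close> shortened \<open>v\<close>, it could be moved to the front
      of \<open>us\<close>, which would then not be longest.\<close>
    have v_up: "wlength v \<le> wlength (v \<circ> reflection (\<alpha> t))" if t: "t \<in> {p, q}" for t
    proof (rule ccontr)
      assume neg: "\<not> ?thesis"
      have tr: "t \<in> {1..r}" using t less.prems(2) q by auto
      have vt: "v \<circ> reflection (\<alpha> t) \<in> weyl_group"
        using weyl_group_comp[OF v simple_reflection_in_weyl_group[OF tr]] .
      have w': "w = (v \<circ> reflection (\<alpha> t)) \<circ> simple_word (t # us)"
        using reflection_involutive[OF simple_norm_nonzero[OF tr]] by (auto simp: fun_eq_iff w)
      have "wlength w \<le> wlength (v \<circ> reflection (\<alpha> t)) + length (t # us)"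
        using wlength_comp_le[OF vt us_r[of "t # us"]] t us w' by simp
      then have "good (v \<circ> reflection (\<alpha> t), t # us)"
        using w' vt us t neg len by (simp add: good_def)
      then show False
        using x(2) us_def by fastforce
    qed
    have cone: "v (\<alpha> t) \<in> simple_cone" if "t \<in> {p, q}" for t
      using less.hyps[of v t] v_up[OF that] that v len \<open>length us \<ge> 1\<close> less.prems(2) q by auto
    have shortest: "length us \<le> length zs" if "zs \<in> lists {p, q}" "simple_word zs = simple_word us" for zs
      using wlength_comp_le[OF v us_r[OF that(1)]] that(2) w len by simp
    \<comment> \<open>A replacement of \<open>us\<close> that ends in \<open>p\<close> and is no
      longer would let the reflection in \<open>\<alpha> p\<close> shorten \<open>w\<close> from the
      right.\<close>
    have no_end: "simple_word us \<noteq> simple_word (zs @ [p])" if "zs \<in> lists {p, q}" "length zs < length us" for zs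
    proof
      assume "simple_word us = simple_word (zs @ [p])"
      then have "w \<circ> reflection (\<alpha> p) = v \<circ> simple_word zs"
        using reflection_involutive[OF simple_norm_nonzero[OF less.prems(2)]]
        by (auto simp: fun_eq_iff w simple_word_append)
      then show False
        using wlength_comp_le[OF v us_r[OF that(1)]] less.prems(3) that(2) len by simp
    qed
    have alt: "us = alternating p q (length us)"
    proof (rule alternatingI[OF us])
      show "\<forall>xs t ys. us \<noteq> xs @ [t, t] @ ys"
      proof (intro allI notI)
        fix xs t ys
        assume eq: "us = xs @ [t, t] @ ys"
        then have "t \<in> {1..r}" using us less.prems(2) q by auto
        then have "simple_word (xs @ ys) = simple_word us"
          using reflection_involutive[OF simple_norm_nonzero] by (auto simp: eq fun_eq_iff simple_word_append)
        then show False
          using shortest[of "xs @ ys"] us eq by auto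
      qed
      show "last us = q" if "us \<noteq> []"
      proof (rule ccontr)
        assume "last us \<noteq> q"
        then have "us = butlast us @ [p]"
          using us that by (metis append_butlast_last_id insert_iff in_listsD last_in_set singletonD)
        then show False
          using no_end[of "butlast us"] us that by (metis append_in_lists_conv length_append_singleton lessI)
      qed
    qed
    \<comment> \<open>If the two alternating words of length \<open>m\<close> agreed, the tail of
      \<open>us\<close> could be exchanged for the one ending in \<open>p\<close>.\<close>
    have "simple_word (alternating p q m) \<noteq> simple_word (alternating q p m)" if m: "1 \<le> m" "m \<le> length us" for m
    proof
      assume eq: "simple_word (alternating p q m) = simple_word (alternating q p m)"
      obtain zs where zs: "zs \<in> lists {p, q}" "us = zs @ alternating p q m"
        using alternating_add[of p q "length us - m" m] m alt by auto
      obtain n where n: "m = Suc n" using m by (cases m) auto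
      have "simple_word us = simple_word ((zs @ alternating p q n) @ [p])"
        unfolding zs(2) simple_word_append[of zs] eq unfolding n alternating_snoc
        by (simp add: simple_word_append o_assoc)
      moreover have "zs @ alternating p q n \<in> lists {p, q}"
        using zs us alternating.simps(2)[of p q n] unfolding n by (auto simp: in_lists_conv_set)
      moreover have "length (zs @ alternating p q n) < length us"
        using zs(2) n by simp
      ultimately show False using no_end by blast
    qed
    then obtain x y where xy: "x \<ge> 0" "y \<ge> 0" "simple_word us (\<alpha> p) = x *\<^sub>R \<alpha> p + y *\<^sub>R \<alpha> q"
      using alternating_word_nonneg[OF less.prems(2) q \<open>p \<noteq> q\<close>, of "length us"] alt by metis
    have "w (\<alpha> p) = x *\<^sub>R v (\<alpha> p) + y *\<^sub>R v (\<alpha> q)"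
      using xy(3) v by (simp add: w weyl_group_add weyl_group_scale)
    then show ?thesis
      using cone xy by (simp add: simple_cone_add simple_cone_scale)
  qed
qed

text \<open>One of \<open>w\<close> and its product with the reflection in \<open>\<alpha> p\<close>
  is not shortened by that reflection, and the two send \<open>\<alpha> p\<close> to opposite
  vectors.\<close>

lemma root_pos_or_neg:
  assumes "a \<in> roots" shows "a \<in> pos_roots \<or> - a \<in> pos_roots"
proof -
  obtain p w where w: "p \<in> {1..r}" "w \<in> weyl_group" "a = w (\<alpha> p)"
    using assms by (rule rootsE)
  let ?s = "reflection (\<alpha> p)"
  have ws: "w \<circ> ?s \<in> weyl_group" "w \<circ> ?s \<circ> ?s = w"
    using weyl_group_comp[OF w(2) simple_reflection_in_weyl_group[OF w(1)]]
      reflection_involutive[OF simple_norm_nonzero[OF w(1)]] by (auto simp: fun_eq_iff)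
  have "a \<in> simple_cone \<or> - a \<in> simple_cone"
  proof (cases "wlength w \<le> wlength (w \<circ> ?s)")
    case True
    then show ?thesis using ascent_simple_cone w by simp
  next
    case False
    then have "(w \<circ> ?s) (\<alpha> p) \<in> simple_cone"
      using ascent_simple_cone[OF ws(1) w(1)] ws(2) by simp
    then show ?thesis
      using w by (simp add: reflection_self simple_norm_nonzero weyl_group_uminus)
  qed
  then show ?thesis
    using assms uminus_roots[OF assms] by (auto simp: pos_roots_eq)
qed

lemma pos_roots_roots: "a \<in> pos_roots \<Longrightarrow> a \<in> roots"
  by (simp add: pos_roots_eq)

lemma uminus_pos_roots: 
  assumes "a \<in> pos_roots" shows "- a \<notin> pos_roots"
proof
  assume "- a \<in> pos_roots"
  then have "a = 0" using assms simple_cone_pointed by (simp add: pos_roots_eq)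
  then show False using root_norm_pos[OF pos_roots_roots[OF assms]] by simp
qed

lemma not_pos_iff: "a \<in> roots \<Longrightarrow> a \<notin> pos_roots \<longleftrightarrow> - a \<in> pos_roots"
  using root_pos_or_neg uminus_pos_roots by blast

lemma simple_pos_roots: "p \<in> {1..r} \<Longrightarrow> \<alpha> p \<in> pos_roots"
  by (simp add: pos_roots_eq simple_roots simple_cone_simple)

lemma pos_root_natE:
  assumes "a \<in> pos_roots"
  obtains c :: "nat \<Rightarrow> nat" where "a = (\<Sum>p\<in>{1..r}. real (c p) *\<^sub>R \<alpha> p)"
proof -
  obtain d where d: "\<forall>p\<in>{1..r}. d p \<in> \<int>" "a = (\<Sum>p\<in>{1..r}. d p *\<^sub>R \<alpha> p)"
    using roots_in_root_lattice[OF pos_roots_roots[OF assms]] unfolding root_lattice_def by blast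
  obtain c where c: "\<forall>p\<in>{1..r}. 0 \<le> c p" "a = (\<Sum>p\<in>{1..r}. c p *\<^sub>R \<alpha> p)"
    using assms unfolding pos_roots_def by blast
  have "\<forall>p\<in>{1..r}. 0 \<le> d p"
    using simple_coeff_unique[of c d] c d(2) by metis
  then have "\<exists>n. d p = real n" if "p \<in> {1..r}" for p
    using d(1) that by (metis Ints_cases nonneg_int_cases of_int_0_le_iff of_int_of_nat_eq)
  then obtain n where "\<And>p. p \<in> {1..r} \<Longrightarrow> d p = real (n p)"
    by metis
  then show ?thesis
    using that[of n] d(2) by simp
qed

lemma ht_sum_simple: "ht (\<Sum>p\<in>{1..r}. c p *\<^sub>R \<alpha> p) = (\<Sum>p\<in>{1..r}. c p)"
  using ht_linear ht_simple by (simp add: linear_sum linear_scale)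

lemma pos_root_ht: assumes "a \<in> pos_roots" shows "ht a \<ge> 1"
proof -
  obtain c :: "nat \<Rightarrow> nat" where c: "a = (\<Sum>p\<in>{1..r}. real (c p) *\<^sub>R \<alpha> p)"
    using assms by (rule pos_root_natE)
  have "(\<Sum>p\<in>{1..r}. c p) \<noteq> 0"
  proof
    assume "(\<Sum>p\<in>{1..r}. c p) = 0"
    then have "a = 0" using c by simp
    then show False using root_norm_pos[OF pos_roots_roots[OF assms]] by simp
  qed
  then have "1 \<le> (\<Sum>p\<in>{1..r}. c p)"
    by linarith
  then have "real 1 \<le> real (\<Sum>p\<in>{1..r}. c p)"
    by (simp only: of_nat_le_iff)
  then show ?thesis
    unfolding c ht_sum_simple by (simp only: of_nat_sum of_nat_1)
qed

text \<open>There may be infinitely many roots; finiteness below each height is what the later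
  counting of admissible subsets relies on.\<close>

lemma finite_pos_roots_ht: "finite {a \<in> pos_roots. ht a \<le> h}"
proof -
  let ?C = "PiE {1..r} (\<lambda>_. {..nat \<lfloor>h\<rfloor>})"
  have "{a \<in> pos_roots. ht a \<le> h} \<subseteq> (\<lambda>c. \<Sum>p\<in>{1..r}. real (c p) *\<^sub>R \<alpha> p) ` ?C"
  proof
    fix a assume a: "a \<in> {a \<in> pos_roots. ht a \<le> h}"
    then obtain c :: "nat \<Rightarrow> nat" where c: "a = (\<Sum>p\<in>{1..r}. real (c p) *\<^sub>R \<alpha> p)"
      using pos_root_natE by blast
    have "c p \<le> nat \<lfloor>h\<rfloor>" if "p \<in> {1..r}" for p
    proof -
      have "real (c p) \<le> (\<Sum>p\<in>{1..r}. real (c p))"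
        using that by (intro member_le_sum) auto
      also have "\<dots> \<le> h" using a ht_sum_simple[of "\<lambda>p. real (c p)"] c by simp
      finally show ?thesis by linarith
    qed
    then show "a \<in> (\<lambda>c. \<Sum>p\<in>{1..r}. real (c p) *\<^sub>R \<alpha> p) ` ?C"
      by (intro image_eqI[of _ _ "restrict c {1..r}"]) (auto simp: c)
  qed
  then show ?thesis
    by (rule finite_subset) (intro finite_imageI finite_PiE; simp)
qed

text \<open>Were the image negative, then \<open>a\<close> minus its image, a multiple of
  \<open>\<alpha> p\<close>, would be a sum of two nonnegative combinations, so \<open>a\<close>
  itself would be a multiple of \<open>\<alpha> p\<close>.\<close>

lemma simple_reflection_pos:
  assumes a: "a \<in> pos_roots" and p: "p \<in> {1..r}" and "a \<noteq> \<alpha> p"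
  shows "reflection (\<alpha> p) a \<in> pos_roots"
proof (rule ccontr)
  assume "\<not> ?thesis"
  moreover have "reflection (\<alpha> p) a \<in> roots"
    using weyl_group_roots[OF simple_reflection_in_weyl_group[OF p] pos_roots_roots[OF a]] .
  ultimately have "- reflection (\<alpha> p) a \<in> pos_roots"
    using root_pos_or_neg by blast
  then obtain d :: "nat \<Rightarrow> nat" where d: "- reflection (\<alpha> p) a = (\<Sum>q\<in>{1..r}. real (d q) *\<^sub>R \<alpha> q)"
    by (rule pos_root_natE)
  obtain c :: "nat \<Rightarrow> nat" where c: "a = (\<Sum>q\<in>{1..r}. real (c q) *\<^sub>R \<alpha> q)"
    using a by (rule pos_root_natE)
  define m where "m = form a (coroot (\<alpha> p))"
  have eq: "(\<Sum>q\<in>{1..r}. (real (c q) + real (d q)) *\<^sub>R \<alpha> q) = (\<Sum>q\<in>{1..r}. (m * (if q = p then 1 else 0)) *\<^sub>R \<alpha> q)"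
  proof -
    have "(\<Sum>q\<in>{1..r}. (m * (if q = p then 1 else 0)) *\<^sub>R \<alpha> q) = m *\<^sub>R \<alpha> p"
      by (subst simple_eq_sum[OF p]) (simp add: scaleR_sum_right)
    moreover have "a + - reflection (\<alpha> p) a = m *\<^sub>R \<alpha> p"
      by (simp add: reflection_def m_def)
    ultimately show ?thesis
      by (simp only: scaleR_add_left sum.distrib c[symmetric] d[symmetric])
  qed
  have zero: "c q = 0" if "q \<in> {1..r}" "q \<noteq> p" for q
    using simple_coeff_unique[OF eq that(1)] that(2) by simp
  have ac: "a = real (c p) *\<^sub>R \<alpha> p"
    using c p by (simp add: zero sum.remove)
  \<comment> \<open>It remains to see that the multiple is 1. Moving \<open>a\<close> back to a
    simple root writes \<open>\<alpha> q\<close> as this natural number times a vector of the root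
    lattice, and comparing coefficients at \<open>\<alpha> q\<close> makes the number a divisor of
    1.\<close>
  obtain q w where w: "q \<in> {1..r}" "w \<in> weyl_group" "a = w (\<alpha> q)"
    using pos_roots_roots[OF a] by (rule rootsE)
  obtain w' where w': "w' \<in> weyl_group" "w \<circ> w' = id" "w' \<circ> w = id"
    using w(2) by (rule weyl_group_inverse)
  have "\<alpha> q = real (c p) *\<^sub>R w' (\<alpha> p)"
    using ac w w' by (metis comp_apply id_apply weyl_group_scale)
  moreover obtain e where e: "\<forall>t\<in>{1..r}. e t \<in> \<int>" "w' (\<alpha> p) = (\<Sum>t\<in>{1..r}. e t *\<^sub>R \<alpha> t)"
    using weyl_group_root_lattice[OF w'(1) root_lattice_simple[OF p]] unfolding root_lattice_def by blast
  ultimately have "(\<Sum>t\<in>{1..r}. (if t = q then 1 else 0) *\<^sub>R \<alpha> t) = (\<Sum>t\<in>{1..r}. (real (c p) * e t) *\<^sub>R \<alpha> t)"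
    using simple_eq_sum[OF w(1)] by (simp add: scaleR_sum_right)
  then have "1 = real (c p) * e q"
    using simple_coeff_unique[of "\<lambda>t. if t = q then 1 else 0" "\<lambda>t. real (c p) * e t" q] w(1) by simp
  moreover obtain z where "e q = of_int z"
    using e(1) w(1) Ints_cases by metis
  ultimately have "1 = int (c p) * z"
    by (metis of_int_1 of_int_eq_iff of_int_mult of_int_of_nat_eq)
  then have "c p = 1"
    by (metis dvd_triv_left of_nat_1_eq_iff zdvd1_eq abs_of_nat)
  then show False
    using ac \<open>a \<noteq> \<alpha> p\<close> by simp
qed

subsection \<open>Reflections and the length function\<close>

text \<open>Let the letters act on \<open>a\<close> from the right. A letter that turns the root
  from positive to negative must meet its own simple root, and then the reflection in
  \<open>a\<close> cancels exactly that letter.\<close>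

lemma strong_exchange:
  assumes "ps \<in> lists {1..r}" "a \<in> pos_roots" "simple_word ps a \<notin> pos_roots"
  shows "\<exists>qs\<in>lists {1..r}. simple_word ps \<circ> reflection a = simple_word qs \<and> length qs < length ps"
  using assms
proof (induction ps rule: list.induct)
  case (Cons p ps)
  have p: "p \<in> {1..r}" and ps: "ps \<in> lists {1..r}" using Cons.prems(1) by auto
  let ?b = "simple_word ps a"
  show ?case
  proof (cases "?b \<in> pos_roots")
    case True
    then have b: "?b = \<alpha> p"
      using Cons.prems(3) simple_reflection_pos[OF True p] by auto
    have "reflection (\<alpha> p) (simple_word ps (reflection a v)) = simple_word ps v" for v
      using weyl_group_conjugate[OF weyl_groupI[OF ps], of a v] b reflection_involutive[OF simple_norm_nonzero[OF p]]
      by metis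
    then have "simple_word (p # ps) \<circ> reflection a = simple_word ps"
      by (auto simp: fun_eq_iff)
    then show ?thesis
      using ps by (metis length_Cons lessI)
  next
    case False
    then obtain qs where qs: "qs \<in> lists {1..r}" "simple_word ps \<circ> reflection a = simple_word qs" "length qs < length ps"
      using Cons.IH[OF ps Cons.prems(2)] by blast
    have "simple_word (p # ps) \<circ> reflection a = simple_word (p # qs)"
      unfolding simple_word_simps(2) comp_assoc qs(2) ..
    moreover have "p # qs \<in> lists {1..r}"
      using qs(1) p by simp
    ultimately show ?thesis
      using qs(3) by (metis length_Cons Suc_less_eq)
  qed
qed simp

lemma wlength_reflection_down:
  assumes "w \<in> weyl_group" "a \<in> pos_roots" "w a \<notin> pos_roots"
  shows "wlength (w \<circ> reflection a) < wlength w"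
proof -
  obtain ps where ps: "ps \<in> lists {1..r}" "simple_word ps = w" "length ps = wlength w"
    using assms(1) by (rule reduced_word)
  then show ?thesis
    using strong_exchange[OF ps(1) assms(2)] assms(3) wlength_le by (metis le_less_trans)
qed

lemma weyl_group_reflection: "w \<in> weyl_group \<Longrightarrow> a \<in> roots \<Longrightarrow> w \<circ> reflection a \<in> weyl_group"
  using weyl_group_comp reflection_in_weyl_group by blast

lemma wlength_reflection_up:
  assumes "w \<in> weyl_group" "a \<in> pos_roots" "w a \<in> pos_roots"
  shows "wlength w < wlength (w \<circ> reflection a)"
proof -
  have a: "a \<in> roots" using assms(2) by (rule pos_roots_roots)
  have "(w \<circ> reflection a) a \<notin> pos_roots"
    using uminus_pos_roots[OF assms(3)] root_norm_pos[OF a] assms(1)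
    by (simp add: reflection_self weyl_group_uminus)
  then have "wlength (w \<circ> reflection a \<circ> reflection a) < wlength (w \<circ> reflection a)"
    using wlength_reflection_down[OF weyl_group_reflection[OF assms(1) a] assms(2)] by blast
  moreover have "w \<circ> reflection a \<circ> reflection a = w"
    using reflection_root_involutive[OF a] by (auto simp: fun_eq_iff)
  ultimately show ?thesis by simp
qed

lemma reflection_left:
  assumes "w \<in> weyl_group" shows "reflection (w b) \<circ> w = w \<circ> reflection b"
  using weyl_group_conjugate[OF assms] by (auto simp: fun_eq_iff)

lemma weyl_group_preimage_root:
  assumes "w \<in> weyl_group" "a \<in> roots"
  obtains b where "b \<in> roots" "a = w b"
proof -
  obtain w' where w': "w' \<in> weyl_group" "w \<circ> w' = id" "w' \<circ> w = id"
    using assms(1) by (rule weyl_group_inverse)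
  then show ?thesis
    using that[of "w' a"] weyl_group_roots[OF w'(1) assms(2)] by (simp add: fun_eq_iff)
qed

text \<open>\<open>a \<in> w ` pos_roots\<close> is how we say that \<open>w\<^sup>-\<^sup>1 a > 0\<close>.\<close>

lemma wlength_simple_left_up:
  assumes w: "w \<in> weyl_group" and p: "p \<in> {1..r}" and up: "\<alpha> p \<in> w ` pos_roots"
  shows "wlength (reflection (\<alpha> p) \<circ> w) = wlength w + 1"
proof -
  obtain b where b: "b \<in> pos_roots" "\<alpha> p = w b" using up by blast
  have "wlength w < wlength (reflection (\<alpha> p) \<circ> w)"
    using wlength_reflection_up[OF w b(1)] simple_pos_roots[OF p] reflection_left[OF w, of b] b by simp
  then show ?thesis using wlength_simple_left[OF w p] by simp
qed

text \<open>The preimages of \<open>\<alpha> p\<close> under the two elements are opposite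
  roots.\<close>

lemma simple_left_image:
  assumes w: "w \<in> weyl_group" and p: "p \<in> {1..r}"
  shows "\<alpha> p \<in> (reflection (\<alpha> p) \<circ> w) ` pos_roots \<longleftrightarrow> \<alpha> p \<notin> w ` pos_roots"
proof -
  obtain b where b: "b \<in> roots" "\<alpha> p = w b"
    using weyl_group_preimage_root[OF w simple_roots[OF p]] .
  have "\<alpha> p \<in> w ` pos_roots \<longleftrightarrow> b \<in> pos_roots"
    using b w by (auto simp: weyl_group_inj)
  moreover have "\<alpha> p = (reflection (\<alpha> p) \<circ> w) (- b)"
    using b w p reflection_self[OF simple_norm_nonzero[OF p]] linear_neg[OF linear_reflection]
    by (simp add: weyl_group_uminus)
  then have "\<alpha> p \<in> (reflection (\<alpha> p) \<circ> w) ` pos_roots \<longleftrightarrow> - b \<in> pos_roots"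
    using weyl_group_inj[OF weyl_group_comp[OF simple_reflection_in_weyl_group[OF p] w]]
    by (metis image_iff)
  ultimately show ?thesis using not_pos_iff[OF b(1)] by blast
qed

lemma wlength_simple_left_down:
  assumes w: "w \<in> weyl_group" and p: "p \<in> {1..r}" and down: "\<alpha> p \<notin> w ` pos_roots"
  shows "wlength w = wlength (reflection (\<alpha> p) \<circ> w) + 1"
proof -
  let ?w = "reflection (\<alpha> p) \<circ> w"
  have "?w \<in> weyl_group"
    using weyl_group_comp[OF simple_reflection_in_weyl_group[OF p] w] .
  moreover have "reflection (\<alpha> p) \<circ> ?w = w"
    using reflection_involutive[OF simple_norm_nonzero[OF p]] by (auto simp: fun_eq_iff)
  ultimately show ?thesis
    using wlength_simple_left_up[of ?w p] simple_left_image[OF w p] down p by simp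
qed

lemma cover_pos:
  assumes "w \<in> weyl_group" "a \<in> pos_roots" "wlength (w \<circ> reflection a) = wlength w + 1"
  shows "w a \<in> pos_roots"
  using wlength_reflection_down[OF assms(1,2)] assms(3) by force

text \<open>If both ends of a cover lie on the same side of the wall of \<open>\<alpha> p\<close>, then the cover can be
  reflected; and a cover can only leave the positive side by crossing that very wall.\<close>

lemma cover_leaves_positive:
  assumes w: "w \<in> weyl_group" and p: "p \<in> {1..r}" and a: "a \<in> pos_roots"
    and cover: "wlength (w \<circ> reflection a) = wlength w + 1"
    and pos: "\<alpha> p \<in> w ` pos_roots" and neg: "\<alpha> p \<notin> (w \<circ> reflection a) ` pos_roots"
  shows "w a = \<alpha> p"
proof (rule ccontr)
  assume "w a \<noteq> \<alpha> p"
  let ?s = "reflection (\<alpha> p)"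
  have sw: "?s \<circ> w \<in> weyl_group" and wr: "w \<circ> reflection a \<in> weyl_group"
    using weyl_group_comp simple_reflection_in_weyl_group[OF p] w weyl_group_reflection pos_roots_roots[OF a]
    by blast+
  have "?s (w a) \<in> pos_roots"
    using simple_reflection_pos[OF cover_pos[OF w a cover] p \<open>w a \<noteq> \<alpha> p\<close>] .
  then have "wlength (?s \<circ> w) < wlength (?s \<circ> w \<circ> reflection a)"
    using wlength_reflection_up[OF sw a] by simp
  moreover have "wlength (?s \<circ> w) = wlength w + 1"
    using wlength_simple_left_up[OF w p pos] .
  moreover have "wlength (w \<circ> reflection a) = wlength (?s \<circ> w \<circ> reflection a) + 1"
    using wlength_simple_left_down[OF wr p neg] by (simp add: comp_assoc)
  ultimately show False using cover by simp
qed

lemma simple_left_cover: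
  assumes w: "w \<in> weyl_group" and p: "p \<in> {1..r}" and a: "a \<in> roots"
    and "\<alpha> p \<in> w ` pos_roots \<longleftrightarrow> \<alpha> p \<in> (w \<circ> reflection a) ` pos_roots"
  shows "wlength (reflection (\<alpha> p) \<circ> w \<circ> reflection a) = wlength (reflection (\<alpha> p) \<circ> w) + 1
    \<longleftrightarrow> wlength (w \<circ> reflection a) = wlength w + 1"
proof -
  note wr = weyl_group_reflection[OF w a]
  show ?thesis
  proof (cases "\<alpha> p \<in> w ` pos_roots")
    case True
    then show ?thesis
      using wlength_simple_left_up[OF w p] wlength_simple_left_up[OF wr p] assms(4) by (simp add: comp_assoc)
  next
    case False
    then have "wlength w = wlength (reflection (\<alpha> p) \<circ> w) + 1"
      "wlength (w \<circ> reflection a) = wlength (reflection (\<alpha> p) \<circ> w \<circ> reflection a) + 1"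
      using wlength_simple_left_down[OF w p] wlength_simple_left_down[OF wr p] assms(4) by (simp_all add: comp_assoc)
    then show ?thesis by simp
  qed
qed

text \<open>A simple reflection changes the length, and by at most one. Simple reflections are
  enough, since the cancelling terms are paired by them.\<close>

lemma wlength_parity_simple:
  assumes w: "w \<in> weyl_group" and p: "p \<in> {1..r}"
  shows "(-1 :: int) ^ wlength (w \<circ> reflection (\<alpha> p)) = - ((-1) ^ wlength w)"
proof -
  let ?s = "reflection (\<alpha> p)"
  have le: "wlength (v \<circ> ?s) \<le> wlength v + 1" if "v \<in> weyl_group" for v
    using wlength_comp_le[OF that, of "[p]"] p by simp
  have ws: "w \<circ> ?s \<in> weyl_group" "w \<circ> ?s \<circ> ?s = w"
    using weyl_group_reflection[OF w simple_roots[OF p]] reflection_involutive[OF simple_norm_nonzero[OF p]]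
    by (auto simp: fun_eq_iff)
  have "wlength (w \<circ> ?s) \<noteq> wlength w"
    using wlength_reflection_down[OF w simple_pos_roots[OF p]] wlength_reflection_up[OF w simple_pos_roots[OF p]]
    by (cases "w (\<alpha> p) \<in> pos_roots") auto
  then have "wlength (w \<circ> ?s) = wlength w + 1 \<or> wlength w = wlength (w \<circ> ?s) + 1"
    using le[OF w] le[OF ws(1)] ws(2) by auto
  then show ?thesis
    by (elim disjE) (simp_all add: power_add)
qed

section \<open>The ring of formal characters\<close>

lemma ht_simps: "ht (u + v) = ht u + ht v" "ht (u - v) = ht u - ht v" "ht (t *\<^sub>R v) = t * ht v" "ht 0 = 0"
  using ht_linear by (simp_all add: linear_add linear_diff linear_scale linear_0)

lemma weights_add: "u \<in> weights \<Longrightarrow> v \<in> weights \<Longrightarrow> u + v \<in> weights"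
  by (simp add: weights_def)

lemma weights_diff: "u \<in> weights \<Longrightarrow> v \<in> weights \<Longrightarrow> u - v \<in> weights"
  by (simp add: weights_def)

lemma weights_zero: "0 \<in> weights"
  by (simp add: weights_def)

lemma char_ring_carrier:
  "c \<in> carrier char_ring \<longleftrightarrow> (\<forall>\<nu>. c \<nu> \<noteq> 0 \<longrightarrow> \<nu> \<in> weights) \<and> (\<forall>h. finite {\<nu>. c \<nu> \<noteq> 0 \<and> ht \<nu> > h})"
  by (auto simp: char_ring_def)

lemma char_ring_simps:
  "c \<oplus>\<^bsub>char_ring\<^esub> d = (\<lambda>\<nu>. c \<nu> + d \<nu>)" "\<zero>\<^bsub>char_ring\<^esub> = (\<lambda>\<nu>. 0)"
  "\<one>\<^bsub>char_ring\<^esub> = (\<lambda>\<nu>. if \<nu> = 0 then 1 else 0)"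
  by (simp_all add: char_ring_def)

lemma char_ring_finite:
  assumes "c \<in> carrier char_ring" shows "finite {\<nu>. c \<nu> \<noteq> 0 \<and> ht \<nu> \<ge> h}"
proof -
  have "finite {\<nu>. c \<nu> \<noteq> 0 \<and> ht \<nu> > h - 1}"
    using assms by (auto simp: char_ring_carrier)
  then show ?thesis
    by (rule rev_finite_subset) auto
qed

lemma char_ring_bounded:
  assumes "c \<in> carrier char_ring"
  shows "\<exists>h. \<forall>\<nu>. c \<nu> \<noteq> 0 \<longrightarrow> ht \<nu> \<le> h"
proof -
  let ?S = "insert 0 (ht ` {\<nu>. c \<nu> \<noteq> 0 \<and> ht \<nu> \<ge> 0})"
  have "finite ?S" using char_ring_finite[OF assms] by simp
  have "ht \<nu> \<le> Max ?S" if "c \<nu> \<noteq> 0" for \<nu>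
  proof (cases "ht \<nu> \<ge> 0")
    case True
    then show ?thesis using \<open>finite ?S\<close> that by (intro Max_ge) auto
  next
    case False
    then show ?thesis using Max_ge[OF \<open>finite ?S\<close>, of 0] by simp
  qed
  then show ?thesis by blast
qed

lemma char_ring_mult_finite:
  assumes "c \<in> carrier char_ring" "d \<in> carrier char_ring"
  shows "finite {\<mu>. c \<mu> \<noteq> 0 \<and> d (\<nu> - \<mu>) \<noteq> 0}"
proof -
  obtain h where h: "\<And>\<nu>. d \<nu> \<noteq> 0 \<Longrightarrow> ht \<nu> \<le> h"
    using char_ring_bounded[OF assms(2)] by blast
  have "{\<mu>. c \<mu> \<noteq> 0 \<and> d (\<nu> - \<mu>) \<noteq> 0} \<subseteq> {\<mu>. c \<mu> \<noteq> 0 \<and> ht \<mu> \<ge> ht \<nu> - h}"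
    using h by (force simp: ht_simps)
  then show ?thesis
    using char_ring_finite[OF assms(1)] finite_subset by blast
qed

text \<open>Allowing any finite superset of the contributing exponents lets several convolutions
  share one index set.\<close>

lemma char_ring_mult_eq:
  assumes "finite T" "{\<mu>. c \<mu> \<noteq> 0 \<and> d (\<nu> - \<mu>) \<noteq> 0} \<subseteq> T"
  shows "(c \<otimes>\<^bsub>char_ring\<^esub> d) \<nu> = (\<Sum>\<mu>\<in>T. c \<mu> * d (\<nu> - \<mu>))"
  unfolding char_ring_def using assms by (auto intro!: sum.mono_neutral_left)

lemma char_ring_mult_support:
  assumes "(c \<otimes>\<^bsub>char_ring\<^esub> d) \<nu> \<noteq> 0"
  obtains \<mu> where "c \<mu> \<noteq> 0" "d (\<nu> - \<mu>) \<noteq> 0"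
proof -
  have "(\<Sum>\<mu> | c \<mu> \<noteq> 0 \<and> d (\<nu> - \<mu>) \<noteq> 0. c \<mu> * d (\<nu> - \<mu>)) \<noteq> 0"
    using assms by (simp add: char_ring_def)
  then have "{\<mu>. c \<mu> \<noteq> 0 \<and> d (\<nu> - \<mu>) \<noteq> 0} \<noteq> {}"
    by (metis sum.empty)
  then show ?thesis using that by blast
qed

lemma char_ring_mult_closed:
  assumes c: "c \<in> carrier char_ring" and d: "d \<in> carrier char_ring"
  shows "c \<otimes>\<^bsub>char_ring\<^esub> d \<in> carrier char_ring"
  unfolding char_ring_carrier
proof (intro conjI allI impI)
  fix \<nu> assume "(c \<otimes>\<^bsub>char_ring\<^esub> d) \<nu> \<noteq> 0"
  then obtain \<mu> where "c \<mu> \<noteq> 0" "d (\<nu> - \<mu>) \<noteq> 0"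
    by (rule char_ring_mult_support)
  then show "\<nu> \<in> weights"
    using c d weights_add[of \<mu> "\<nu> - \<mu>"] by (simp add: char_ring_carrier)
next
  fix h
  obtain hc where hc: "\<And>\<nu>. c \<nu> \<noteq> 0 \<Longrightarrow> ht \<nu> \<le> hc" using char_ring_bounded[OF c] by blast
  obtain hd where hd: "\<And>\<nu>. d \<nu> \<noteq> 0 \<Longrightarrow> ht \<nu> \<le> hd" using char_ring_bounded[OF d] by blast
  let ?S = "{\<nu>. c \<nu> \<noteq> 0 \<and> ht \<nu> \<ge> h - hd}" and ?T = "{\<nu>. d \<nu> \<noteq> 0 \<and> ht \<nu> \<ge> h - hc}"
  have "{\<nu>. (c \<otimes>\<^bsub>char_ring\<^esub> d) \<nu> \<noteq> 0 \<and> ht \<nu> > h} \<subseteq> (\<lambda>(x, y). x + y) ` (?S \<times> ?T)"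
  proof
    fix \<nu> assume \<nu>: "\<nu> \<in> {\<nu>. (c \<otimes>\<^bsub>char_ring\<^esub> d) \<nu> \<noteq> 0 \<and> ht \<nu> > h}"
    then have "(c \<otimes>\<^bsub>char_ring\<^esub> d) \<nu> \<noteq> 0" by simp
    then obtain \<mu> where \<mu>: "c \<mu> \<noteq> 0" "d (\<nu> - \<mu>) \<noteq> 0"
      by (rule char_ring_mult_support)
    have "ht \<mu> + ht (\<nu> - \<mu>) > h" using \<nu> by (simp add: ht_simps)
    then have "(\<mu>, \<nu> - \<mu>) \<in> ?S \<times> ?T"
      using \<mu> hc[OF \<mu>(1)] hd[OF \<mu>(2)] by auto
    then show "\<nu> \<in> (\<lambda>(x, y). x + y) ` (?S \<times> ?T)"
      by (intro image_eqI[of _ _ "(\<mu>, \<nu> - \<mu>)"]) simp_all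
  qed
  then show "finite {\<nu>. (c \<otimes>\<^bsub>char_ring\<^esub> d) \<nu> \<noteq> 0 \<and> ht \<nu> > h}"
    by (rule finite_subset) (intro finite_imageI finite_cartesian_product char_ring_finite c d)
qed

lemma char_ring_mult_comm:
  "c \<otimes>\<^bsub>char_ring\<^esub> d = d \<otimes>\<^bsub>char_ring\<^esub> c"
proof
  fix \<nu>
  have "(\<Sum>\<mu> | c \<mu> \<noteq> 0 \<and> d (\<nu> - \<mu>) \<noteq> 0. c \<mu> * d (\<nu> - \<mu>)) =
      (\<Sum>\<mu> | d \<mu> \<noteq> 0 \<and> c (\<nu> - \<mu>) \<noteq> 0. d \<mu> * c (\<nu> - \<mu>))"
    by (rule sum.reindex_bij_witness[of _ "\<lambda>\<mu>. \<nu> - \<mu>" "\<lambda>\<mu>. \<nu> - \<mu>"]) auto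
  then show "(c \<otimes>\<^bsub>char_ring\<^esub> d) \<nu> = (d \<otimes>\<^bsub>char_ring\<^esub> c) \<nu>"
    by (simp add: char_ring_def)
qed

lemma char_ring_mult_assoc:
  assumes c: "c \<in> carrier char_ring" and d: "d \<in> carrier char_ring" and e: "e \<in> carrier char_ring"
  shows "c \<otimes>\<^bsub>char_ring\<^esub> d \<otimes>\<^bsub>char_ring\<^esub> e = c \<otimes>\<^bsub>char_ring\<^esub> (d \<otimes>\<^bsub>char_ring\<^esub> e)"
proof
  fix \<nu>
  obtain hd where hd: "\<And>\<nu>. d \<nu> \<noteq> 0 \<Longrightarrow> ht \<nu> \<le> hd" using char_ring_bounded[OF d] by blast
  obtain he where he: "\<And>\<nu>. e \<nu> \<noteq> 0 \<Longrightarrow> ht \<nu> \<le> he" using char_ring_bounded[OF e] by blast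
  \<comment> \<open>Exponents of \<open>c\<close> high enough to be completed to \<nu> by exponents
    of \<open>d\<close> and \<open>e\<close>.\<close>
  define T where "T = {\<mu>. c \<mu> \<noteq> 0 \<and> ht \<mu> \<ge> ht \<nu> - hd - he}"
  have T: "finite T" using char_ring_finite[OF c] by (simp add: T_def)
  \<comment> \<open>The intermediate exponents, contributed by the first two factors
    together.\<close>
  define S where "S = (\<Union>\<mu>\<in>T. (\<lambda>\<tau>. \<mu> + \<tau>) ` {\<tau>. d \<tau> \<noteq> 0 \<and> e (\<nu> - \<mu> - \<tau>) \<noteq> 0})"
  have S: "finite S" using T char_ring_mult_finite[OF d e] by (auto simp: S_def)
  have TI: "\<mu> \<in> T" if "c \<mu> \<noteq> 0" "d (\<sigma> - \<mu>) \<noteq> 0" "e (\<nu> - \<sigma>) \<noteq> 0" for \<mu> \<sigma>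
    using that hd[OF that(2)] he[OF that(3)] by (simp add: T_def ht_simps)
  have SI: "\<sigma> \<in> S" if "\<mu> \<in> T" "d (\<sigma> - \<mu>) \<noteq> 0" "e (\<nu> - \<sigma>) \<noteq> 0" for \<mu> \<sigma>
    unfolding S_def using that by (intro UN_I[of \<mu>] image_eqI[of _ _ "\<sigma> - \<mu>"]) simp_all
  have "(c \<otimes>\<^bsub>char_ring\<^esub> d \<otimes>\<^bsub>char_ring\<^esub> e) \<nu> = (\<Sum>\<sigma>\<in>S. (c \<otimes>\<^bsub>char_ring\<^esub> d) \<sigma> * e (\<nu> - \<sigma>))"
  proof (rule char_ring_mult_eq[OF S], clarify)
    fix \<sigma> assume "(c \<otimes>\<^bsub>char_ring\<^esub> d) \<sigma> \<noteq> 0" and e': "e (\<nu> - \<sigma>) \<noteq> 0"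
    then obtain \<mu> where "c \<mu> \<noteq> 0" "d (\<sigma> - \<mu>) \<noteq> 0" by (rule_tac char_ring_mult_support)
    then show "\<sigma> \<in> S" using TI SI e' by blast
  qed
  also have "\<dots> = (\<Sum>\<sigma>\<in>S. \<Sum>\<mu>\<in>T. c \<mu> * d (\<sigma> - \<mu>) * e (\<nu> - \<sigma>))"
  proof (rule sum.cong[OF refl])
    fix \<sigma>
    show "(c \<otimes>\<^bsub>char_ring\<^esub> d) \<sigma> * e (\<nu> - \<sigma>) = (\<Sum>\<mu>\<in>T. c \<mu> * d (\<sigma> - \<mu>) * e (\<nu> - \<sigma>))"
    proof (cases "e (\<nu> - \<sigma>) = 0")
      case False
      then have "(c \<otimes>\<^bsub>char_ring\<^esub> d) \<sigma> = (\<Sum>\<mu>\<in>T. c \<mu> * d (\<sigma> - \<mu>))"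
        using TI by (intro char_ring_mult_eq T) blast
      then show ?thesis by (simp add: sum_distrib_right)
    qed simp
  qed
  also have "\<dots> = (\<Sum>\<mu>\<in>T. \<Sum>\<sigma>\<in>S. c \<mu> * d (\<sigma> - \<mu>) * e (\<nu> - \<sigma>))"
    by (rule sum.swap)
  also have "\<dots> = (\<Sum>\<mu>\<in>T. c \<mu> * (d \<otimes>\<^bsub>char_ring\<^esub> e) (\<nu> - \<mu>))"
  proof (rule sum.cong[OF refl])
    fix \<mu> assume \<mu>: "\<mu> \<in> T"
    let ?S = "(\<lambda>\<sigma>. \<sigma> - \<mu>) ` S"
    have "(d \<otimes>\<^bsub>char_ring\<^esub> e) (\<nu> - \<mu>) = (\<Sum>\<tau>\<in>?S. d \<tau> * e (\<nu> - \<mu> - \<tau>))"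
    proof (rule char_ring_mult_eq, use S in simp, clarify)
      fix \<tau> assume "d \<tau> \<noteq> 0" "e (\<nu> - \<mu> - \<tau>) \<noteq> 0"
      then show "\<tau> \<in> ?S"
        using SI[OF \<mu>, of "\<mu> + \<tau>"] by (intro image_eqI[of _ _ "\<mu> + \<tau>"]) (simp_all add: diff_diff_eq)
    qed
    also have "\<dots> = (\<Sum>\<sigma>\<in>S. d (\<sigma> - \<mu>) * e (\<nu> - \<sigma>))"
      by (subst sum.reindex) (auto simp: inj_on_def)
    finally show "(\<Sum>\<sigma>\<in>S. c \<mu> * d (\<sigma> - \<mu>) * e (\<nu> - \<sigma>)) = c \<mu> * (d \<otimes>\<^bsub>char_ring\<^esub> e) (\<nu> - \<mu>)"
      by (simp add: sum_distrib_left mult.assoc)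
  qed
  also have "\<dots> = (c \<otimes>\<^bsub>char_ring\<^esub> (d \<otimes>\<^bsub>char_ring\<^esub> e)) \<nu>"
  proof (rule char_ring_mult_eq[symmetric, OF T], clarify)
    fix \<mu> assume "c \<mu> \<noteq> 0" "(d \<otimes>\<^bsub>char_ring\<^esub> e) (\<nu> - \<mu>) \<noteq> 0"
    moreover from this(2) obtain \<tau> where "d \<tau> \<noteq> 0" "e (\<nu> - \<mu> - \<tau>) \<noteq> 0"
      by (rule char_ring_mult_support)
    ultimately show "\<mu> \<in> T"
      using TI[of \<mu> "\<mu> + \<tau>"] by (simp add: diff_diff_eq)
  qed
  finally show "(c \<otimes>\<^bsub>char_ring\<^esub> d \<otimes>\<^bsub>char_ring\<^esub> e) \<nu> = (c \<otimes>\<^bsub>char_ring\<^esub> (d \<otimes>\<^bsub>char_ring\<^esub> e)) \<nu>" .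
qed

lemma char_ring_add_closed:
  assumes "c \<in> carrier char_ring" "d \<in> carrier char_ring"
  shows "(\<lambda>\<nu>. c \<nu> + d \<nu>) \<in> carrier char_ring"
  unfolding char_ring_carrier
proof (intro conjI allI impI)
  fix \<nu> assume "c \<nu> + d \<nu> \<noteq> 0"
  then have "c \<nu> \<noteq> 0 \<or> d \<nu> \<noteq> 0" by auto
  then show "\<nu> \<in> weights" using assms by (auto simp: char_ring_carrier)
next
  fix h
  have "finite ({\<nu>. c \<nu> \<noteq> 0 \<and> ht \<nu> > h} \<union> {\<nu>. d \<nu> \<noteq> 0 \<and> ht \<nu> > h})"
    using assms by (auto simp: char_ring_carrier)
  then show "finite {\<nu>. c \<nu> + d \<nu> \<noteq> 0 \<and> ht \<nu> > h}"
    by (rule rev_finite_subset) auto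
qed

lemma char_ring_uminus_closed: "c \<in> carrier char_ring \<Longrightarrow> (\<lambda>\<nu>. - c \<nu>) \<in> carrier char_ring"
  by (simp add: char_ring_carrier)

lemma char_ring_one_closed: "\<one>\<^bsub>char_ring\<^esub> \<in> carrier char_ring"
proof -
  have "finite {\<nu>. \<nu> = 0 \<and> ht \<nu> > h}" for h
    by (rule finite_subset[of _ "{0}"]) auto
  then show ?thesis
    by (auto simp: char_ring_carrier char_ring_simps weights_zero)
qed

lemma char_ring_cring: "cring char_ring"
proof (rule cringI)
  show "abelian_group char_ring"
  proof (rule abelian_groupI)
    fix c assume "c \<in> carrier char_ring"
    then show "\<exists>d\<in>carrier char_ring. d \<oplus>\<^bsub>char_ring\<^esub> c = \<zero>\<^bsub>char_ring\<^esub>"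
      by (intro bexI[of _ "\<lambda>\<nu>. - c \<nu>"] char_ring_uminus_closed) (auto simp: char_ring_simps)
  qed (simp_all add: char_ring_simps char_ring_add_closed ac_simps char_ring_carrier[of "\<lambda>\<nu>. 0"])
  show "comm_monoid char_ring"
  proof (rule comm_monoidI)
    fix c assume "c \<in> carrier char_ring"
    show "\<one>\<^bsub>char_ring\<^esub> \<otimes>\<^bsub>char_ring\<^esub> c = c"
    proof
      fix \<nu>
      show "(\<one>\<^bsub>char_ring\<^esub> \<otimes>\<^bsub>char_ring\<^esub> c) \<nu> = c \<nu>"
        by (subst char_ring_mult_eq[of "{0}"]) (auto simp: char_ring_simps split: if_splits)
    qed
  qed (auto simp: char_ring_mult_closed char_ring_one_closed char_ring_mult_assoc intro: char_ring_mult_comm)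
  fix c d e assume c: "c \<in> carrier char_ring" and d: "d \<in> carrier char_ring" and e: "e \<in> carrier char_ring"
  show "(c \<oplus>\<^bsub>char_ring\<^esub> d) \<otimes>\<^bsub>char_ring\<^esub> e = c \<otimes>\<^bsub>char_ring\<^esub> e \<oplus>\<^bsub>char_ring\<^esub> d \<otimes>\<^bsub>char_ring\<^esub> e"
  proof
    fix \<nu>
    let ?T = "{\<mu>. c \<mu> \<noteq> 0 \<and> e (\<nu> - \<mu>) \<noteq> 0} \<union> {\<mu>. d \<mu> \<noteq> 0 \<and> e (\<nu> - \<mu>) \<noteq> 0}"
    have T: "finite ?T" using char_ring_mult_finite c d e by simp
    have "(c \<otimes>\<^bsub>char_ring\<^esub> e) \<nu> = (\<Sum>\<mu>\<in>?T. c \<mu> * e (\<nu> - \<mu>))"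
      "(d \<otimes>\<^bsub>char_ring\<^esub> e) \<nu> = (\<Sum>\<mu>\<in>?T. d \<mu> * e (\<nu> - \<mu>))"
      "((\<lambda>\<nu>. c \<nu> + d \<nu>) \<otimes>\<^bsub>char_ring\<^esub> e) \<nu> = (\<Sum>\<mu>\<in>?T. (c \<mu> + d \<mu>) * e (\<nu> - \<mu>))"
      by (rule char_ring_mult_eq[OF T]; force)+
    then show "((c \<oplus>\<^bsub>char_ring\<^esub> d) \<otimes>\<^bsub>char_ring\<^esub> e) \<nu> = (c \<otimes>\<^bsub>char_ring\<^esub> e \<oplus>\<^bsub>char_ring\<^esub> d \<otimes>\<^bsub>char_ring\<^esub> e) \<nu>"
      unfolding char_ring_simps by (simp add: sum.distrib distrib_right)
  qed
qed

interpretation char_ring: cring char_ring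
  by (rule char_ring_cring)

lemma char_ring_a_inv: "c \<in> carrier char_ring \<Longrightarrow> \<ominus>\<^bsub>char_ring\<^esub> c = (\<lambda>\<nu>. - c \<nu>)"
  by (rule char_ring.minus_equality) (auto simp: char_ring_simps char_ring_uminus_closed)

lemma char_ring_minus:
  "c \<in> carrier char_ring \<Longrightarrow> d \<in> carrier char_ring \<Longrightarrow> c \<ominus>\<^bsub>char_ring\<^esub> d = (\<lambda>\<nu>. c \<nu> - d \<nu>)"
  by (simp add: a_minus_def char_ring_a_inv char_ring_simps)

text \<open>The inverse of \<open>1 - m\<close> is the geometric series in \<open>m\<close>, of which only the terms up to the power
  \<open>- ht \<nu>\<close> contribute at \<open>\<nu>\<close>.\<close>

lemma char_ring_unit:
  assumes c: "c \<in> carrier char_ring" and c0: "c 0 = 1" and lower: "\<And>\<nu>. c \<nu> \<noteq> 0 \<Longrightarrow> \<nu> = 0 \<or> ht \<nu> \<le> -1"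
  obtains u where "u \<in> carrier char_ring" "c \<otimes>\<^bsub>char_ring\<^esub> u = \<one>\<^bsub>char_ring\<^esub>" "\<And>\<nu>. u \<nu> \<noteq> 0 \<Longrightarrow> ht \<nu> \<le> 0"
proof -
  define m where "m = \<one>\<^bsub>char_ring\<^esub> \<ominus>\<^bsub>char_ring\<^esub> c"
  have m: "m \<in> carrier char_ring" using c by (simp add: m_def)
  have m_lower: "ht \<nu> \<le> -1" if "m \<nu> \<noteq> 0" for \<nu>
    using that lower[of \<nu>] c0 char_ring_minus[OF char_ring_one_closed c]
    by (auto simp: m_def char_ring_simps split: if_splits)
  have cm: "c = \<one>\<^bsub>char_ring\<^esub> \<ominus>\<^bsub>char_ring\<^esub> m"
    using char_ring_minus[OF char_ring_one_closed c] char_ring_minus[OF char_ring_one_closed m] by (simp add: m_def)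
  define P where "P k = m [^]\<^bsub>char_ring\<^esub> k" for k :: nat
  have P: "P k \<in> carrier char_ring" for k using m by (simp add: P_def)
  have P_lower: "ht \<nu> \<le> - real k" if "P k \<nu> \<noteq> 0" for k \<nu>
    using that
  proof (induction k arbitrary: \<nu>)
    case 0
    then show ?case by (simp add: P_def char_ring_simps ht_simps split: if_splits)
  next
    case (Suc k)
    then have "(P k \<otimes>\<^bsub>char_ring\<^esub> m) \<nu> \<noteq> 0" by (simp add: P_def)
    then obtain \<mu> where "P k \<mu> \<noteq> 0" "m (\<nu> - \<mu>) \<noteq> 0" by (rule char_ring_mult_support)
    then have "ht \<mu> \<le> - real k" "ht (\<nu> - \<mu>) \<le> -1" using Suc.IH m_lower by blast+
    then show ?case by (simp add: ht_simps)
  qed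
  \<comment> \<open>The truncated geometric series; multiplied by \<open>c\<close>, which is one
    minus \<open>m\<close>, it telescopes.\<close>
  define S where "S K = (\<lambda>\<nu>. \<Sum>k\<le>K. P k \<nu>)" for K :: nat
  have S: "S K \<in> carrier char_ring \<and> c \<otimes>\<^bsub>char_ring\<^esub> S K = \<one>\<^bsub>char_ring\<^esub> \<ominus>\<^bsub>char_ring\<^esub> P (Suc K)" for K
  proof (induction K)
    case 0
    have "S 0 = \<one>\<^bsub>char_ring\<^esub>" "P (Suc 0) = m" using m by (simp_all add: S_def P_def)
    then show ?case using c cm by simp
  next
    case (Suc K)
    have SK: "S (Suc K) = S K \<oplus>\<^bsub>char_ring\<^esub> P (Suc K)"
      by (simp add: S_def char_ring_simps)
    have "P (Suc (Suc K)) = m \<otimes>\<^bsub>char_ring\<^esub> P (Suc K)"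
      using m char_ring.m_comm by (simp add: P_def)
    moreover have "c \<otimes>\<^bsub>char_ring\<^esub> P (Suc K) = P (Suc K) \<ominus>\<^bsub>char_ring\<^esub> m \<otimes>\<^bsub>char_ring\<^esub> P (Suc K)"
      unfolding cm using m P[of "Suc K"] by (simp add: char_ring.minus_eq char_ring.l_distr char_ring.l_minus)
    ultimately have "c \<otimes>\<^bsub>char_ring\<^esub> S (Suc K) =
        (\<one>\<^bsub>char_ring\<^esub> \<ominus>\<^bsub>char_ring\<^esub> P (Suc K)) \<oplus>\<^bsub>char_ring\<^esub> (P (Suc K) \<ominus>\<^bsub>char_ring\<^esub> P (Suc (Suc K)))"
      using Suc c P[of "Suc K"] by (simp add: SK char_ring.r_distr)
    also have "\<dots> = \<one>\<^bsub>char_ring\<^esub> \<ominus>\<^bsub>char_ring\<^esub> P (Suc (Suc K))"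
      using char_ring_minus[OF char_ring_one_closed P] char_ring_minus[OF P P]
      by (simp add: char_ring_simps fun_eq_iff)
    finally show ?case using Suc P[of "Suc K"] SK by simp
  qed
  define u where "u \<nu> = S (nat \<lceil>- ht \<nu>\<rceil>) \<nu>" for \<nu>
  have u_eq: "u \<nu> = S K \<nu>" if "real K \<ge> - ht \<nu>" for \<nu> K
    unfolding u_def S_def
  proof (rule sum.mono_neutral_left)
    show "{..nat \<lceil>- ht \<nu>\<rceil>} \<subseteq> {..K}" using that by (auto simp: nat_le_iff ceiling_le_iff)
    show "\<forall>k\<in>{..K} - {..nat \<lceil>- ht \<nu>\<rceil>}. P k \<nu> = 0"
    proof (intro ballI)
      fix k assume "k \<in> {..K} - {..nat \<lceil>- ht \<nu>\<rceil>}"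
      then have "real k > - ht \<nu>" by (auto simp: nat_less_iff ceiling_less_iff) linarith
      then show "P k \<nu> = 0" using P_lower[of k \<nu>] by force
    qed
  qed simp
  have u_lower: "ht \<nu> \<le> 0" if "u \<nu> \<noteq> 0" for \<nu>
  proof -
    have "(\<Sum>k\<le>nat \<lceil>- ht \<nu>\<rceil>. P k \<nu>) \<noteq> 0" using that by (simp add: u_def S_def)
    then obtain k where "P k \<nu> \<noteq> 0" by (rule sum.not_neutral_contains_not_neutral)
    then show ?thesis using P_lower[of k \<nu>] by simp
  qed
  have u: "u \<in> carrier char_ring"
    unfolding char_ring_carrier
  proof (intro conjI allI impI)
    fix \<nu> assume "u \<nu> \<noteq> 0"
    then show "\<nu> \<in> weights" using S[of "nat \<lceil>- ht \<nu>\<rceil>"] by (simp add: u_def char_ring_carrier)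
  next
    fix h
    have "{\<nu>. u \<nu> \<noteq> 0 \<and> ht \<nu> > h} \<subseteq> {\<nu>. S (nat \<lceil>- h\<rceil>) \<nu> \<noteq> 0 \<and> ht \<nu> > h}"
    proof
      fix \<nu> assume "\<nu> \<in> {\<nu>. u \<nu> \<noteq> 0 \<and> ht \<nu> > h}"
      then have h: "u \<nu> \<noteq> 0" "ht \<nu> > h" by auto
      have "real (nat \<lceil>- h\<rceil>) \<ge> - ht \<nu>" using h(2) real_nat_ceiling_ge[of "- h"] by linarith
      then show "\<nu> \<in> {\<nu>. S (nat \<lceil>- h\<rceil>) \<nu> \<noteq> 0 \<and> ht \<nu> > h}" using h u_eq[of \<nu> "nat \<lceil>- h\<rceil>"] by simp
    qed
    then show "finite {\<nu>. u \<nu> \<noteq> 0 \<and> ht \<nu> > h}"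
      using S finite_subset unfolding char_ring_carrier by blast
  qed
  have "c \<otimes>\<^bsub>char_ring\<^esub> u = \<one>\<^bsub>char_ring\<^esub>"
  proof
    fix \<nu>
    define K where "K = nat \<lceil>- ht \<nu>\<rceil>"
    have K: "real K \<ge> - ht \<nu>" using real_nat_ceiling_ge[of "- ht \<nu>"] by (simp add: K_def)
    \<comment> \<open>Exponents of \<open>c\<close> have height at most 0, so \<open>u\<close> is
      evaluated only at heights at least \<open>ht \<nu>\<close>, where truncation at
      \<open>K\<close> is exact.\<close>
    have same: "u (\<nu> - \<mu>) = S K (\<nu> - \<mu>)" if "c \<mu> \<noteq> 0" for \<mu>
      using lower[OF that] K by (intro u_eq) (auto simp: ht_simps)
    let ?T = "{\<mu>. c \<mu> \<noteq> 0 \<and> u (\<nu> - \<mu>) \<noteq> 0}"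
    have T: "finite ?T" using char_ring_mult_finite[OF c u] .
    have "(c \<otimes>\<^bsub>char_ring\<^esub> u) \<nu> = (\<Sum>\<mu>\<in>?T. c \<mu> * u (\<nu> - \<mu>))"
      by (rule char_ring_mult_eq[OF T]) simp
    also have "\<dots> = (\<Sum>\<mu>\<in>?T. c \<mu> * S K (\<nu> - \<mu>))"
      using same by (intro sum.cong) auto
    also have "\<dots> = (c \<otimes>\<^bsub>char_ring\<^esub> S K) \<nu>"
      using same by (intro char_ring_mult_eq[symmetric] T) auto
    also have "\<dots> = \<one>\<^bsub>char_ring\<^esub> \<nu> - P (Suc K) \<nu>"
      using S[of K] char_ring_minus[OF char_ring_one_closed P] by simp
    also have "P (Suc K) \<nu> = 0"
      using P_lower[of "Suc K" \<nu>] K by force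
    finally show "(c \<otimes>\<^bsub>char_ring\<^esub> u) \<nu> = \<one>\<^bsub>char_ring\<^esub> \<nu>" by simp
  qed
  then show ?thesis using that u u_lower by blast
qed

text \<open>This lets division by the Weyl denominator pass through an infinite sum. As
  \<open>u\<close> has no exponent of positive height, only the finitely many \<open>j\<close> with
  \<open>b j \<ge> ht \<kappa>\<close> can contribute at \<kappa>.\<close>

lemma formal_sum_mult:
  assumes sum: "formal_sum_of c F A" and F: "\<And>j. j \<in> A \<Longrightarrow> F j \<in> carrier char_ring"
    and bound: "\<And>j \<nu>. j \<in> A \<Longrightarrow> F j \<nu> \<noteq> 0 \<Longrightarrow> ht \<nu> \<le> b j" and fin: "\<And>h. finite {j \<in> A. b j \<ge> h}"
    and u: "u \<in> carrier char_ring" and u_lower: "\<And>\<nu>. u \<nu> \<noteq> 0 \<Longrightarrow> ht \<nu> \<le> 0"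
  shows "formal_sum_of (c \<otimes>\<^bsub>char_ring\<^esub> u) (\<lambda>j. F j \<otimes>\<^bsub>char_ring\<^esub> u) A"
  unfolding formal_sum_of_def
proof
  fix \<kappa>
  define B where "B = {j \<in> A. b j \<ge> ht \<kappa>}"
  have B: "finite B" using fin by (simp add: B_def)
  have BI: "j \<in> B" if "j \<in> A" "F j \<nu> \<noteq> 0" "ht \<nu> \<ge> ht \<kappa>" for j \<nu>
    using bound[OF that(1,2)] that by (simp add: B_def)
  have cB: "c \<nu> = (\<Sum>j\<in>B. F j \<nu>)" if "ht \<nu> \<ge> ht \<kappa>" for \<nu>
  proof -
    have "c \<nu> = (\<Sum>j | j \<in> A \<and> F j \<nu> \<noteq> 0. F j \<nu>)" using sum by (simp add: formal_sum_of_def)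
    also have "\<dots> = (\<Sum>j\<in>B. F j \<nu>)"
      using B BI[OF _ _ that] by (intro sum.mono_neutral_left) (auto simp: B_def)
    finally show ?thesis .
  qed
  have sub: "{j \<in> A. (F j \<otimes>\<^bsub>char_ring\<^esub> u) \<kappa> \<noteq> 0} \<subseteq> B"
  proof clarify
    fix j assume j: "j \<in> A" and "(F j \<otimes>\<^bsub>char_ring\<^esub> u) \<kappa> \<noteq> 0"
    from this(2) obtain \<mu> where "F j \<mu> \<noteq> 0" "u (\<kappa> - \<mu>) \<noteq> 0" by (rule char_ring_mult_support)
    then show "j \<in> B" using BI[OF j, of \<mu>] u_lower[of "\<kappa> - \<mu>"] by (simp add: ht_simps)
  qed
  let ?T = "\<Union>j\<in>B. {\<mu>. u \<mu> \<noteq> 0 \<and> F j (\<kappa> - \<mu>) \<noteq> 0}"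
  have T: "finite ?T" using B F char_ring_mult_finite[OF u] by (auto simp: B_def)
  have "(c \<otimes>\<^bsub>char_ring\<^esub> u) \<kappa> = (u \<otimes>\<^bsub>char_ring\<^esub> c) \<kappa>" by (simp add: char_ring_mult_comm)
  also have "\<dots> = (\<Sum>\<mu>\<in>?T. u \<mu> * c (\<kappa> - \<mu>))"
  proof (rule char_ring_mult_eq[OF T], clarify)
    fix \<mu> assume "u \<mu> \<noteq> 0" "c (\<kappa> - \<mu>) \<noteq> 0"
    then have "(\<Sum>j\<in>B. F j (\<kappa> - \<mu>)) \<noteq> 0" using cB[of "\<kappa> - \<mu>"] u_lower[of \<mu>] by (simp add: ht_simps)
    then obtain j where "j \<in> B" "F j (\<kappa> - \<mu>) \<noteq> 0" by (rule sum.not_neutral_contains_not_neutral)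
    then show "\<mu> \<in> ?T" using \<open>u \<mu> \<noteq> 0\<close> by auto
  qed
  also have "\<dots> = (\<Sum>\<mu>\<in>?T. \<Sum>j\<in>B. u \<mu> * F j (\<kappa> - \<mu>))"
    using cB u_lower by (intro sum.cong refl) (auto simp: ht_simps sum_distrib_left)
  also have "\<dots> = (\<Sum>j\<in>B. \<Sum>\<mu>\<in>?T. u \<mu> * F j (\<kappa> - \<mu>))" by (rule sum.swap)
  also have "\<dots> = (\<Sum>j\<in>B. (u \<otimes>\<^bsub>char_ring\<^esub> F j) \<kappa>)"
    by (intro sum.cong refl char_ring_mult_eq[symmetric] T) auto
  also have "\<dots> = (\<Sum>j\<in>B. (F j \<otimes>\<^bsub>char_ring\<^esub> u) \<kappa>)" by (simp add: char_ring_mult_comm)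
  also have "\<dots> = (\<Sum>j | j \<in> A \<and> (F j \<otimes>\<^bsub>char_ring\<^esub> u) \<kappa> \<noteq> 0. (F j \<otimes>\<^bsub>char_ring\<^esub> u) \<kappa>)"
    using sub B by (intro sum.mono_neutral_right) (auto simp: B_def)
  finally show "finite {j \<in> A. (F j \<otimes>\<^bsub>char_ring\<^esub> u) \<kappa> \<noteq> 0} \<and> (c \<otimes>\<^bsub>char_ring\<^esub> u) \<kappa> =
      (\<Sum>j | j \<in> A \<and> (F j \<otimes>\<^bsub>char_ring\<^esub> u) \<kappa> \<noteq> 0. (F j \<otimes>\<^bsub>char_ring\<^esub> u) \<kappa>)"
    using sub B finite_subset by blast
qed

section \<open>Alternating sums over the Weyl group and the Weyl denominator\<close>

lemma rho_weights: "\<rho> \<in> weights"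
  using rho_pairing by (simp add: weights_def coroot_def)

lemma weyl_group_weights: "w \<in> weyl_group \<Longrightarrow> v \<in> weights \<Longrightarrow> w v \<in> weights"
proof (induction rule: weyl_group_induct)
  case (step p w)
  then have "w v \<in> weights" by blast
  then show ?case
    using step(1) simple_pairing_int by (auto simp: weights_def reflection_def intro!: Ints_diff Ints_mult)
qed simp

lemma dominant_weights: "dominant v \<Longrightarrow> v \<in> weights"
  by (simp add: dominant_def)

lemma dominant_shift:
  assumes "dominant lam" "p \<in> {1..r}"
  shows "form (lam + \<rho>) (coroot (\<alpha> p)) \<ge> 1"
proof -
  have "form \<rho> (coroot (\<alpha> p)) = 1" using rho_pairing[OF assms(2)] by (simp only: coroot_def)
  then show ?thesis using assms simple_pos_roots[of p] by (simp add: dominant_def)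
qed

text \<open>A coroot is a positive multiple of its root, and a positive root is a nonnegative
  combination of simple ones, so the simple coroots decide.\<close>

lemma dominantI:
  assumes "v \<in> weights" "\<And>p. p \<in> {1..r} \<Longrightarrow> form v (coroot (\<alpha> p)) \<ge> 0"
  shows "dominant v"
  unfolding dominant_def
proof (intro conjI ballI)
  fix a assume a: "a \<in> pos_roots"
  then obtain c where c: "\<forall>p\<in>{1..r}. 0 \<le> c p" "a = (\<Sum>p\<in>{1..r}. c p *\<^sub>R \<alpha> p)"
    unfolding pos_roots_def by blast
  have nonneg: "form (\<alpha> p) v \<ge> 0" if "p \<in> {1..r}" for p
    using assms(2)[OF that] simple_root_norm_pos[OF that]
    by (simp add: coroot_def form_symmetric[of v] zero_le_mult_iff zero_le_divide_iff)
  have "form a v = (\<Sum>p\<in>{1..r}. c p * form (\<alpha> p) v)"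
    using c(2) by (simp add: form_sum_left)
  also have "\<dots> \<ge> 0"
    using c(1) nonneg by (intro sum_nonneg mult_nonneg_nonneg) auto
  finally show "0 \<le> form v (coroot a)"
    using root_norm_pos[OF pos_roots_roots[OF a]] by (simp add: coroot_def form_symmetric[of v])
qed (rule assms(1))

text \<open>Every letter of a reduced word costs at least one unit of height: the last letter
  \<open>q\<close> subtracts at least one copy of the positive root \<open>v (\<alpha> q)\<close>.
  This makes sums over an infinite Weyl group locally finite.\<close>

lemma ht_weyl_group:
  assumes x: "\<And>p. p \<in> {1..r} \<Longrightarrow> form x (coroot (\<alpha> p)) \<ge> 1" and "w \<in> weyl_group"
  shows "ht (w x) \<le> ht x - wlength w"
  using assms(2)
proof (induction "wlength w" arbitrary: w)
  case 0
  then show ?case by (metis diff_zero id_apply of_nat_0 order_refl wlength_eq_0)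
next
  case (Suc n)
  obtain ps where ps: "ps \<in> lists {1..r}" "simple_word ps = w" "length ps = wlength w"
    using Suc.prems by (rule reduced_word)
  then have "ps \<noteq> []" using Suc.hyps(2) by auto
  then obtain qs q where qs: "ps = qs @ [q]" by (metis rev_exhaust)
  define v where "v = simple_word qs"
  have q: "q \<in> {1..r}" and qs_lists: "qs \<in> lists {1..r}" using ps(1) qs by auto
  have v: "v \<in> weyl_group" using weyl_groupI[OF qs_lists] by (simp add: v_def)
  have w: "w = v \<circ> reflection (\<alpha> q)" using ps(2) qs by (simp add: simple_word_append v_def)
  have "wlength v \<le> n" using wlength_le[OF qs_lists] ps(3) qs Suc.hyps(2) by (simp add: v_def)
  moreover have "wlength w \<le> wlength v + 1" using wlength_comp_le[OF v, of "[q]"] q w by simp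
  ultimately have len: "wlength v = n" using Suc.hyps(2) by simp
  have "v (\<alpha> q) \<in> pos_roots"
    using wlength_reflection_down[OF v simple_pos_roots[OF q]] w len Suc.hyps(2) by fastforce
  then have "ht (v (\<alpha> q)) \<ge> 1" by (rule pos_root_ht)
  then have "form x (coroot (\<alpha> q)) * ht (v (\<alpha> q)) \<ge> 1 * 1"
    using x[OF q] by (intro mult_mono) auto
  moreover have "w x = v x - form x (coroot (\<alpha> q)) *\<^sub>R v (\<alpha> q)"
    by (simp add: w reflection_def weyl_group_diff[OF v] weyl_group_scale[OF v])
  ultimately show ?case
    using Suc.hyps(1)[OF len[symmetric] v] len Suc.hyps(2)[symmetric] by (simp add: ht_simps)
qed

lemma finite_weyl_group_length: "finite {w \<in> weyl_group. wlength w \<le> n}"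
proof -
  have "{w \<in> weyl_group. wlength w \<le> n} \<subseteq> simple_word ` {ps. set ps \<subseteq> {1..r} \<and> length ps \<le> n}"
  proof
    fix w assume w: "w \<in> {w \<in> weyl_group. wlength w \<le> n}"
    then obtain ps where "ps \<in> lists {1..r}" "simple_word ps = w" "length ps = wlength w"
      using reduced_word by blast
    then show "w \<in> simple_word ` {ps. set ps \<subseteq> {1..r} \<and> length ps \<le> n}"
      using w by (intro image_eqI[of _ _ ps]) auto
  qed
  then show ?thesis
    by (rule finite_subset) (intro finite_imageI finite_lists_length_le; simp)
qed

lemma finite_weyl_group_ht:
  assumes "dominant lam"
  shows "finite {w \<in> weyl_group. ht (w (lam + \<rho>)) \<ge> h}"
proof -
  have "{w \<in> weyl_group. ht (w (lam + \<rho>)) \<ge> h} \<subseteq> {w \<in> weyl_group. wlength w \<le> nat \<lceil>ht (lam + \<rho>) - h\<rceil>}"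
  proof clarify
    fix w assume w: "w \<in> weyl_group" "h \<le> ht (w (lam + \<rho>))"
    have "real (wlength w) \<le> ht (lam + \<rho>) - h"
      using ht_weyl_group[OF dominant_shift[OF assms] w(1)] w(2) by linarith
    then show "wlength w \<le> nat \<lceil>ht (lam + \<rho>) - h\<rceil>"
      using real_nat_ceiling_ge[of "ht (lam + \<rho>) - h"] by linarith
  qed
  then show ?thesis using finite_weyl_group_length finite_subset by blast
qed

lemma alternant_nonzero:
  assumes "alternant lam \<kappa> \<noteq> 0"
  obtains w where "w \<in> weyl_group" "w (lam + \<rho>) - \<rho> = \<kappa>"
proof -
  have "{w. w \<in> weyl_group \<and> w (lam + \<rho>) - \<rho> = \<kappa>} \<noteq> {}"
    using assms unfolding alternant_def by (metis (no_types, lifting) sum.empty)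
  then show ?thesis using that by blast
qed

lemma alternant_ht:
  assumes "dominant lam" "alternant lam \<kappa> \<noteq> 0" shows "ht \<kappa> \<le> ht lam"
proof -
  obtain w where w: "w \<in> weyl_group" "w (lam + \<rho>) - \<rho> = \<kappa>"
    using assms(2) by (rule alternant_nonzero)
  then have "ht (w (lam + \<rho>)) = ht \<kappa> + ht \<rho>" by (auto simp: ht_simps)
  moreover have "ht (w (lam + \<rho>)) \<le> ht (lam + \<rho>)"
    using ht_weyl_group[OF dominant_shift[OF assms(1)] w(1)] by simp
  ultimately show ?thesis by (simp add: ht_simps)
qed

lemma alternant_closed:
  assumes "dominant lam" shows "alternant lam \<in> carrier char_ring"
  unfolding char_ring_carrier
proof (intro conjI allI impI)
  fix \<kappa> assume "alternant lam \<kappa> \<noteq> 0"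
  then obtain w where "w \<in> weyl_group" "w (lam + \<rho>) - \<rho> = \<kappa>" by (rule alternant_nonzero)
  then show "\<kappa> \<in> weights"
    using weyl_group_weights weights_add weights_diff rho_weights dominant_weights[OF assms] by blast
next
  fix h
  let ?W = "{w \<in> weyl_group. ht (w (lam + \<rho>)) \<ge> h + ht \<rho>}"
  have "{\<kappa>. alternant lam \<kappa> \<noteq> 0 \<and> ht \<kappa> > h} \<subseteq> (\<lambda>w. w (lam + \<rho>) - \<rho>) ` ?W"
  proof clarify
    fix \<kappa> assume "alternant lam \<kappa> \<noteq> 0" and h: "h < ht \<kappa>"
    from this(1) obtain w where w: "w \<in> weyl_group" "w (lam + \<rho>) - \<rho> = \<kappa>" by (rule alternant_nonzero)
    then have "ht (w (lam + \<rho>)) = ht \<kappa> + ht \<rho>" by (auto simp: ht_simps)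
    then show "\<kappa> \<in> (\<lambda>w. w (lam + \<rho>) - \<rho>) ` ?W"
      using w h by (intro image_eqI[of _ _ w]) auto
  qed
  then show "finite {\<kappa>. alternant lam \<kappa> \<noteq> 0 \<and> ht \<kappa> > h}"
    by (rule finite_subset) (intro finite_imageI finite_weyl_group_ht assms)
qed

lemma dominant_zero: "dominant 0"
  by (simp add: dominant_def weights_zero)

text \<open>One inverse \<open>u\<close> is fixed for all characters, together with the bound on its
  exponents that \<open>formal_sum_mult\<close> requires.\<close>

lemma weyl_denominator_unit:
  "\<exists>u\<in>carrier char_ring. alternant 0 \<otimes>\<^bsub>char_ring\<^esub> u = \<one>\<^bsub>char_ring\<^esub> \<and>
    (\<forall>\<nu>. u \<nu> \<noteq> 0 \<longrightarrow> ht \<nu> \<le> 0) \<and> (\<forall>lam. character lam = alternant lam \<otimes>\<^bsub>char_ring\<^esub> u)"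
proof -
  have ht0: "ht (w \<rho>) \<le> ht \<rho> - wlength w" if "w \<in> weyl_group" for w
    using ht_weyl_group[OF dominant_shift[OF dominant_zero] that] by simp
  \<comment> \<open>Every element other than \<open>id\<close> lowers the height of \<rho>, so its
    stabiliser is trivial.\<close>
  have "{w. w \<in> weyl_group \<and> w \<rho> = \<rho>} = {id}"
    using ht0 wlength_eq_0 by fastforce
  then have "alternant 0 0 = 1"
    by (simp add: alternant_def)
  moreover have "\<nu> = 0 \<or> ht \<nu> \<le> -1" if nonzero: "alternant 0 \<nu> \<noteq> 0" for \<nu>
  proof -
    obtain w where "w \<in> weyl_group" "w (0 + \<rho>) - \<rho> = \<nu>"
      using nonzero by (rule alternant_nonzero)
    then have w: "w \<in> weyl_group" "w \<rho> - \<rho> = \<nu>" by simp_all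
    then have "w = id \<or> wlength w \<ge> 1" using wlength_eq_0[OF w(1)] by linarith
    then show ?thesis
      using w ht0[OF w(1)] by (auto simp: ht_simps)
  qed
  ultimately obtain u where u: "u \<in> carrier char_ring" "alternant 0 \<otimes>\<^bsub>char_ring\<^esub> u = \<one>\<^bsub>char_ring\<^esub>"
    "\<And>\<nu>. u \<nu> \<noteq> 0 \<Longrightarrow> ht \<nu> \<le> 0"
    using char_ring_unit[OF alternant_closed[OF dominant_zero]] by blast
  have "inv\<^bsub>char_ring\<^esub> (alternant 0) = u"
    using char_ring.comm_inv_char[OF alternant_closed[OF dominant_zero] u(1,2)] .
  then show ?thesis using u by (intro bexI[of _ u]) (simp_all add: character_def)
qed

end

subsection \<open>Words of up, down and folded steps\<close>

text \<open>The folded chain of an admissible subset meets the walls of a simple root \<open>\<alpha> p\<close> in finitely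
  many steps \<open>0, \<dots>, n - 1\<close>; \<open>s k\<close> says that step \<open>k\<close> starts on the positive side, \<open>f k\<close> that it is a
  folding, and \<open>k = n\<close> stands for the index \<open>\<infinity>\<close>.\<close>

definition step_height :: "(nat \<Rightarrow> bool) \<Rightarrow> (nat \<Rightarrow> bool) \<Rightarrow> nat \<Rightarrow> int" where
  "step_height s f k = (\<Sum>j<k. if f j then 0 else if s j then 1 else -1)"

text \<open>The 1 subtracted on the negative side is the shift \<open>\<delta>'\<close> in the
  definition of the levels.\<close>

definition step_level :: "(nat \<Rightarrow> bool) \<Rightarrow> (nat \<Rightarrow> bool) \<Rightarrow> nat \<Rightarrow> int" where
  "step_level s f k = step_height s f k - (if s k then 0 else 1)"

definition step_max :: "nat \<Rightarrow> (nat \<Rightarrow> bool) \<Rightarrow> (nat \<Rightarrow> bool) \<Rightarrow> int" where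
  "step_max n s f = Max (step_level s f ` {..n})"

text \<open>These are the rules imposed by admissibility: walls are folded only from the positive
  side, and the positive side is left only by folding at a wall. After a folding, or from the
  negative side, the next state is free, since foldings away from the walls may lead back to the
  positive side.\<close>

definition step_word :: "nat \<Rightarrow> (nat \<Rightarrow> bool) \<Rightarrow> (nat \<Rightarrow> bool) \<Rightarrow> bool" where
  "step_word n s f \<longleftrightarrow> s 0 \<and> (\<forall>j<n. f j \<longrightarrow> s j) \<and> (\<forall>j<n. s j \<and> \<not> f j \<longrightarrow> s (Suc j))"

text \<open>The two toggled foldings reverse the side once each, so only the state between them
  changes.\<close>

definition flip_state :: "nat \<Rightarrow> (nat \<Rightarrow> bool) \<Rightarrow> nat \<Rightarrow> bool" where
  "flip_state k s = s(Suc k := \<not> s (Suc k))"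

definition flip_fold :: "nat \<Rightarrow> (nat \<Rightarrow> bool) \<Rightarrow> nat \<Rightarrow> bool" where
  "flip_fold k f = f(k := \<not> f k, Suc k := \<not> f (Suc k))"

definition last_max :: "nat \<Rightarrow> (nat \<Rightarrow> bool) \<Rightarrow> (nat \<Rightarrow> bool) \<Rightarrow> nat" where
  "last_max n s f = Max {k. k \<le> n \<and> step_level s f k = step_max n s f}"

definition first_max :: "nat \<Rightarrow> (nat \<Rightarrow> bool) \<Rightarrow> (nat \<Rightarrow> bool) \<Rightarrow> nat" where
  "first_max n s f = Min {k. k \<le> n \<and> step_level s f k = step_max n s f}"

lemma step_level_cong:
  assumes "\<And>j. j \<le> n \<Longrightarrow> s j = s' j" "\<And>j. j < n \<Longrightarrow> f j = f' j" "k \<le> n"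
  shows "step_level s f k = step_level s' f' k"
  unfolding step_level_def step_height_def using assms by (auto intro!: sum.cong)

lemma step_max_cong:
  assumes "\<And>j. j \<le> n \<Longrightarrow> s j = s' j" "\<And>j. j < n \<Longrightarrow> f j = f' j"
  shows "step_max n s f = step_max n s' f'" "last_max n s f = last_max n s' f'" "first_max n s f = first_max n s' f'"
proof -
  have *: "step_level s f k = step_level s' f' k" if "k \<le> n" for k
    using step_level_cong assms that by blast
  then have "step_level s f ` {..n} = step_level s' f' ` {..n}"
    by (intro image_cong) auto
  then show M: "step_max n s f = step_max n s' f'"
    by (simp add: step_max_def)
  have "{k. k \<le> n \<and> step_level s f k = step_max n s f} = {k. k \<le> n \<and> step_level s' f' k = step_max n s' f'}"
    using * M by auto
  then show "last_max n s f = last_max n s' f'" "first_max n s f = first_max n s' f'"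
    by (simp_all add: last_max_def first_max_def)
qed

lemma step_word_cong:
  assumes "\<And>j. j \<le> n \<Longrightarrow> s j = s' j" "\<And>j. j < n \<Longrightarrow> f j = f' j"
  shows "step_word n s f = step_word n s' f'"
  using assms unfolding step_word_def by (auto simp: Suc_le_eq less_imp_le)

lemma step_height_Suc: "step_height s f (Suc k) = step_height s f k + (if f k then 0 else if s k then 1 else -1)"
  by (simp add: step_height_def)

lemma step_max_ge: "k \<le> n \<Longrightarrow> step_level s f k \<le> step_max n s f"
  by (simp add: step_max_def)

lemma step_max_eqI:
  assumes "k \<le> n" "step_level s f k = M" "\<And>j. j \<le> n \<Longrightarrow> step_level s f j \<le> M"
  shows "step_max n s f = M"
  unfolding step_max_def using assms by (intro Max_eqI) auto

lemma step_max_attained: "{k. k \<le> n \<and> step_level s f k = step_max n s f} \<noteq> {}"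
proof -
  have "step_max n s f \<in> step_level s f ` {..n}"
    unfolding step_max_def by (intro Max_in) auto
  then show ?thesis by auto
qed

lemma last_max:
  "last_max n s f \<le> n" "step_level s f (last_max n s f) = step_max n s f"
  "\<And>j. last_max n s f < j \<Longrightarrow> j \<le> n \<Longrightarrow> step_level s f j < step_max n s f"
proof -
  let ?S = "{k. k \<le> n \<and> step_level s f k = step_max n s f}"
  have fin: "finite ?S" by (rule finite_subset[of _ "{..n}"]) auto
  have "last_max n s f \<in> ?S"
    unfolding last_max_def by (rule Max_in[OF fin step_max_attained])
  then show "last_max n s f \<le> n" "step_level s f (last_max n s f) = step_max n s f" by auto
  show "step_level s f j < step_max n s f" if "last_max n s f < j" "j \<le> n" for j
  proof -
    have "j \<notin> ?S"
    proof
      assume "j \<in> ?S"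
      then have "j \<le> last_max n s f" unfolding last_max_def by (rule Max_ge[OF fin])
      then show False using that(1) by simp
    qed
    then show ?thesis using step_max_ge[OF that(2), of s f] that(2) by auto
  qed
qed

lemma first_max:
  "first_max n s f \<le> n" "step_level s f (first_max n s f) = step_max n s f"
  "\<And>j. j < first_max n s f \<Longrightarrow> step_level s f j < step_max n s f"
proof -
  let ?S = "{k. k \<le> n \<and> step_level s f k = step_max n s f}"
  have fin: "finite ?S" by (rule finite_subset[of _ "{..n}"]) auto
  have mem: "first_max n s f \<in> ?S"
    unfolding first_max_def by (rule Min_in[OF fin step_max_attained])
  then show "first_max n s f \<le> n" "step_level s f (first_max n s f) = step_max n s f" by auto
  show "step_level s f j < step_max n s f" if "j < first_max n s f" for j
  proof -
    have "j \<notin> ?S"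
    proof
      assume "j \<in> ?S"
      then have "first_max n s f \<le> j" unfolding first_max_def by (rule Min_le[OF fin])
      then show False using that by simp
    qed
    then show ?thesis using step_max_ge[of j n s f] that mem by auto
  qed
qed

lemma last_max_eqI:
  assumes "k \<le> n" "step_level s f k = step_max n s f" "\<And>j. k < j \<Longrightarrow> j \<le> n \<Longrightarrow> step_level s f j < step_max n s f"
  shows "last_max n s f = k"
  using last_max[where n = n and s = s and f = f] assms by (metis less_irrefl linorder_neqE_nat)

lemma first_max_eqI:
  assumes "k \<le> n" "step_level s f k = step_max n s f" "\<And>j. j < k \<Longrightarrow> step_level s f j < step_max n s f"
  shows "first_max n s f = k"
  using first_max[where n = n and s = s and f = f] assms by (metis less_irrefl linorder_neqE_nat)

lemma step_max_nonneg: "step_word n s f \<Longrightarrow> step_max n s f \<ge> 0"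
  using step_max_ge[of 0 n s f] by (simp add: step_word_def step_level_def step_height_def)

lemma step_height_flip:
  "step_height (flip_state k s) (flip_fold k f) j =
    (if j \<le> k then step_height s f j
     else step_height s f j + (if f k then (if s k then 1 else -1) else (if s k then -1 else 1))
       + (if j = Suc k then 0 else if f (Suc k) then (if s (Suc k) then -1 else 1) else (if s (Suc k) then -1 else 1)))"
proof (induction j)
  case (Suc j)
  consider "j < k" | "j = k" | "j = Suc k" | "j > Suc k" by linarith
  then show ?case
    using Suc by cases (auto simp: step_height_Suc flip_state_def flip_fold_def)
qed (simp add: step_height_def)

text \<open>Leaving the maximum for good requires a folding from the positive to the negative side:
  an unfolded positive step is followed by a higher level, and a negative state is preceded by
  one.\<close>

lemma last_max_step:
  assumes wf: "step_word n s f" and pos: "step_level s f n < step_max n s f"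
  defines "k \<equiv> last_max n s f"
  shows "k < n" "f k" "s k" "\<not> s (Suc k)" "step_level s f (Suc k) = step_max n s f - 1"
    "Suc k < n \<Longrightarrow> \<not> f (Suc k)"
proof -
  have k: "k \<le> n" "step_level s f k = step_max n s f" "\<And>j. k < j \<Longrightarrow> j \<le> n \<Longrightarrow> step_level s f j < step_max n s f"
    using last_max[where n = n and s = s and f = f] by (auto simp: k_def)
  then show kn: "k < n" using pos by (cases "k = n") auto
  have next_lev: "step_level s f (Suc k) < step_level s f k" using k kn by simp
  have fk: "f k"
  proof (rule ccontr)
    assume nf: "\<not> f k"
    show False
    proof (cases "s k")
      case True
      then have "s (Suc k)" using wf kn nf by (simp add: step_word_def)
      then show False using next_lev True nf by (simp add: step_level_def step_height_Suc)
    next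
      case False
      then have "k \<noteq> 0" using wf by (cases k) (auto simp: step_word_def)
      then obtain i where i: "k = Suc i" by (cases k) auto
      have "f i \<or> \<not> s i" "f i \<longrightarrow> s i" using wf kn False i by (auto simp: step_word_def)
      moreover have "step_level s f i \<le> step_level s f k" using step_max_ge[of i n s f] k kn i by simp
      ultimately show False using False i by (auto simp: step_level_def step_height_Suc split: if_splits)
    qed
  qed
  then show "f k" .
  then show sk: "s k" using wf kn by (simp add: step_word_def)
  show nsk: "\<not> s (Suc k)" using next_lev sk \<open>f k\<close> by (auto simp: step_level_def step_height_Suc)
  show "step_level s f (Suc k) = step_max n s f - 1"
    using k(2) sk nsk \<open>f k\<close> by (simp add: step_level_def step_height_Suc)
  show "\<not> f (Suc k)" if "Suc k < n" using wf that nsk by (auto simp: step_word_def)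
qed

text \<open>Only an unfolded positive step raises the level, so it leads to a first maximum above 0;
  a second such step in a row would exceed the maximum, so a folding follows.\<close>

lemma first_max_step:
  assumes wf: "step_word n s f" and pos: "step_max n s f > 0"
  defines "k \<equiv> first_max n s f - 1"
  shows "first_max n s f = Suc k" "k < n" "\<not> f k" "s k" "s (Suc k)" "step_level s f k = step_max n s f - 1"
    "Suc k < n \<Longrightarrow> f (Suc k)"
proof -
  let ?m = "first_max n s f"
  have m: "?m \<le> n" "step_level s f ?m = step_max n s f" "\<And>j. j < ?m \<Longrightarrow> step_level s f j < step_max n s f"
    using first_max[where n = n and s = s and f = f] by auto
  have "step_level s f 0 = 0" using wf by (simp add: step_word_def step_level_def step_height_def)
  then have "?m \<noteq> 0" using m(2) pos by (metis less_irrefl)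
  then show mk: "?m = Suc k" by (simp add: k_def)
  then show kn: "k < n" using m(1) by simp
  have prev_lev: "step_level s f k < step_level s f (Suc k)" using m mk by simp
  have "\<not> f k \<and> s k"
  proof (rule ccontr)
    assume "\<not> (\<not> f k \<and> s k)"
    then have "f k \<and> s k \<or> \<not> f k \<and> \<not> s k" using wf kn by (auto simp: step_word_def)
    then show False using prev_lev by (auto simp: step_level_def step_height_Suc split: if_splits)
  qed
  then show nf: "\<not> f k" and sk: "s k" by auto
  show ssk: "s (Suc k)" using wf kn nf sk by (simp add: step_word_def)
  show "step_level s f k = step_max n s f - 1"
    using m(2) mk nf sk ssk by (simp add: step_level_def step_height_Suc)
  show "f (Suc k)" if less: "Suc k < n"
  proof (rule ccontr)
    assume "\<not> f (Suc k)"
    moreover from this have "s (Suc (Suc k))" using wf less ssk by (simp add: step_word_def)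
    ultimately have "step_level s f (Suc (Suc k)) = step_max n s f + 1"
      using m(2) mk ssk by (simp add: step_level_def step_height_Suc)
    then show False using step_max_ge[of "Suc (Suc k)" n s f] less by simp
  qed
qed

text \<open>The folding at \<open>k\<close> becomes an up step and the down step after it a folding,
  so all later levels rise by 2; right at \<open>Suc k\<close> the second unit comes from the
  changed state. Level \<open>Suc k\<close> was one below the maximum and all later ones were
  strictly below it, so the maximum grows by exactly 1 and is first reached at \<open>Suc k\<close>.
  Thus lowering finds the same position again.\<close>

lemma raise_step:
  assumes wf: "step_word n s f" and pos: "step_level s f n < step_max n s f"
  defines "k \<equiv> last_max n s f"
  defines "s' \<equiv> flip_state k s" and "f' \<equiv> flip_fold k f"
  shows "step_word n s' f'" "\<And>j. k < j \<Longrightarrow> j \<le> n \<Longrightarrow> step_level s' f' j = step_level s f j + 2"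
    "step_max n s' f' = step_max n s f + 1" "first_max n s' f' = Suc k"
proof -
  note k = last_max_step[OF wf pos, folded k_def]
  show "step_word n s' f'"
    using wf k unfolding step_word_def s'_def f'_def flip_state_def flip_fold_def by auto
  have low: "step_level s' f' j = step_level s f j" if "j \<le> k" for j
    using that by (simp add: step_level_def step_height_flip s'_def f'_def) (simp add: flip_state_def)
  show high: "step_level s' f' j = step_level s f j + 2" if "k < j" "j \<le> n" for j
  proof (cases "j = Suc k")
    case True
    then show ?thesis
      using k by (simp add: step_level_def step_height_flip s'_def f'_def) (simp add: flip_state_def)
  next
    case False
    then have "Suc k < n" using that by simp
    then show ?thesis
      using k False that
      by (simp add: step_level_def step_height_flip s'_def f'_def) (simp add: flip_state_def)
  qed
  have top: "step_level s' f' (Suc k) = step_max n s f + 1"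
    using high[of "Suc k"] k by simp
  show M: "step_max n s' f' = step_max n s f + 1"
  proof (rule step_max_eqI[OF _ top])
    fix j assume j: "j \<le> n"
    show "step_level s' f' j \<le> step_max n s f + 1"
      using low[of j] high[OF _ j] step_max_ge[OF j, of s f] last_max(3)[where n = n and s = s and f = f and j = j] j
      by (cases "j \<le> k") (auto simp: k_def)
  qed (use k in simp)
  show "first_max n s' f' = Suc k"
  proof (rule first_max_eqI)
    fix j assume "j < Suc k"
    then show "step_level s' f' j < step_max n s' f'"
      using low[of j] step_max_ge[of j n s f] k(1) M by simp
  qed (use k top M in simp_all)
qed

text \<open>The same bookkeeping in reverse: the step before the old first maximum becomes the last
  maximum, which is where raising acts.\<close>

lemma lower_step:
  assumes wf: "step_word n s f" and pos: "step_max n s f > 0"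
  defines "k \<equiv> first_max n s f - 1"
  defines "s' \<equiv> flip_state k s" and "f' \<equiv> flip_fold k f"
  shows "step_word n s' f'" "\<And>j. k < j \<Longrightarrow> j \<le> n \<Longrightarrow> step_level s' f' j = step_level s f j - 2"
    "step_max n s' f' = step_max n s f - 1" "last_max n s' f' = k"
proof -
  note k = first_max_step[OF wf pos, folded k_def]
  show "step_word n s' f'"
    using wf k unfolding step_word_def s'_def f'_def flip_state_def flip_fold_def by auto
  have low: "step_level s' f' j = step_level s f j" if "j \<le> k" for j
    using that by (simp add: step_level_def step_height_flip s'_def f'_def) (simp add: flip_state_def)
  show high: "step_level s' f' j = step_level s f j - 2" if "k < j" "j \<le> n" for j
  proof (cases "j = Suc k")
    case True
    then show ?thesis
      using k by (simp add: step_level_def step_height_flip s'_def f'_def) (simp add: flip_state_def)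
  next
    case False
    then have "Suc k < n" using that by simp
    then show ?thesis
      using k False that
      by (simp add: step_level_def step_height_flip s'_def f'_def) (simp add: flip_state_def)
  qed
  have top: "step_level s' f' k = step_max n s f - 1"
    using low[of k] k by simp
  have below: "step_level s' f' j \<le> step_max n s f - 1" if j: "j \<le> n" for j
    using low[of j] high[OF _ j] step_max_ge[OF j, of s f] first_max(3)[where n = n and s = s and f = f and j = j] k(1)
    by (cases "j \<le> k") auto
  show M: "step_max n s' f' = step_max n s f - 1"
    using step_max_eqI[OF _ top below] k by simp
  show "last_max n s' f' = k"
  proof (rule last_max_eqI)
    fix j assume "k < j" "j \<le> n"
    then show "step_level s' f' j < step_max n s' f'"
      using high[of j] step_max_ge[of j n s f] M by simp
  qed (use k top M in simp_all)
qed

subsection \<open>Chains of roots\<close>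

lemma sorted_list_of_set_Un:
  fixes J K :: "'i::linorder set"
  assumes "finite J" "finite K" "\<And>j k. j \<in> J \<Longrightarrow> k \<in> K \<Longrightarrow> j < k"
  shows "sorted_list_of_set (J \<union> K) = sorted_list_of_set J @ sorted_list_of_set K"
  using assms by (intro strict_sorted_equal) (auto simp: sorted_wrt_append)

lemma strict_sorted_nth_less_iff:
  fixes xs :: "'a::linorder list"
  assumes "sorted_wrt (<) xs" "a < length xs" "b < length xs"
  shows "xs ! a < xs ! b \<longleftrightarrow> a < b"
  using sorted_wrt_nth_less[OF assms(1), of a b] sorted_wrt_nth_less[OF assms(1), of b a] assms(2,3)
  by (cases a b rule: linorder_cases) auto

locale root_chain = kac_moody_roots form r \<alpha> \<rho> ht
  for form :: "'v::real_vector \<Rightarrow> 'v \<Rightarrow> real" and r :: nat and \<alpha> :: "nat \<Rightarrow> 'v" and \<rho> :: 'v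
    and ht :: "'v \<Rightarrow> real" +
  fixes lam :: 'v and I :: "'i::linorder set" and \<beta> :: "'i \<Rightarrow> 'v"
  assumes dominant_lam: "dominant lam" and chain: "lambda_chain lam I \<beta>"
begin

definition fold_product :: "'i set \<Rightarrow> 'v \<Rightarrow> 'v" where
  "fold_product J = reflection_product \<beta> (sorted_list_of_set J)"

text \<open>\<open>affine_fold v J\<close> applies the affine counterpart of \<open>fold_product J\<close> to \<open>v\<close>; \<open>lam\<close> plays no role in it.\<close>

abbreviation affine_fold :: "'v \<Rightarrow> 'i set \<Rightarrow> 'v" where
  "affine_fold v J \<equiv> subset_weight v I \<beta> J"

lemma reflection_product_append:
  "reflection_product \<beta> (xs @ ys) = reflection_product \<beta> xs \<circ> reflection_product \<beta> ys"
  by (induction xs) (simp_all add: reflection_product_def o_assoc)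

lemma fold_product_empty [simp]: "fold_product {} = id"
  by (simp add: fold_product_def reflection_product_def)

lemma fold_product_single [simp]: "fold_product {k} = reflection (\<beta> k)"
  by (simp add: fold_product_def reflection_product_def)

lemma fold_product_Un:
  assumes "finite J" "finite K" "\<And>j k. j \<in> J \<Longrightarrow> k \<in> K \<Longrightarrow> j < k"
  shows "fold_product (J \<union> K) = fold_product J \<circ> fold_product K"
  using sorted_list_of_set_Un[OF assms] by (simp add: fold_product_def reflection_product_append)

lemma fold_product_insert_max:
  assumes "finite J" "\<And>j. j \<in> J \<Longrightarrow> j < k"
  shows "fold_product (insert k J) = fold_product J \<circ> reflection (\<beta> k)"
  using fold_product_Un[of J "{k}"] assms by simp

lemma affine_fold_Un:
  assumes "finite J" "finite K" "\<And>j k. j \<in> J \<Longrightarrow> k \<in> K \<Longrightarrow> j < k"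
  shows "affine_fold v (J \<union> K) = affine_fold (affine_fold v K) J"
  using sorted_list_of_set_Un[OF assms] by (simp add: subset_weight_def)

lemma affine_fold_empty [simp]: "affine_fold v {} = v"
  by (simp add: subset_weight_def)

lemma affine_fold_single [simp]: "affine_fold v {k} = reflection_hat I \<beta> k v"
  by (simp add: subset_weight_def)

lemma affine_fold_insert_max:
  assumes "finite J" "\<And>j. j \<in> J \<Longrightarrow> j < k"
  shows "affine_fold v (insert k J) = affine_fold (reflection_hat I \<beta> k v) J"
  using affine_fold_Un[of J "{k}"] assms by simp

lemma beta_pos: "i \<in> I \<Longrightarrow> \<beta> i \<in> pos_roots"
  using chain by (simp add: lambda_chain_def)

lemma beta_roots: "i \<in> I \<Longrightarrow> \<beta> i \<in> roots"
  using beta_pos pos_roots_roots by blast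

lemma fold_product_weyl: "finite J \<Longrightarrow> J \<subseteq> I \<Longrightarrow> fold_product J \<in> weyl_group"
proof (induction J rule: finite_linorder_max_induct)
  case (insert b A)
  then show ?case
    using weyl_group_reflection[of "fold_product A" "\<beta> b"] beta_roots
    by (subst fold_product_insert_max) auto
qed simp

lemma affine_fold_linear_part:
  "finite J \<Longrightarrow> J \<subseteq> I \<Longrightarrow> affine_fold v J = fold_product J v + affine_fold 0 J"
proof (induction J arbitrary: v rule: finite_linorder_max_induct)
  case (insert b A)
  have w: "fold_product A \<in> weyl_group" using fold_product_weyl insert by simp
  have hat: "reflection_hat I \<beta> b v = reflection (\<beta> b) v + reflection_hat I \<beta> b 0"
    by (simp add: reflection_hat_def affine_reflection_def reflection_def)
  have "affine_fold v (insert b A) = fold_product A (reflection_hat I \<beta> b v) + affine_fold 0 A"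
    using insert.hyps insert.IH[of "reflection_hat I \<beta> b v"] insert.prems by (subst affine_fold_insert_max) auto
  moreover have "affine_fold 0 (insert b A) = fold_product A (reflection_hat I \<beta> b 0) + affine_fold 0 A"
    using insert.hyps insert.IH[of "reflection_hat I \<beta> b 0"] insert.prems by (subst affine_fold_insert_max) auto
  moreover have "fold_product (insert b A) = fold_product A \<circ> reflection (\<beta> b)"
    using insert.hyps by (subst fold_product_insert_max) auto
  ultimately show ?case
    by (simp add: hat weyl_group_add[OF w])
qed simp

definition folded_root :: "'i set \<Rightarrow> 'i \<Rightarrow> 'v" where
  "folded_root J i = fold_product (J \<inter> {..<i}) (\<beta> i)"

text \<open>Foldings of larger index act earlier and leave the root at \<open>j\<close> alone, so
  the folding at \<open>j\<close> reflects in \<open>\<beta> j\<close> itself. The entry at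
  \<open>i\<close> collects the reflections of the smaller indices in increasing order.\<close>

lemma folding_fst:
  assumes "finite J"
  shows "fst (folding \<beta> J) i = (folded_root J i, if i \<in> J then -1 else 1)"
proof -
  have "fst (foldr fold_op js (\<lambda>i. (\<beta> i, 1), \<rho>)) i =
      (reflection_product \<beta> (filter (\<lambda>j. j < i) js) (\<beta> i), if i \<in> set js then -1 else 1)"
    if "sorted_wrt (<) js" for js
    using that
  proof (induction js arbitrary: i)
    case (Cons j js)
    have IH: "fst (foldr fold_op js (\<lambda>i. (\<beta> i, 1), \<rho>)) i =
        (reflection_product \<beta> (filter (\<lambda>j. j < i) js) (\<beta> i), if i \<in> set js then -1 else 1)" for i
      using Cons by simp
    have "filter (\<lambda>i. i < j) js = []" "j \<notin> set js" "i < j \<Longrightarrow> filter (\<lambda>k. k < i) js = []"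
      "i < j \<Longrightarrow> i \<notin> set js"
      using Cons.prems by (auto simp: filter_empty_conv)
    then show ?case
      unfolding foldr.simps comp_apply fold_op_def[of j] by (auto simp: Let_def IH reflection_product_def)
  qed (simp add: reflection_product_def)
  moreover have "filter (\<lambda>j. j < i) (sorted_list_of_set J) = sorted_list_of_set (J \<inter> {..<i})"
    using assms by (intro strict_sorted_equal) (auto simp: sorted_wrt_filter)
  ultimately show ?thesis
    using assms by (simp add: folding_def folded_root_def fold_product_def)
qed

text \<open>Prefixes of the sorted list become initial segments of \<open>J\<close>, which makes
  admissibility a condition on each index separately. The positive root required by a cover can be
  taken to be \<open>\<beta> j\<close>.\<close>

lemma admissible_iff:
  "admissible I \<beta> J \<longleftrightarrow> finite J \<and> J \<subseteq> I \<and>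
    (\<forall>j\<in>J. wlength (fold_product (J \<inter> {..<j}) \<circ> reflection (\<beta> j)) = wlength (fold_product (J \<inter> {..<j})) + 1)"
proof (cases "finite J \<and> J \<subseteq> I")
  case True
  let ?js = "sorted_list_of_set J"
  have take: "reflection_product \<beta> (take k ?js) = fold_product (J \<inter> {..<?js ! k})" if "k < card J" for k
  proof -
    have "take k ?js = sorted_list_of_set (J \<inter> {..<?js ! k})"
    proof (rule strict_sorted_equal)
      have len: "k < length ?js" using that by simp
      have mono: "?js ! a < ?js ! b \<longleftrightarrow> a < b" if "a < length ?js" "b < length ?js" for a b
        using sorted_wrt_nth_less[OF strict_sorted_list_of_set, of a b J]
          sorted_wrt_nth_less[OF strict_sorted_list_of_set, of b a J] that
        by (cases a b rule: linorder_cases) auto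
      show "set (take k ?js) = set (sorted_list_of_set (J \<inter> {..<?js ! k}))"
      proof (intro equalityI[rotated] subsetI)
        fix x assume "x \<in> set (sorted_list_of_set (J \<inter> {..<?js ! k}))"
        then have "x \<in> set ?js" "x < ?js ! k" using True by auto
        then obtain a where "a < length ?js" "x = ?js ! a" by (metis in_set_conv_nth)
        then show "x \<in> set (take k ?js)"
          using mono len \<open>x < ?js ! k\<close> by (auto simp: in_set_conv_nth)
      next
        fix x assume "x \<in> set (take k ?js)"
        then obtain a where "a < k" "x = ?js ! a" using len by (auto simp: in_set_conv_nth)
        then show "x \<in> set (sorted_list_of_set (J \<inter> {..<?js ! k}))"
          using mono[of a k] len True nth_mem[of a ?js] by auto
      qed
    qed (simp_all add: sorted_wrt_take)
    then show ?thesis by (simp add: fold_product_def)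
  qed
  have step: "bruhat_cover (reflection_product \<beta> (take k ?js)) (reflection_product \<beta> (take (Suc k) ?js)) \<longleftrightarrow>
      wlength (fold_product (J \<inter> {..<?js ! k}) \<circ> reflection (\<beta> (?js ! k))) =
      wlength (fold_product (J \<inter> {..<?js ! k})) + 1" if k: "k < card J" for k
  proof -
    have "?js ! k \<in> set ?js" using k by (intro nth_mem) simp
    then have "\<beta> (?js ! k) \<in> pos_roots" using beta_pos True by auto
    moreover have "reflection_product \<beta> (take (Suc k) ?js) =
        fold_product (J \<inter> {..<?js ! k}) \<circ> reflection (\<beta> (?js ! k))"
      using k by (simp add: take_Suc_conv_app_nth reflection_product_append take)
        (simp add: reflection_product_def)
    ultimately show ?thesis
      unfolding bruhat_cover_def take[OF k] by auto
  qed
  have "(\<forall>j\<in>J. P j) \<longleftrightarrow> (\<forall>k<card J. P (?js ! k))" for P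
    using all_set_conv_all_nth[of ?js P] True by simp
  then show ?thesis
    using True step by (simp add: admissible_def)
qed (auto simp: admissible_def)

lemma admissible_finite: "admissible I \<beta> J \<Longrightarrow> finite J"
  and admissible_subset: "admissible I \<beta> J \<Longrightarrow> J \<subseteq> I"
  by (simp_all add: admissible_def)

lemma admissible_cover:
  "admissible I \<beta> J \<Longrightarrow> j \<in> J \<Longrightarrow>
    wlength (fold_product (J \<inter> {..<j}) \<circ> reflection (\<beta> j)) = wlength (fold_product (J \<inter> {..<j})) + 1"
  by (simp add: admissible_iff)

lemma admissible_folded_root_pos:
  assumes "admissible I \<beta> J" "j \<in> J" shows "folded_root J j \<in> pos_roots"
proof -
  have "J \<inter> {..<j} \<subseteq> I" "finite (J \<inter> {..<j})" "j \<in> I" using assms by (auto simp: admissible_iff)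
  then show ?thesis
    unfolding folded_root_def
    using cover_pos[OF fold_product_weyl beta_pos admissible_cover[OF assms]] by blast
qed

subsection \<open>Crossing numbers\<close>

definition root_count :: "'i set \<Rightarrow> 'v \<Rightarrow> int" where
  "root_count C b = int (card {j \<in> I \<inter> C. \<beta> j = b})"

definition neg_ind :: "'v \<Rightarrow> int" where
  "neg_ind b = (if b \<in> pos_roots then 0 else 1)"

text \<open>On roots and for \<open>C = {..<i}\<close> this is \<open>N_i\<close>. At least one of
  the two counts vanishes, so a single formula serves both signs.\<close>

definition crossings :: "'i set \<Rightarrow> 'v \<Rightarrow> int" where
  "crossings C b = neg_ind b + root_count C b - root_count C (- b)"

definition fold_count :: "'i set \<Rightarrow> 'i set \<Rightarrow> 'v \<Rightarrow> int" where
  "fold_count J C a = int (card {j \<in> I \<inter> C - J. folded_root J j = a})"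

definition net_count :: "'i set \<Rightarrow> 'i set \<Rightarrow> 'v \<Rightarrow> int" where
  "net_count J C a = fold_count J C a - fold_count J C (- a)"

text \<open>Initial segments. Since \<open>UNIV\<close> is one, standing for the index at infinity,
  levels and weights come out of the same formula.\<close>

definition lower :: "'i set \<Rightarrow> bool" where
  "lower C \<longleftrightarrow> (\<forall>x\<in>C. \<forall>y\<le>x. y \<in> C)"

lemma lower_simps [simp]: "lower {..<i}" "lower {..i}" "lower UNIV" "lower {}"
  by (auto simp: lower_def)

lemma finite_root_fibre: "finite {j \<in> I. \<beta> j = a}"
proof (cases "a \<in> pos_roots")
  case True
  then show ?thesis using chain by (simp add: lambda_chain_def)
next
  case False
  then have "{j \<in> I. \<beta> j = a} = {}" using beta_pos by auto
  then show ?thesis by (simp only: finite.emptyI)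
qed

lemma root_count_nonpos: "b \<notin> pos_roots \<Longrightarrow> root_count C b = 0"
  using beta_pos by (auto simp: root_count_def card_eq_0_iff)

lemma root_count_UNIV: "b \<in> pos_roots \<Longrightarrow> real_of_int (root_count UNIV b) = form lam (coroot b)"
  using chain by (simp add: lambda_chain_def root_count_def)

lemma chain_count_eq:
  assumes "a \<in> roots" shows "chain_count I \<beta> i a = crossings {..<i} a"
proof -
  have "{j \<in> I. j < i \<and> \<beta> j = b} = {j \<in> I \<inter> {..<i}. \<beta> j = b}" for b by auto
  then show ?thesis
    using assms uminus_pos_roots root_count_nonpos[of "- a" "{..<i}"] root_count_nonpos[of a "{..<i}"]
    by (auto simp: chain_count_def crossings_def neg_ind_def root_count_def)
qed

text \<open>The indices may be infinite in number, but they see only the finitely many products over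
  subsets of \<open>J\<close>, each of which is injective.\<close>

lemma finite_folded_root_fibre:
  assumes "finite J" "J \<subseteq> I" shows "finite {j \<in> I. folded_root J j = a}"
proof -
  have fib: "finite {j \<in> I. v (\<beta> j) = a}" if v: "v \<in> weyl_group" for v
  proof (cases "\<exists>b. v b = a")
    case True
    then obtain b where "v b = a" by blast
    then have "{j \<in> I. v (\<beta> j) = a} = {j \<in> I. \<beta> j = b}" using weyl_group_inj[OF v] by auto
    then show ?thesis using finite_root_fibre by simp
  qed simp
  have "{j \<in> I. folded_root J j = a} \<subseteq> (\<Union>K\<in>Pow J. {j \<in> I. fold_product K (\<beta> j) = a})"
    by (auto simp: folded_root_def)
  moreover have "finite (\<Union>K\<in>Pow J. {j \<in> I. fold_product K (\<beta> j) = a})"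
  proof (intro finite_UN_I)
    fix K assume "K \<in> Pow J"
    then have "fold_product K \<in> weyl_group" using assms finite_subset by (intro fold_product_weyl) auto
    then show "finite {j \<in> I. fold_product K (\<beta> j) = a}" by (rule fib)
  qed (use assms in simp)
  ultimately show ?thesis by (rule finite_subset)
qed

lemma fold_count_split:
  assumes "finite J" "J \<subseteq> I" "D \<subseteq> C"
  shows "fold_count J C a = fold_count J D a + fold_count J (C - D) a"
proof -
  have fin: "finite {j \<in> I \<inter> E - J. folded_root J j = a}" for E
    by (rule finite_subset[OF _ finite_folded_root_fibre[OF assms(1,2), of a]]) auto
  have "{j \<in> I \<inter> C - J. folded_root J j = a} =
      {j \<in> I \<inter> D - J. folded_root J j = a} \<union> {j \<in> I \<inter> (C - D) - J. folded_root J j = a}"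
    using assms(3) by auto
  moreover have "card ({j \<in> I \<inter> D - J. folded_root J j = a} \<union> {j \<in> I \<inter> (C - D) - J. folded_root J j = a}) =
      card {j \<in> I \<inter> D - J. folded_root J j = a} + card {j \<in> I \<inter> (C - D) - J. folded_root J j = a}"
    by (rule card_Un_disjoint[OF fin fin]) auto
  ultimately show ?thesis by (simp add: fold_count_def)
qed

lemma root_count_split:
  assumes "D \<subseteq> C" shows "root_count C a = root_count D a + root_count (C - D) a"
proof -
  have fin: "finite {j \<in> I \<inter> E. \<beta> j = a}" for E
    by (rule finite_subset[OF _ finite_root_fibre[of a]]) auto
  have "{j \<in> I \<inter> C. \<beta> j = a} = {j \<in> I \<inter> D. \<beta> j = a} \<union> {j \<in> I \<inter> (C - D). \<beta> j = a}"
    using assms by auto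
  moreover have "card ({j \<in> I \<inter> D. \<beta> j = a} \<union> {j \<in> I \<inter> (C - D). \<beta> j = a}) =
      card {j \<in> I \<inter> D. \<beta> j = a} + card {j \<in> I \<inter> (C - D). \<beta> j = a}"
    by (rule card_Un_disjoint[OF fin fin]) auto
  ultimately show ?thesis by (simp add: root_count_def)
qed

text \<open>Past the last folding the folded chain is the original one moved by a single Weyl group
  element.\<close>

lemma fold_count_beyond:
  assumes "finite J" "J \<subseteq> I" "\<And>j k. j \<in> I \<inter> E \<Longrightarrow> k \<in> J \<Longrightarrow> k < j"
  shows "fold_count J E (fold_product J b) = root_count E b"
proof -
  have "J \<inter> {..<j} = J" if "j \<in> I \<inter> E" for j
    using assms(3)[OF that] by auto
  moreover have "j \<notin> J" if "j \<in> I \<inter> E" for j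
    using assms(3)[OF that] by blast
  ultimately have "{j \<in> I \<inter> E - J. folded_root J j = fold_product J b} = {j \<in> I \<inter> E. \<beta> j = b}"
    using weyl_group_inj[OF fold_product_weyl[OF assms(1,2)]] by (auto simp: folded_root_def)
  then show ?thesis by (simp add: fold_count_def root_count_def)
qed

lemma net_count_beyond:
  assumes "finite J" "J \<subseteq> I" "\<And>j k. j \<in> I \<inter> E \<Longrightarrow> k \<in> J \<Longrightarrow> k < j"
  shows "net_count J E (fold_product J b) = root_count E b - root_count E (- b)"
  using fold_count_beyond[OF assms, where b = b] fold_count_beyond[OF assms, where b = "- b"]
    weyl_group_uminus[OF fold_product_weyl[OF assms(1,2)]] by (simp add: net_count_def)

lemma net_count_cong:
  assumes "lower C" "J \<inter> C = J' \<inter> C" shows "net_count J C a = net_count J' C a"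
proof -
  have "J \<inter> {..<j} = J' \<inter> {..<j}" if "j \<in> C" for j
    using assms that unfolding lower_def by (auto dest: less_imp_le)
  then have "{j \<in> I \<inter> C - J. folded_root J j = b} = {j \<in> I \<inter> C - J'. folded_root J' j = b}" for b
    using assms(2) by (auto simp: folded_root_def)
  then show ?thesis by (simp add: net_count_def fold_count_def)
qed

text \<open>This is where condition (2) on a chain enters: the affine reflections keep track of the
  number of walls crossed so far.\<close>

lemma crossings_reflection:
  assumes k: "k \<in> I" and b: "b \<in> roots"
  shows "real_of_int (crossings {..k} b) =
    real_of_int (crossings {..<k} (reflection (\<beta> k) b)) + form (\<beta> k) (coroot b) * real_of_int (root_count {..<k} (\<beta> k))"
proof -
  let ?\<beta> = "\<beta> k"
  have \<beta>: "?\<beta> \<in> pos_roots" "?\<beta> \<in> roots" "- ?\<beta> \<notin> pos_roots"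
    using beta_pos[OF k] beta_roots[OF k] uminus_pos_roots by auto
  have count: "root_count {..k} c = root_count {..<k} c + (if c = ?\<beta> then 1 else 0)" for c
  proof -
    have "{j \<in> I \<inter> ({..k} - {..<k}). \<beta> j = c} = (if c = ?\<beta> then {k} else {})"
      using k by (auto simp: not_less dest: antisym)
    then have "root_count ({..k} - {..<k}) c = int (card (if c = ?\<beta> then {k} else {}))"
      unfolding root_count_def by (rule arg_cong)
    then have "root_count ({..k} - {..<k}) c = (if c = ?\<beta> then 1 else 0)" by simp
    moreover have "{..<k} \<subseteq> {..k}" by auto
    ultimately show ?thesis
      using root_count_split[of "{..<k}" "{..k}" c] by simp
  qed
  consider "b = ?\<beta>" | "b = - ?\<beta>" | "b \<noteq> ?\<beta>" "b \<noteq> - ?\<beta>" by blast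
  then show ?thesis
  proof cases
    case 1
    then show ?thesis
      using \<beta> root_count_nonpos[OF \<beta>(3)] root_norm_pos[OF \<beta>(2)] root_pairing_self[OF \<beta>(2)]
      by (simp add: reflection_self crossings_def neg_ind_def count)
  next
    case 2
    have "reflection ?\<beta> b = ?\<beta>"
      using 2 reflection_self[of ?\<beta>] root_norm_pos[OF \<beta>(2)] linear_neg[OF linear_reflection, of ?\<beta> ?\<beta>] by simp
    moreover have "form ?\<beta> (coroot b) = -2"
      using 2 root_pairing_self[OF \<beta>(2)] by (simp add: coroot_def)
    moreover have "?\<beta> \<noteq> - ?\<beta>" using \<beta> by metis
    ultimately show ?thesis
      using 2 \<beta> root_count_nonpos[OF \<beta>(3)] by (simp add: crossings_def neg_ind_def count)
  next
    case 3
    let ?b = "reflection ?\<beta> b"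
    have rb: "?b \<in> roots" using weyl_group_roots[OF reflection_in_weyl_group[OF \<beta>(2)] b] .
    obtain c where c: "form ?\<beta> (coroot b) = of_int c"
      using root_pairing_int[OF \<beta>(2) b] Ints_cases by metis
    \<comment> \<open>The coroot of the reflected root is that of \<open>b\<close> minus
      \<open>c\<close> times that of \<open>\<beta> k\<close>, so condition (2) applies with the
      integer \<open>- c\<close>.\<close>
    have "coroot ?b = coroot b - form (coroot b) (coroot ?\<beta>) *\<^sub>R ?\<beta>"
      using weyl_group_coroot[OF reflection_in_weyl_group[OF \<beta>(2)], of b] by (simp add: reflection_def)
    also have "form (coroot b) (coroot ?\<beta>) *\<^sub>R ?\<beta> = of_int c *\<^sub>R coroot ?\<beta>"
      using c by (simp add: coroot_def form_symmetric[of b ?\<beta>])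
    finally have "coroot ?b = coroot b + of_int (- c) *\<^sub>R coroot ?\<beta>" by simp
    then have "chain_count I \<beta> k ?b = chain_count I \<beta> k b + (- c) * chain_count I \<beta> k ?\<beta>"
      using chain 3 k b rb \<beta>(2) unfolding lambda_chain_def by blast
    then have "crossings {..<k} ?b = crossings {..<k} b - c * root_count {..<k} ?\<beta>"
      using chain_count_eq[OF b] chain_count_eq[OF rb] chain_count_eq[OF \<beta>(2)] \<beta> root_count_nonpos[OF \<beta>(3)]
      by (simp add: crossings_def[of _ ?\<beta>] neg_ind_def[of ?\<beta>])
    moreover have "crossings {..k} b = crossings {..<k} b"
      using 3 minus_equation_iff[of b] by (auto simp: crossings_def count)
    ultimately show ?thesis using c by simp
  qed
qed

lemma reflection_hat_eq:
  "reflection_hat I \<beta> k v = reflection (\<beta> k) v + real_of_int (root_count {..<k} (\<beta> k)) *\<^sub>R \<beta> k"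
proof -
  have "{j \<in> I. j < k \<and> \<beta> j = \<beta> k} = {j \<in> I \<inter> {..<k}. \<beta> j = \<beta> k}" by auto
  then show ?thesis by (simp add: reflection_hat_def affine_reflection_def root_count_def)
qed

text \<open>The link between geometry and counting: the translation part of the affine product
  accounts for the difference between crossings of the original chain and unfolded crossings of the
  folded one. Induction removes the largest folding \<open>k\<close>; up to \<open>k\<close> one
  affine reflection is compared, and beyond \<open>k\<close> both sides grow by the same
  counts.\<close>

lemma crossing_formula:
  assumes "finite J" "J \<subseteq> I" "lower C" "J \<subseteq> C" "b \<in> roots"
  shows "real_of_int (crossings C b) + form (affine_fold 0 J) (coroot (fold_product J b)) =
    real_of_int (neg_ind (fold_product J b) + net_count J C (fold_product J b))"
  using assms
proof (induction J arbitrary: C b rule: finite_linorder_max_induct)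
  case empty
  have "net_count {} C b = root_count C b - root_count C (- b)"
    using net_count_beyond[of "{}" C b] by simp
  then show ?case by (simp add: crossings_def)
next
  case (insert k A)
  let ?J = "insert k A" and ?b = "reflection (\<beta> k) b"
  define l where "l = root_count {..<k} (\<beta> k)"
  have k: "k \<in> I" and A: "A \<subseteq> I" and J: "finite ?J" "?J \<subseteq> I" using insert by auto
  have rb: "?b \<in> roots" using weyl_group_roots[OF reflection_in_weyl_group[OF beta_roots[OF k]]] insert.prems(4) .
  note wA = fold_product_weyl[OF insert.hyps(1) A]
  have wJ: "fold_product ?J b = fold_product A ?b"
    using insert.hyps by (subst fold_product_insert_max) auto
  have IH: "real_of_int (crossings {..<k} ?b) + form (affine_fold 0 A) (coroot (fold_product A ?b)) =
      real_of_int (neg_ind (fold_product A ?b) + net_count A {..<k} (fold_product A ?b))"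
    using insert.IH[of "{..<k}" ?b] insert.hyps A rb by auto
  have "affine_fold 0 ?J = fold_product A (reflection_hat I \<beta> k 0) + affine_fold 0 A"
    using insert.hyps affine_fold_linear_part[OF insert.hyps(1) A, of "reflection_hat I \<beta> k 0"]
    by (subst affine_fold_insert_max) auto
  also have "reflection_hat I \<beta> k 0 = real_of_int l *\<^sub>R \<beta> k"
    by (simp add: reflection_hat_eq reflection_def l_def)
  finally have shift: "affine_fold 0 ?J = real_of_int l *\<^sub>R fold_product A (\<beta> k) + affine_fold 0 A"
    by (simp add: weyl_group_scale[OF wA])
  have "form (fold_product A (\<beta> k)) (coroot (fold_product A ?b)) = form (\<beta> k) (coroot ?b)"
    by (rule weyl_group_pairing[OF wA])
  also have "\<dots> = - form (\<beta> k) (coroot b)"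
    using weyl_group_pairing[OF reflection_in_weyl_group[OF beta_roots[OF k]], of "- \<beta> k" b]
      reflection_self[of "\<beta> k"] root_norm_pos[OF beta_roots[OF k]]
      weyl_group_uminus[OF reflection_in_weyl_group[OF beta_roots[OF k]], of "\<beta> k"] by simp
  finally have at_k: "real_of_int (crossings {..k} b) + form (affine_fold 0 ?J) (coroot (fold_product ?J b)) =
      real_of_int (neg_ind (fold_product ?J b) + net_count A {..<k} (fold_product ?J b))"
    using IH crossings_reflection[OF k insert.prems(4)] by (simp add: shift wJ l_def)
  have kC: "{..k} \<subseteq> C" using insert.prems unfolding lower_def by auto
  \<comment> \<open>The index \<open>k\<close> is folded and so left out of the net count, although
    the original chain counts it.\<close>
  have "net_count ?J {..k} c = net_count A {..<k} c" for c
  proof -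
    have "folded_root ?J j = folded_root A j" if "j < k" for j
      using that by (auto simp: folded_root_def intro!: arg_cong2[of _ _ _ _ fold_product] arg_cong[of _ _ fold_product])
    then have "{j \<in> I \<inter> {..k} - ?J. folded_root ?J j = d} = {j \<in> I \<inter> {..<k} - A. folded_root A j = d}" for d
      by auto
    then show ?thesis by (simp add: net_count_def fold_count_def)
  qed
  moreover have "net_count ?J (C - {..k}) (fold_product ?J b) = root_count (C - {..k}) b - root_count (C - {..k}) (- b)"
    using insert.hyps(2) by (intro net_count_beyond[OF J]) force
  moreover have "net_count ?J C c = net_count ?J {..k} c + net_count ?J (C - {..k}) c" for c
    using fold_count_split[OF J kC] by (simp add: net_count_def)
  moreover have "crossings C b = crossings {..k} b + root_count (C - {..k}) b - root_count (C - {..k}) (- b)"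
    using root_count_split[OF kC] by (simp add: crossings_def)
  ultimately show ?case using at_k by simp
qed

subsection \<open>Levels\<close>

definition wall_state :: "'i set \<Rightarrow> 'i set \<Rightarrow> nat \<Rightarrow> bool" where
  "wall_state J C p \<longleftrightarrow> \<alpha> p \<in> fold_product (J \<inter> C) ` pos_roots"

text \<open>For \<open>C = {..<i}\<close> at a wall \<open>i\<close> this is the level
  \<open>l_i\<close>; for \<open>C = UNIV\<close> it is the pairing of the weight with the coroot of
  \<open>\<alpha> p\<close>.\<close>

definition wall_level :: "'i set \<Rightarrow> 'i set \<Rightarrow> nat \<Rightarrow> int" where
  "wall_level J C p = net_count J C (\<alpha> p) - (if wall_state J C p then 0 else 1)"

definition walls :: "'i set \<Rightarrow> nat \<Rightarrow> 'i set" where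
  "walls J p = {i \<in> I. folded_root J i = \<alpha> p \<or> folded_root J i = - \<alpha> p}"

lemma finite_walls: "finite J \<Longrightarrow> J \<subseteq> I \<Longrightarrow> finite (walls J p)"
  using finite_folded_root_fibre[of J "\<alpha> p"] finite_folded_root_fibre[of J "- \<alpha> p"]
  by (rule_tac finite_subset[of _ "{j \<in> I. folded_root J j = \<alpha> p} \<union> {j \<in> I. folded_root J j = - \<alpha> p}"])
    (auto simp: walls_def)

lemma simple_neq_uminus:
  assumes "p \<in> {1..r}" "q \<in> {1..r}" shows "\<alpha> p \<noteq> - \<alpha> q"
  using simple_pos_roots[OF assms(1)] uminus_pos_roots[OF simple_pos_roots[OF assms(2)]] by auto

lemma wall_state_iff:
  assumes "finite J" "J \<subseteq> I" "p \<in> {1..r}" "i \<in> walls J p"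
  shows "wall_state J {..<i} p \<longleftrightarrow> folded_root J i = \<alpha> p"
proof -
  have w: "fold_product (J \<inter> {..<i}) \<in> weyl_group" by (rule fold_product_weyl) (use assms in auto)
  have i: "i \<in> I" using assms by (simp add: walls_def)
  show ?thesis
  proof
    assume "wall_state J {..<i} p"
    then obtain b where b: "b \<in> pos_roots" "\<alpha> p = fold_product (J \<inter> {..<i}) b" by (auto simp: wall_state_def)
    show "folded_root J i = \<alpha> p"
    proof (rule ccontr)
      assume "folded_root J i \<noteq> \<alpha> p"
      then have "fold_product (J \<inter> {..<i}) (\<beta> i) = fold_product (J \<inter> {..<i}) (- b)"
        using assms(4) b by (auto simp: walls_def folded_root_def weyl_group_uminus[OF w])
      then show False using weyl_group_inj[OF w] beta_pos[OF i] uminus_pos_roots[OF b(1)] by auto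
    qed
  next
    assume "folded_root J i = \<alpha> p"
    then show "wall_state J {..<i} p"
      using beta_pos[OF i] unfolding wall_state_def folded_root_def by (metis imageI)
  qed
qed

lemma net_count_sum:
  assumes "finite J" "J \<subseteq> I" "p \<in> {1..r}"
  shows "net_count J C (\<alpha> p) = (\<Sum>j\<in>walls J p \<inter> C. if j \<in> J then 0 else if folded_root J j = \<alpha> p then 1 else -1)"
proof -
  let ?W = "walls J p \<inter> C"
  have fin: "finite ?W" using finite_walls[OF assms(1,2)] by simp
  have ne: "\<alpha> p \<noteq> - \<alpha> p" using simple_neq_uminus assms(3) by blast
  have "(\<Sum>j\<in>?W. if j \<in> J then 0 else if folded_root J j = \<alpha> p then 1 else (-1::int)) =
      (\<Sum>j\<in>?W. (if j \<notin> J \<and> folded_root J j = \<alpha> p then 1 else 0) - (if j \<notin> J \<and> folded_root J j = - \<alpha> p then 1 else 0))"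
    using ne by (intro sum.cong) (auto simp: walls_def)
  also have "\<dots> = int (card {j \<in> ?W. j \<notin> J \<and> folded_root J j = \<alpha> p}) - int (card {j \<in> ?W. j \<notin> J \<and> folded_root J j = - \<alpha> p})"
    unfolding sum_subtractf using fin by (simp add: sum.If_cases Int_def)
  also have "{j \<in> ?W. j \<notin> J \<and> folded_root J j = \<alpha> p} = {j \<in> I \<inter> C - J. folded_root J j = \<alpha> p}"
    by (auto simp: walls_def)
  also have "{j \<in> ?W. j \<notin> J \<and> folded_root J j = - \<alpha> p} = {j \<in> I \<inter> C - J. folded_root J j = - \<alpha> p}"
    by (auto simp: walls_def)
  finally show ?thesis by (simp add: net_count_def fold_count_def)
qed

lemma level_folding:
  assumes "finite J" "J \<subseteq> I" "p \<in> {1..r}" "i \<in> walls J p"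
  shows "level I (folding \<beta> J) i = wall_level J {..<i} p"
proof -
  have eq: "folded_root J i = \<alpha> p \<or> folded_root J i = - \<alpha> p" using assms(4) by (simp add: walls_def)
  have pos: "\<alpha> p \<in> pos_roots" "- \<alpha> p \<notin> pos_roots"
    using simple_pos_roots[OF assms(3)] uminus_pos_roots by auto
  have ne: "- \<alpha> p \<noteq> \<alpha> p" using pos by metis
  let ?T = "{j. j \<in> I \<and> j < i \<and> snd (fst (folding \<beta> J) j) = 1 \<and>
      (folded_root J j = folded_root J i \<or> folded_root J j = - folded_root J i)}"
  have T: "?T = {j \<in> walls J p \<inter> {..<i}. j \<notin> J}"
    using eq by (auto simp: walls_def folding_fst[OF assms(1)])
  have "(\<Sum>j\<in>?T. root_sgn (folded_root J j)) = (\<Sum>j\<in>{j \<in> walls J p \<inter> {..<i}. j \<notin> J}. if folded_root J j = \<alpha> p then 1 else -1)"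
    unfolding T using pos by (intro sum.cong) (auto simp: root_sgn_def walls_def)
  also have "\<dots> = net_count J {..<i} (\<alpha> p)"
    unfolding net_count_sum[OF assms(1-3)] using finite_walls[OF assms(1,2), of p]
    by (intro sum.mono_neutral_cong_left) auto
  moreover have "folded_root J i \<in> pos_roots \<longleftrightarrow> wall_state J {..<i} p"
    using wall_state_iff[OF assms] eq pos ne by auto
  ultimately show ?thesis
    by (simp add: level_def Let_def folding_fst[OF assms(1)] wall_level_def)
qed

text \<open>This is the crossing formula at infinity, where condition (1) turns the total count of a
  root into the pairing of \<open>lam\<close> with its coroot.\<close>

lemma weight_pairing:
  assumes J: "finite J" "J \<subseteq> I" and p: "p \<in> {1..r}"
  shows "form (affine_fold lam J) (coroot (\<alpha> p)) = real_of_int (wall_level J UNIV p)"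
proof -
  note w = fold_product_weyl[OF J]
  obtain b where b: "b \<in> roots" "\<alpha> p = fold_product J b"
    using weyl_group_preimage_root[OF w simple_roots[OF p]] .
  have nb: "- b \<in> roots" using uminus_roots[OF b(1)] .
  have "real_of_int (crossings UNIV b) = real_of_int (neg_ind b) + form lam (coroot b)"
  proof (cases "b \<in> pos_roots")
    case True
    then show ?thesis
      using root_count_UNIV[OF True] root_count_nonpos[OF uminus_pos_roots[OF True]] by (simp add: crossings_def)
  next
    case False
    then have neg: "- b \<in> pos_roots" using not_pos_iff[OF b(1)] by simp
    then show ?thesis
      using root_count_UNIV[OF neg] root_count_nonpos[OF False] by (simp add: crossings_def coroot_def)
  qed
  moreover have "form (fold_product J lam) (coroot (\<alpha> p)) = form lam (coroot b)"
    unfolding b(2) by (rule weyl_group_pairing[OF w])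
  moreover have "real_of_int (crossings UNIV b) + form (affine_fold 0 J) (coroot (\<alpha> p)) =
      real_of_int (neg_ind (\<alpha> p) + net_count J UNIV (\<alpha> p))"
    using crossing_formula[OF J _ _ b(1), of UNIV] b(2) by simp
  moreover have "wall_state J UNIV p \<longleftrightarrow> b \<in> pos_roots"
    unfolding wall_state_def b(2) using weyl_group_inj[OF w] by auto
  ultimately show ?thesis
    using simple_pos_roots[OF p] affine_fold_linear_part[OF J, of lam]
    by (simp add: wall_level_def neg_ind_def)
qed

subsection \<open>Toggling a wall\<close>

definition toggle :: "'i \<Rightarrow> 'i set \<Rightarrow> 'i set" where
  "toggle k J = (if k \<in> J then J - {k} else insert k J)"

lemma toggle_simps [simp]: "finite (toggle k J) \<longleftrightarrow> finite J" "k \<in> I \<Longrightarrow> toggle k J \<subseteq> I \<longleftrightarrow> J \<subseteq> I"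
  "toggle k (toggle k J) = J" "j \<in> toggle k J \<longleftrightarrow> (if j = k then k \<notin> J else j \<in> J)"
  by (auto simp: toggle_def)

text \<open>Carried through the foldings of \<open>K\<close>, the affine reflection of index
  \<open>k\<close> becomes one in \<open>\<alpha> p\<close>. The crossing formula identifies its
  constant as the level; when the folded root is \<open>- \<alpha> p\<close>, the term
  \<open>neg_ind\<close> supplies the shift by -1.\<close>

lemma affine_fold_hat:
  assumes K: "finite K" "K \<subseteq> I" "\<And>j. j \<in> K \<Longrightarrow> j < k" and k: "k \<in> I" and p: "p \<in> {1..r}"
    and wall: "fold_product K (\<beta> k) = \<alpha> p \<or> fold_product K (\<beta> k) = - \<alpha> p"
  shows "affine_fold (reflection_hat I \<beta> k v) K =
    reflection (\<alpha> p) (affine_fold v K) + real_of_int (wall_level K {..<k} p) *\<^sub>R \<alpha> p"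
proof -
  note w = fold_product_weyl[OF K(1,2)]
  define \<gamma> where "\<gamma> = fold_product K (\<beta> k)"
  define l where "l = root_count {..<k} (\<beta> k)"
  define sh where "sh = affine_fold 0 K"
  have Kk: "K \<inter> {..<k} = K" using K(3) by auto
  have \<beta>: "\<beta> k \<in> pos_roots" "\<beta> k \<in> roots" using beta_pos beta_roots k by auto
  have refl: "reflection (\<alpha> p) = reflection \<gamma>" using wall reflection_uminus[of "\<alpha> p"] by (auto simp: \<gamma>_def)
  have lin: "affine_fold x K = fold_product K x + sh" for x
    unfolding sh_def by (rule affine_fold_linear_part[OF K(1,2)])
  have "affine_fold (reflection_hat I \<beta> k v) K = fold_product K (reflection (\<beta> k) v) + real_of_int l *\<^sub>R \<gamma> + sh"
    by (simp add: lin reflection_hat_eq l_def \<gamma>_def weyl_group_add[OF w] weyl_group_scale[OF w])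
  also have "fold_product K (reflection (\<beta> k) v) = reflection (\<alpha> p) (fold_product K v)"
    unfolding refl \<gamma>_def by (rule weyl_group_conjugate[OF w, symmetric])
  also have "\<dots> = reflection (\<alpha> p) (affine_fold v K) - sh + form sh (coroot (\<alpha> p)) *\<^sub>R \<alpha> p"
    by (simp add: lin reflection_def scaleR_add_left)
  finally have 1: "affine_fold (reflection_hat I \<beta> k v) K =
      reflection (\<alpha> p) (affine_fold v K) + form sh (coroot (\<alpha> p)) *\<^sub>R \<alpha> p + real_of_int l *\<^sub>R \<gamma>" by simp
  have "crossings {..<k} (\<beta> k) = l"
    using \<beta> root_count_nonpos[OF uminus_pos_roots[OF \<beta>(1)]] by (simp add: crossings_def neg_ind_def l_def)
  then have cross: "real_of_int l + form sh (coroot \<gamma>) = real_of_int (neg_ind \<gamma> + net_count K {..<k} \<gamma>)"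
    using crossing_formula[OF K(1,2), of "{..<k}" "\<beta> k"] \<beta> K(3) by (auto simp: sh_def \<gamma>_def)
  have "k \<in> walls K p" using k wall by (simp add: walls_def folded_root_def Kk)
  then have state: "wall_state K {..<k} p \<longleftrightarrow> \<gamma> = \<alpha> p"
    using wall_state_iff[OF K(1,2) p] by (simp add: folded_root_def Kk \<gamma>_def)
  have pos: "\<alpha> p \<in> pos_roots" "- \<alpha> p \<notin> pos_roots"
    using simple_pos_roots[OF p] uminus_pos_roots by auto
  show ?thesis
  proof (cases "\<gamma> = \<alpha> p")
    case True
    then have "form sh (coroot (\<alpha> p)) + real_of_int l = real_of_int (wall_level K {..<k} p)"
      using cross state pos by (simp add: wall_level_def neg_ind_def)
    then show ?thesis unfolding 1 by (simp add: True scaleR_add_left[symmetric] add.assoc)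
  next
    case False
    then have \<gamma>: "\<gamma> = - \<alpha> p" using wall by (simp add: \<gamma>_def)
    then have "form sh (coroot (\<alpha> p)) - real_of_int l = real_of_int (wall_level K {..<k} p)"
      using cross state pos False by (simp add: wall_level_def neg_ind_def coroot_def net_count_def)
    then show ?thesis unfolding 1 by (simp add: \<gamma> scaleR_diff_left[symmetric] add_diff_eq[symmetric])
  qed
qed

lemma wall_level_cong:
  assumes "lower C" "J \<inter> C = J' \<inter> C" shows "wall_level J C p = wall_level J' C p"
  using net_count_cong[OF assms] assms(2) by (simp add: wall_level_def wall_state_def)

lemma folded_root_cong: "J \<inter> {..<k} = J' \<inter> {..<k} \<Longrightarrow> folded_root J k = folded_root J' k"
  by (simp add: folded_root_def)

lemma toggle_initial: "toggle k J \<inter> {..<k} = J \<inter> {..<k}"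
  by auto

lemma toggle_outside: "k \<notin> C \<Longrightarrow> toggle k J \<inter> C = J \<inter> C"
  by (auto simp: toggle_def)

lemma affine_fold_toggle:
  assumes J: "finite J" "J \<subseteq> I" and p: "p \<in> {1..r}" and wall: "k \<in> walls J p"
  shows "affine_fold v (toggle k J) =
    reflection (\<alpha> p) (affine_fold v J) + real_of_int (wall_level J {..<k} p) *\<^sub>R \<alpha> p"
proof -
  have k: "k \<in> I" using wall by (simp add: walls_def)
  have *: "affine_fold v (insert k J) = reflection (\<alpha> p) (affine_fold v J) + real_of_int (wall_level J {..<k} p) *\<^sub>R \<alpha> p"
    if J: "finite J" "J \<subseteq> I" "k \<notin> J" "k \<in> walls J p" for J
  proof -
    let ?K = "J \<inter> {..<k}" and ?T = "J \<inter> {k<..}"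
    have split: "J = ?K \<union> ?T" "insert k J = ?K \<union> ({k} \<union> ?T)"
      using J(3) by (auto simp: not_less_iff_gr_or_eq)
    have 1: "affine_fold v J = affine_fold (affine_fold v ?T) ?K"
      by (subst split(1), rule affine_fold_Un) (use J in auto)
    have "affine_fold v (insert k J) = affine_fold (affine_fold v ({k} \<union> ?T)) ?K"
      by (subst split(2), rule affine_fold_Un) (use J in auto)
    also have "affine_fold v ({k} \<union> ?T) = reflection_hat I \<beta> k (affine_fold v ?T)"
      using J by (subst affine_fold_Un) auto
    also have "affine_fold (reflection_hat I \<beta> k (affine_fold v ?T)) ?K =
        reflection (\<alpha> p) (affine_fold (affine_fold v ?T) ?K) + real_of_int (wall_level ?K {..<k} p) *\<^sub>R \<alpha> p"
      by (rule affine_fold_hat) (use J k p in \<open>auto simp: walls_def folded_root_def\<close>)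
    also have "wall_level ?K {..<k} p = wall_level J {..<k} p"
      by (rule wall_level_cong) auto
    finally show ?thesis by (simp add: 1)
  qed
  show ?thesis
  proof (cases "k \<in> J")
    case False
    then show ?thesis using *[of J] J wall by (simp add: toggle_def)
  next
    case True
    let ?J = "J - {k}"
    have init: "?J \<inter> {..<k} = J \<inter> {..<k}" by auto
    have J': "toggle k J = ?J" "insert k ?J = J" using True by (auto simp: toggle_def)
    have "affine_fold v J = reflection (\<alpha> p) (affine_fold v ?J) + real_of_int (wall_level J {..<k} p) *\<^sub>R \<alpha> p"
      using *[of ?J, unfolded J'(2) wall_level_cong[OF lower_simps(1) init]] J wall folded_root_cong[OF init]
      by (auto simp: walls_def)
    then have "reflection (\<alpha> p) (affine_fold v J) =
        affine_fold v ?J - real_of_int (wall_level J {..<k} p) *\<^sub>R \<alpha> p"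
      using reflection_involutive[OF simple_norm_nonzero[OF p]] reflection_self[OF simple_norm_nonzero[OF p]]
        linear_add[OF linear_reflection] linear_scale[OF linear_reflection] by simp
    then show ?thesis by (simp add: J')
  qed
qed

text \<open>The reflection toggled at \<open>k\<close> is conjugated to the front of the product,
  where it becomes the reflection in \<open>\<alpha> p\<close>.\<close>

lemma fold_product_toggle:
  assumes J: "finite J" "J \<subseteq> I" and p: "p \<in> {1..r}" and wall: "k \<in> walls J p" and C: "lower C" "k \<in> C"
  shows "fold_product (toggle k J \<inter> C) = reflection (\<alpha> p) \<circ> fold_product (J \<inter> C)"
proof -
  have k: "k \<in> I" using wall by (simp add: walls_def)
  have *: "fold_product (insert k J \<inter> C) = reflection (\<alpha> p) \<circ> fold_product (J \<inter> C)"
    if J: "finite J" "J \<subseteq> I" "k \<notin> J" "k \<in> walls J p" for J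
  proof -
    let ?K = "J \<inter> {..<k}" and ?T = "J \<inter> C \<inter> {k<..}"
    have split: "J \<inter> C = ?K \<union> ?T" "insert k J \<inter> C = ?K \<union> ({k} \<union> ?T)"
      using J(3) C unfolding lower_def by (auto simp: not_less_iff_gr_or_eq less_imp_le)
    have w: "fold_product ?K \<in> weyl_group" by (rule fold_product_weyl) (use J in auto)
    have 1: "fold_product (J \<inter> C) = fold_product ?K \<circ> fold_product ?T"
      by (subst split(1), rule fold_product_Un) (use J in auto)
    have "fold_product (insert k J \<inter> C) = fold_product ?K \<circ> fold_product ({k} \<union> ?T)"
      by (subst split(2), rule fold_product_Un) (use J in auto)
    also have "fold_product ({k} \<union> ?T) = reflection (\<beta> k) \<circ> fold_product ?T"
      using J by (subst fold_product_Un) auto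
    also have "fold_product ?K \<circ> (reflection (\<beta> k) \<circ> fold_product ?T) =
        (reflection (folded_root J k) \<circ> fold_product ?K) \<circ> fold_product ?T"
      unfolding folded_root_def reflection_left[OF w] by (simp add: o_assoc)
    also have "reflection (folded_root J k) = reflection (\<alpha> p)"
      using J(4) reflection_uminus[of "\<alpha> p"] by (auto simp: walls_def)
    finally show ?thesis by (simp only: 1 o_assoc)
  qed
  show ?thesis
  proof (cases "k \<in> J")
    case False
    then show ?thesis using *[of J] J wall by (simp add: toggle_def)
  next
    case True
    let ?J = "J - {k}"
    have init: "?J \<inter> {..<k} = J \<inter> {..<k}" by auto
    have J': "toggle k J = ?J" "insert k ?J = J" using True by (auto simp: toggle_def)
    have "fold_product (J \<inter> C) = reflection (\<alpha> p) \<circ> fold_product (?J \<inter> C)"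
      using *[of ?J, unfolded J'(2)] J wall folded_root_cong[OF init] by (auto simp: walls_def)
    then show ?thesis
      using reflection_involutive[OF simple_norm_nonzero[OF p]] by (simp add: J' fun_eq_iff)
  qed
qed

lemma folded_root_toggle:
  assumes "finite J" "J \<subseteq> I" "p \<in> {1..r}" "k \<in> walls J p"
  shows "folded_root (toggle k J) j = (if k < j then reflection (\<alpha> p) (folded_root J j) else folded_root J j)"
proof (cases "k < j")
  case True
  then show ?thesis using fold_product_toggle[OF assms, of "{..<j}"] by (simp add: folded_root_def)
next
  case False
  then show ?thesis using toggle_outside[of k "{..<j}" J] by (simp add: folded_root_def)
qed

lemma reflection_simple_eq_iff:
  assumes "p \<in> {1..r}"
  shows "reflection (\<alpha> p) v = \<alpha> p \<longleftrightarrow> v = - \<alpha> p" "reflection (\<alpha> p) v = - \<alpha> p \<longleftrightarrow> v = \<alpha> p"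
  using reflection_involutive[OF simple_norm_nonzero[OF assms]] reflection_self[OF simple_norm_nonzero[OF assms]]
  by (metis minus_minus linear_neg[OF linear_reflection])+

text \<open>Later folded roots are reflected in \<open>\<alpha> p\<close>, which exchanges
  \<open>\<alpha> p\<close> and \<open>- \<alpha> p\<close>. Hence the numbering of the walls
  survives every flip.\<close>

lemma walls_toggle:
  assumes "finite J" "J \<subseteq> I" "p \<in> {1..r}" "k \<in> walls J p" shows "walls (toggle k J) p = walls J p"
  using folded_root_toggle[OF assms] reflection_simple_eq_iff[OF assms(3)] by (auto simp: walls_def)

subsection \<open>Root operators\<close>

definition wall_list :: "'i set \<Rightarrow> nat \<Rightarrow> 'i list" where
  "wall_list J p = sorted_list_of_set (walls J p)"

abbreviation wall_num :: "'i set \<Rightarrow> nat \<Rightarrow> nat" where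
  "wall_num J p \<equiv> length (wall_list J p)"

text \<open>The part of the chain before the \<open>k\<close>-th wall; the default
  \<open>UNIV\<close> makes \<open>k = wall_num J p\<close> the end at infinity.\<close>

definition cut :: "'i set \<Rightarrow> nat \<Rightarrow> nat \<Rightarrow> 'i set" where
  "cut J p k = (if k < wall_num J p then {..<wall_list J p ! k} else UNIV)"

definition sign_at :: "'i set \<Rightarrow> nat \<Rightarrow> nat \<Rightarrow> bool" where
  "sign_at J p k \<longleftrightarrow> wall_state J (cut J p k) p"

definition fold_at :: "'i set \<Rightarrow> nat \<Rightarrow> nat \<Rightarrow> bool" where
  "fold_at J p k \<longleftrightarrow> wall_list J p ! k \<in> J"

lemma lower_cut [simp]: "lower (cut J p k)"
  by (simp add: cut_def)

lemma wall_list_less_iff: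
  "a < wall_num J p \<Longrightarrow> b < wall_num J p \<Longrightarrow> wall_list J p ! a < wall_list J p ! b \<longleftrightarrow> a < b"
  unfolding wall_list_def by (rule strict_sorted_nth_less_iff) simp_all

lemma wall_list_eq_iff:
  "a < wall_num J p \<Longrightarrow> b < wall_num J p \<Longrightarrow> wall_list J p ! a = wall_list J p ! b \<longleftrightarrow> a = b"
  unfolding wall_list_def by (rule nth_eq_iff_index_eq) simp_all

lemma wall_list_cut_iff:
  "k < wall_num J p \<Longrightarrow> j \<le> wall_num J p \<Longrightarrow> wall_list J p ! k \<in> cut J p j \<longleftrightarrow> k < j"
  by (auto simp: cut_def wall_list_less_iff)

lemma wall_list_nth: "finite J \<Longrightarrow> J \<subseteq> I \<Longrightarrow> k < wall_num J p \<Longrightarrow> wall_list J p ! k \<in> walls J p"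
  using nth_mem[of k "wall_list J p"] finite_walls[of J p] by (simp add: wall_list_def)

lemma wallsE:
  assumes "finite J" "J \<subseteq> I" "x \<in> walls J p"
  obtains k where "k < wall_num J p" "x = wall_list J p ! k"
proof -
  have "x \<in> set (wall_list J p)" using assms finite_walls by (simp add: wall_list_def)
  then show ?thesis using that by (metis in_set_conv_nth)
qed

lemma walls_cut:
  assumes "finite J" "J \<subseteq> I" "k \<le> wall_num J p"
  shows "walls J p \<inter> cut J p k = (!) (wall_list J p) ` {..<k}"
proof (intro equalityI subsetI)
  fix x assume "x \<in> walls J p \<inter> cut J p k"
  moreover from this obtain i where "i < wall_num J p" "x = wall_list J p ! i"
    using wallsE[OF assms(1,2)] by blast
  ultimately show "x \<in> (!) (wall_list J p) ` {..<k}"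
    using wall_list_cut_iff assms(3) by auto
next
  fix x assume "x \<in> (!) (wall_list J p) ` {..<k}"
  then show "x \<in> walls J p \<inter> cut J p k"
    using wall_list_cut_iff[of _ J p k] wall_list_nth[OF assms(1,2)] assms(3) by auto
qed

lemma sign_at_iff:
  assumes "finite J" "J \<subseteq> I" "p \<in> {1..r}" "k < wall_num J p"
  shows "sign_at J p k \<longleftrightarrow> folded_root J (wall_list J p ! k) = \<alpha> p"
  using wall_state_iff[OF assms(1-3) wall_list_nth[OF assms(1,2,4)]] assms(4) by (simp add: sign_at_def cut_def)

lemma wall_level_cut:
  assumes J: "finite J" "J \<subseteq> I" and p: "p \<in> {1..r}" and k: "k \<le> wall_num J p"
  shows "wall_level J (cut J p k) p = step_level (sign_at J p) (fold_at J p) k"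
proof -
  have "inj_on ((!) (wall_list J p)) {..<k}"
    using k by (auto simp: inj_on_def wall_list_eq_iff)
  then have "net_count J (cut J p k) (\<alpha> p) = step_height (sign_at J p) (fold_at J p) k"
    unfolding net_count_sum[OF J p] walls_cut[OF J k] step_height_def
    using k by (auto simp: sum.reindex sign_at_iff[OF J p] fold_at_def intro!: sum.cong)
  then show ?thesis by (simp add: wall_level_def step_level_def sign_at_def)
qed

text \<open>A cover leaves the positive side only through a wall of \<open>\<alpha> p\<close>; this
  is applied in turn to the foldings between \<open>C\<close> and \<open>C'\<close>.\<close>

lemma wall_state_persist:
  assumes adm: "admissible I \<beta> J" and p: "p \<in> {1..r}" and C: "lower C" "lower C'" "C \<subseteq> C'"
    and pos: "wall_state J C p" and no_wall: "\<And>j. j \<in> J \<Longrightarrow> j \<in> C' \<Longrightarrow> j \<notin> C \<Longrightarrow> folded_root J j \<noteq> \<alpha> p"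
  shows "wall_state J C' p"
proof -
  have J: "finite J" "J \<subseteq> I" using adm by (auto simp: admissible_iff)
  \<comment> \<open>The sets \<open>A\<close> of foldings beyond \<open>C\<close> leave no gap, so
    that \<open>J \<inter> C \<union> A\<close> is always an initial segment of
    \<open>J\<close>.\<close>
  have "(\<forall>j\<in>A. j \<in> J \<and> j \<in> C' \<and> j \<notin> C \<and> J \<inter> {..<j} \<subseteq> C \<union> A) \<longrightarrow>
      \<alpha> p \<in> fold_product (J \<inter> C \<union> A) ` pos_roots" if "finite A" for A
    using that
  proof (induction A rule: finite_linorder_max_induct)
    case empty
    then show ?case using pos by (simp add: wall_state_def)
  next
    case (insert b A)
    show ?case
    proof
      assume H: "\<forall>j\<in>insert b A. j \<in> J \<and> j \<in> C' \<and> j \<notin> C \<and> J \<inter> {..<j} \<subseteq> C \<union> insert b A"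
      have b: "b \<in> J" "b \<in> I" "b \<in> C'" "b \<notin> C" using H J by auto
      have IH: "\<alpha> p \<in> fold_product (J \<inter> C \<union> A) ` pos_roots"
      proof -
        have "J \<inter> {..<j} \<subseteq> C \<union> A" if j: "j \<in> A" for j
        proof -
          have "J \<inter> {..<j} \<subseteq> C \<union> insert b A" using H j by blast
          moreover have "b \<notin> {..<j}" using insert.hyps(2) j by auto
          ultimately show ?thesis by blast
        qed
        then show ?thesis using insert.IH H by blast
      qed
      have "x < b" if "x \<in> C" for x
        using C(1) that b(4) unfolding lower_def by (meson not_less)
      then have init: "J \<inter> {..<b} = J \<inter> C \<union> A" using H insert.hyps(2) by auto
      have "fold_product (J \<inter> C \<union> insert b A) = fold_product (insert b (J \<inter> {..<b}))"
        by (simp add: init)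
      also have "\<dots> = fold_product (J \<inter> {..<b}) \<circ> reflection (\<beta> b)"
        using J(1) by (subst fold_product_insert_max) auto
      finally have step: "fold_product (J \<inter> C \<union> insert b A) = fold_product (J \<inter> {..<b}) \<circ> reflection (\<beta> b)" .
      have w: "fold_product (J \<inter> {..<b}) \<in> weyl_group" by (rule fold_product_weyl) (use J in auto)
      show "\<alpha> p \<in> fold_product (J \<inter> C \<union> insert b A) ` pos_roots"
        using cover_leaves_positive[OF w p beta_pos[OF b(2)] admissible_cover[OF adm b(1)]] IH
          no_wall[OF b(1,3,4)] unfolding step folded_root_def[symmetric] init[symmetric] by blast
    qed
  qed
  from this[of "J \<inter> C' - C"] have "\<alpha> p \<in> fold_product (J \<inter> C \<union> (J \<inter> C' - C)) ` pos_roots"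
    using J C(2) unfolding lower_def by (fastforce dest: less_imp_le)
  moreover have "J \<inter> C \<union> (J \<inter> C' - C) = J \<inter> C'" using C(3) by auto
  ultimately show ?thesis by (simp add: wall_state_def)
qed

lemma cut_mono: "a \<le> b \<Longrightarrow> cut J p a \<subseteq> cut J p b"
  using wall_list_less_iff[of a J p b] by (cases "a = b") (auto simp: cut_def intro: less_trans)

text \<open>The foldings of an admissible subset have positive folded roots, so at a wall the root
  is \<open>\<alpha> p\<close> itself; away from folded walls the positive side persists.\<close>

lemma admissible_step_word:
  assumes adm: "admissible I \<beta> J" and p: "p \<in> {1..r}"
  shows "step_word (wall_num J p) (sign_at J p) (fold_at J p)"
  unfolding step_word_def
proof (intro conjI allI impI)
  have J: "finite J" "J \<subseteq> I" using adm by (auto simp: admissible_iff)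
  have wallI: "j \<in> walls J p" if "j \<in> J" "folded_root J j = \<alpha> p" for j
    using that J by (auto simp: walls_def)
  show "sign_at J p 0"
    unfolding sign_at_def
  proof (rule wall_state_persist[OF adm p _ _ empty_subsetI])
    show "wall_state J {} p" using simple_pos_roots[OF p] by (simp add: wall_state_def)
    fix j assume "j \<in> J" "j \<in> cut J p 0"
    then show "folded_root J j \<noteq> \<alpha> p" using walls_cut[OF J, of 0 p] wallI by auto
  qed simp_all
  show "sign_at J p j" if "j < wall_num J p" "fold_at J p j" for j
    unfolding sign_at_iff[OF J p that(1)]
    using admissible_folded_root_pos[OF adm, of "wall_list J p ! j"] that(2) wall_list_nth[OF J that(1)]
      uminus_pos_roots[OF simple_pos_roots[OF p]] by (auto simp: walls_def fold_at_def)
  show "sign_at J p (Suc j)" if j: "j < wall_num J p" and s: "sign_at J p j \<and> \<not> fold_at J p j" for j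
    unfolding sign_at_def
  proof (rule wall_state_persist[OF adm p, of "cut J p j"])
    show "wall_state J (cut J p j) p" using s by (simp add: sign_at_def)
    fix i assume i: "i \<in> J" "i \<in> cut J p (Suc j)" "i \<notin> cut J p j"
    show "folded_root J i \<noteq> \<alpha> p"
    proof
      assume "folded_root J i = \<alpha> p"
      then have "i \<in> walls J p" using wallI i by blast
      then have "i \<in> (!) (wall_list J p) ` {..<Suc j}" "i \<notin> (!) (wall_list J p) ` {..<j}"
        using walls_cut[OF J, of "Suc j" p] walls_cut[OF J, of j p] i j by auto
      then have "i = wall_list J p ! j" by (auto simp: less_Suc_eq)
      then show False using i s by (simp add: fold_at_def)
    qed
  qed (simp_all add: cut_mono)
qed

text \<open>The last wall has the index at infinity as its right neighbour, so there the second
  toggle is dropped.\<close>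

definition flip_walls :: "'i set \<Rightarrow> nat \<Rightarrow> nat \<Rightarrow> 'i set" where
  "flip_walls J p k =
    (if Suc k < wall_num J p then toggle (wall_list J p ! Suc k) (toggle (wall_list J p ! k) J)
     else toggle (wall_list J p ! k) J)"

context
  fixes J p k
  assumes J: "finite J" "J \<subseteq> I" and p: "p \<in> {1..r}" and k: "k < wall_num J p"
begin

private abbreviation "a \<equiv> wall_list J p ! k"
private abbreviation "b \<equiv> wall_list J p ! Suc k"

lemma toggle_first: "finite (toggle a J)" "toggle a J \<subseteq> I" "walls (toggle a J) p = walls J p"
  using J walls_toggle[OF J p wall_list_nth[OF J k]] wall_list_nth[OF J k] by (simp_all add: walls_def)

lemma flip_walls_subset: "finite (flip_walls J p k)" "flip_walls J p k \<subseteq> I"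
  using toggle_first wall_list_nth[OF J, of "Suc k" p] by (auto simp: flip_walls_def walls_def)

lemma flip_walls_walls: "walls (flip_walls J p k) p = walls J p"
  using toggle_first walls_toggle[OF toggle_first(1,2) p] wall_list_nth[OF J, of "Suc k" p]
  by (simp add: flip_walls_def)

lemma flip_walls_list: "wall_list (flip_walls J p k) p = wall_list J p" "cut (flip_walls J p k) p = cut J p"
  by (simp_all add: wall_list_def flip_walls_walls fun_eq_iff cut_def)

lemma flip_walls_mem:
  "j \<in> flip_walls J p k \<longleftrightarrow> (if j = a \<or> Suc k < wall_num J p \<and> j = b then j \<notin> J else j \<in> J)"
  using wall_list_less_iff[OF k, of "Suc k"] by (auto simp: flip_walls_def)

lemma flip_walls_involutive: "flip_walls (flip_walls J p k) p k = J"
  using flip_walls_list wall_list_less_iff[OF k, of "Suc k"]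
  by (auto simp: flip_walls_def[of "flip_walls J p k"] flip_walls_mem split: if_splits)

text \<open>To the right of both walls the two reflections in \<open>\<alpha> p\<close> cancel; only
  the strip between them is affected.\<close>

lemma fold_product_flip:
  assumes C: "lower C"
  shows "fold_product (flip_walls J p k \<inter> C) =
    (if a \<in> C \<and> \<not> (Suc k < wall_num J p \<and> b \<in> C) then reflection (\<alpha> p) \<circ> fold_product (J \<inter> C)
     else fold_product (J \<inter> C))"
proof -
  have first: "fold_product (toggle a J \<inter> C) =
      (if a \<in> C then reflection (\<alpha> p) \<circ> fold_product (J \<inter> C) else fold_product (J \<inter> C))"
    using fold_product_toggle[OF J p wall_list_nth[OF J k] C] toggle_outside[of a C J] by simp
  show ?thesis
  proof (cases "Suc k < wall_num J p")
    case True
    have wall: "b \<in> walls (toggle a J) p" using wall_list_nth[OF J True] toggle_first by simp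
    have "a \<in> C" if "b \<in> C"
      using C that wall_list_less_iff[OF k True] unfolding lower_def by (auto dest: less_imp_le)
    moreover have "fold_product (flip_walls J p k \<inter> C) =
        (if b \<in> C then reflection (\<alpha> p) \<circ> fold_product (toggle a J \<inter> C) else fold_product (toggle a J \<inter> C))"
      using fold_product_toggle[OF toggle_first(1,2) p wall C] toggle_outside[of b C "toggle a J"] True
      by (simp add: flip_walls_def)
    moreover have "reflection (\<alpha> p) \<circ> (reflection (\<alpha> p) \<circ> w) = w" for w
      using reflection_involutive[OF simple_norm_nonzero[OF p]] by (simp add: fun_eq_iff)
    ultimately show ?thesis using first True by auto
  next
    case False
    then show ?thesis using first by (simp add: flip_walls_def)
  qed
qed

lemma sign_at_flip:
  assumes "j \<le> wall_num J p"
  shows "sign_at (flip_walls J p k) p j = flip_state k (sign_at J p) j"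
proof -
  have w: "fold_product (J \<inter> cut J p j) \<in> weyl_group" by (rule fold_product_weyl) (use J in auto)
  have "a \<in> cut J p j \<longleftrightarrow> k < j" using wall_list_cut_iff[OF k assms] .
  moreover have "Suc k < wall_num J p \<Longrightarrow> b \<in> cut J p j \<longleftrightarrow> Suc k < j" using wall_list_cut_iff[OF _ assms] .
  ultimately have "fold_product (flip_walls J p k \<inter> cut J p j) =
      (if j = Suc k then reflection (\<alpha> p) \<circ> fold_product (J \<inter> cut J p j) else fold_product (J \<inter> cut J p j))"
    using fold_product_flip[of "cut J p j"] assms by auto
  then show ?thesis
    using simple_left_image[OF w p] by (auto simp: sign_at_def wall_state_def flip_state_def flip_walls_list)
qed

lemma fold_at_flip:
  assumes "j < wall_num J p"
  shows "fold_at (flip_walls J p k) p j = flip_fold k (fold_at J p) j"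
  using assms k wall_list_eq_iff[OF assms k] wall_list_eq_iff[OF assms, of "Suc k"]
  by (auto simp: fold_at_def flip_walls_list flip_walls_mem flip_fold_def)

lemma flip_walls_steps:
  "\<And>j. j \<le> wall_num J p \<Longrightarrow> step_level (sign_at (flip_walls J p k) p) (fold_at (flip_walls J p k) p) j =
    step_level (flip_state k (sign_at J p)) (flip_fold k (fold_at J p)) j"
  "step_max (wall_num J p) (sign_at (flip_walls J p k) p) (fold_at (flip_walls J p k) p) =
    step_max (wall_num J p) (flip_state k (sign_at J p)) (flip_fold k (fold_at J p))"
  "last_max (wall_num J p) (sign_at (flip_walls J p k) p) (fold_at (flip_walls J p k) p) =
    last_max (wall_num J p) (flip_state k (sign_at J p)) (flip_fold k (fold_at J p))"
  "first_max (wall_num J p) (sign_at (flip_walls J p k) p) (fold_at (flip_walls J p k) p) =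
    first_max (wall_num J p) (flip_state k (sign_at J p)) (flip_fold k (fold_at J p))"
  "step_word (wall_num J p) (sign_at (flip_walls J p k) p) (fold_at (flip_walls J p k) p) =
    step_word (wall_num J p) (flip_state k (sign_at J p)) (flip_fold k (fold_at J p))"
  by (rule step_level_cong step_max_cong step_word_cong; use sign_at_flip fold_at_flip in simp)+

text \<open>Two toggles compose reflections in parallel walls to a translation by the difference of
  their levels. A single toggle reflects the weight, whose pairing is the level at the end of the
  word.\<close>

lemma flip_walls_weight:
  "affine_fold lam (flip_walls J p k) = affine_fold lam J + real_of_int
    (if Suc k < wall_num J p
     then step_level (flip_state k (sign_at J p)) (flip_fold k (fold_at J p)) (Suc k) - step_level (sign_at J p) (fold_at J p) k
     else step_level (sign_at J p) (fold_at J p) k - step_level (sign_at J p) (fold_at J p) (wall_num J p)) *\<^sub>R \<alpha> p"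
proof -
  let ?l = "step_level (sign_at J p) (fold_at J p)"
  have "wall_level J {..<a} p = ?l k"
    using wall_level_cut[OF J p, of k] k by (simp add: cut_def)
  then have first: "affine_fold v (toggle a J) = reflection (\<alpha> p) (affine_fold v J) + real_of_int (?l k) *\<^sub>R \<alpha> p" for v
    using affine_fold_toggle[OF J p wall_list_nth[OF J k]] by simp
  show ?thesis
  proof (cases "Suc k < wall_num J p")
    case True
    let ?J = "flip_walls J p k"
    let ?m = "step_level (flip_state k (sign_at J p)) (flip_fold k (fold_at J p)) (Suc k)"
    have flip: "?J = toggle b (toggle a J)" using True by (simp add: flip_walls_def)
    have wall: "b \<in> walls (toggle a J) p" using wall_list_nth[OF J True] toggle_first by simp
    have "wall_level (toggle a J) {..<b} p = wall_level ?J {..<b} p"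
      unfolding flip by (rule wall_level_cong) (simp_all add: toggle_initial)
    also have "\<dots> = step_level (sign_at ?J p) (fold_at ?J p) (Suc k)"
      using wall_level_cut[OF flip_walls_subset p, of "Suc k"] True by (simp add: cut_def flip_walls_list)
    also have "\<dots> = ?m" using flip_walls_steps(1)[of "Suc k"] True by simp
    finally have "affine_fold lam ?J = reflection (\<alpha> p) (affine_fold lam (toggle a J)) + real_of_int ?m *\<^sub>R \<alpha> p"
      using affine_fold_toggle[OF toggle_first(1,2) p wall] by (simp add: flip)
    also have "reflection (\<alpha> p) (affine_fold lam (toggle a J)) = affine_fold lam J - real_of_int (?l k) *\<^sub>R \<alpha> p"
      unfolding first using reflection_involutive[OF simple_norm_nonzero[OF p]]
        reflection_self[OF simple_norm_nonzero[OF p]]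
      by (simp add: linear_add[OF linear_reflection] linear_scale[OF linear_reflection])
    finally show ?thesis using True by (simp add: scaleR_diff_left)
  next
    case False
    then have "form (affine_fold lam J) (coroot (\<alpha> p)) = ?l (wall_num J p)"
      using weight_pairing[OF J p] wall_level_cut[OF J p, of "wall_num J p"] by (simp add: cut_def)
    then have "reflection (\<alpha> p) (affine_fold lam J) = affine_fold lam J - real_of_int (?l (wall_num J p)) *\<^sub>R \<alpha> p"
      by (simp add: reflection_def)
    then show ?thesis using False first[of lam] by (simp add: flip_walls_def scaleR_diff_left)
  qed
qed

text \<open>A folding at a wall is a cover because \<open>word\<close> makes its state positive, and
  away from the strip the other foldings keep their prefixes. Inside the strip the prefix is
  multiplied by the reflection in \<open>\<alpha> p\<close>, which preserves covers with both ends
  on one side. The condition \<open>between\<close> ensures this: the strip is entirely positive or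
  entirely negative.\<close>

lemma flip_walls_admissible:
  assumes adm: "admissible I \<beta> J"
    and word: "step_word (wall_num J p) (flip_state k (sign_at J p)) (flip_fold k (fold_at J p))"
    and between: "sign_at J p k \<and> \<not> fold_at J p k \<or> \<not> sign_at J p (Suc k)"
  shows "admissible I \<beta> (flip_walls J p k)"
  unfolding admissible_iff
proof (intro conjI ballI flip_walls_subset)
  let ?J = "flip_walls J p k"
  fix j assume j: "j \<in> ?J"
  then have jI: "j \<in> I" using flip_walls_subset by auto
  let ?u = "fold_product (J \<inter> {..<j})" and ?u' = "fold_product (?J \<inter> {..<j})"
  have u: "?u \<in> weyl_group" by (rule fold_product_weyl) (use J in auto)
  have u': "?u' \<in> weyl_group" by (rule fold_product_weyl) (use flip_walls_subset in auto)
  show "wlength (?u' \<circ> reflection (\<beta> j)) = wlength ?u' + 1"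
  proof (cases "j \<in> walls J p")
    case True
    then obtain i where i: "i < wall_num J p" "j = wall_list J p ! i" using wallsE[OF J] by blast
    have "fold_at ?J p i" using j i by (simp add: fold_at_def flip_walls_list)
    then have "sign_at ?J p i"
      using flip_walls_steps(5) word i(1) by (auto simp: step_word_def)
    then have "folded_root ?J j = \<alpha> p"
      using sign_at_iff[OF flip_walls_subset p, of i] i by (simp add: flip_walls_list)
    then have 1: "?u' (\<beta> j) = \<alpha> p" by (simp add: folded_root_def)
    then have "?u' \<circ> reflection (\<beta> j) = reflection (\<alpha> p) \<circ> ?u'"
      using reflection_left[OF u', of "\<beta> j"] by simp
    moreover have "\<alpha> p \<in> ?u' ` pos_roots" using 1 beta_pos[OF jI] by (metis imageI)
    ultimately show ?thesis using wlength_simple_left_up[OF u' p] by simp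
  next
    case False
    have "j \<in> J"
      using j False wall_list_nth[OF J k] wall_list_nth[OF J, of "Suc k" p] by (auto simp: flip_walls_mem split: if_splits)
    then have cover: "wlength (?u \<circ> reflection (\<beta> j)) = wlength ?u + 1" by (rule admissible_cover[OF adm])
    show ?thesis
    proof (cases "a < j \<and> \<not> (Suc k < wall_num J p \<and> b < j)")
      case False
      then show ?thesis using fold_product_flip[OF lower_simps(1), of j] cover
        by (simp only: lessThan_iff if_False)
    next
      case mid: True
      then have eq: "?u' = reflection (\<alpha> p) \<circ> ?u"
        using fold_product_flip[OF lower_simps(1), of j] by (simp only: lessThan_iff simp_thms if_True)
      have "insert j (J \<inter> {..<j}) = J \<inter> {..j}" using \<open>j \<in> J\<close> by auto
      then have uj: "?u \<circ> reflection (\<beta> j) = fold_product (J \<inter> {..j})"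
        using fold_product_insert_max[of "J \<inter> {..<j}" j] J(1) by simp
      have before: "Suc k < wall_num J p \<Longrightarrow> j < b"
        using mid False wall_list_nth[OF J, of "Suc k" p] by (metis linorder_neqE)
      have idx: "i \<le> k" if "i < wall_num J p" "wall_list J p ! i \<le> j" for i
      proof (rule ccontr)
        assume "\<not> i \<le> k"
        then have "Suc k < wall_num J p" "b \<le> wall_list J p ! i"
          using that(1) wall_list_less_iff[of "Suc k" J p i] by (cases "i = Suc k"; auto simp: less_imp_le)+
        then show False using before that(2) by auto
      qed
      have "wall_state J {..<j} p \<longleftrightarrow> wall_state J {..j} p"
        using between
      proof
        assume sk: "sign_at J p k \<and> \<not> fold_at J p k"
        have *: "wall_state J C p" if C: "lower C" "{..<a} \<subseteq> C" "C \<subseteq> {..j}" for C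
        proof (rule wall_state_persist[OF adm p _ C(1,2)])
          show "wall_state J {..<a} p" using sk k by (simp add: sign_at_def cut_def)
          fix i assume i: "i \<in> J" "i \<in> C" "i \<notin> {..<a}"
          show "folded_root J i \<noteq> \<alpha> p"
          proof
            assume "folded_root J i = \<alpha> p"
            then have "i \<in> walls J p" using i J by (auto simp: walls_def)
            then obtain t where t: "t < wall_num J p" "i = wall_list J p ! t" using wallsE[OF J] by blast
            then have "t \<le> k" using idx C(3) i by auto
            moreover have "\<not> t < k" using i(3) t wall_list_less_iff[OF t(1) k] by auto
            ultimately have "t = k" by simp
            then show False using sk t i by (simp add: fold_at_def)
          qed
        qed simp
        have "{..<a} \<subseteq> {..<j}" "{..<j} \<subseteq> {..j}" "{..<a} \<subseteq> {..j}"
          using mid by (auto intro: less_imp_le)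
        then show ?thesis using *[of "{..<j}"] *[of "{..j}"] by simp
      next
        assume ns: "\<not> sign_at J p (Suc k)"
        \<comment> \<open>Once positive, the state would remain so up to the next cut, since no wall
          lies in between.\<close>
        have *: "\<not> wall_state J C p" if C: "lower C" "{..<j} \<subseteq> C" "C \<subseteq> {..j}" for C
        proof
          assume st: "wall_state J C p"
          have sub: "C \<subseteq> cut J p (Suc k)"
            using C(3) before by (auto simp: cut_def)
          have "wall_state J (cut J p (Suc k)) p"
          proof (rule wall_state_persist[OF adm p C(1) _ sub st])
            fix i assume i: "i \<in> J" "i \<in> cut J p (Suc k)" "i \<notin> C"
            show "folded_root J i \<noteq> \<alpha> p"
            proof
              assume "folded_root J i = \<alpha> p"
              then have "i \<in> walls J p" using i J by (auto simp: walls_def)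
              then obtain t where t: "t < wall_num J p" "i = wall_list J p ! t" using wallsE[OF J] by blast
              then have "t \<le> k" using i(2) wall_list_cut_iff[OF t(1), of "Suc k"] k by simp
              then have "i \<le> a" using t wall_list_less_iff[OF t(1) k] by (cases "t = k") (auto simp: less_imp_le)
              then have "i \<in> C" using mid C(2) by auto
              then show False using i(3) by simp
            qed
          qed simp
          then show False using ns by (simp add: sign_at_def)
        qed
        have "{..<j} \<subseteq> {..j}" by auto
        then show ?thesis using *[of "{..<j}"] *[of "{..j}"] by simp
      qed
      then have "\<alpha> p \<in> ?u ` pos_roots \<longleftrightarrow> \<alpha> p \<in> (?u \<circ> reflection (\<beta> j)) ` pos_roots"
        unfolding uj by (simp add: wall_state_def)
      then show ?thesis
        using simple_left_cover[OF u p beta_roots[OF jI]] cover unfolding eq by blast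
    qed
  qed
qed

end

text \<open>As for crystals, \<open>phi\<close> and \<open>eps\<close> measure how often the
  lowering and the raising operator apply, and their difference is the pairing of the
  weight.\<close>

definition phi :: "nat \<Rightarrow> 'i set \<Rightarrow> int" where
  "phi p J = step_max (wall_num J p) (sign_at J p) (fold_at J p)"

definition eps :: "nat \<Rightarrow> 'i set \<Rightarrow> int" where
  "eps p J = phi p J - step_level (sign_at J p) (fold_at J p) (wall_num J p)"

definition raise_pos :: "nat \<Rightarrow> 'i set \<Rightarrow> nat" where
  "raise_pos p J = last_max (wall_num J p) (sign_at J p) (fold_at J p)"

definition lower_pos :: "nat \<Rightarrow> 'i set \<Rightarrow> nat" where
  "lower_pos p J = first_max (wall_num J p) (sign_at J p) (fold_at J p) - 1"

definition raise_op :: "nat \<Rightarrow> 'i set \<Rightarrow> 'i set" where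
  "raise_op p J = flip_walls J p (raise_pos p J)"

definition lower_op :: "nat \<Rightarrow> 'i set \<Rightarrow> 'i set" where
  "lower_op p J = flip_walls J p (lower_pos p J)"

lemma weight_phi_eps:
  assumes "finite J" "J \<subseteq> I" "p \<in> {1..r}"
  shows "form (affine_fold lam J) (coroot (\<alpha> p)) = real_of_int (phi p J - eps p J)"
  using weight_pairing[OF assms] wall_level_cut[OF assms, of "wall_num J p"] by (simp add: cut_def eps_def)

lemma phi_nonneg: "admissible I \<beta> J \<Longrightarrow> p \<in> {1..r} \<Longrightarrow> phi p J \<ge> 0"
  unfolding phi_def by (rule step_max_nonneg[OF admissible_step_word])

lemma eps_nonneg: "eps p J \<ge> 0"
  using step_max_ge[of "wall_num J p" "wall_num J p" "sign_at J p" "fold_at J p"] by (simp add: eps_def phi_def)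

lemma raise_op:
  assumes adm: "admissible I \<beta> J" and p: "p \<in> {1..r}" and eps: "eps p J > 0"
  shows "raise_pos p J < wall_num J p" "admissible I \<beta> (raise_op p J)"
    "phi p (raise_op p J) = phi p J + 1" "eps p (raise_op p J) = eps p J - 1"
    "lower_op p (raise_op p J) = J" "affine_fold lam (raise_op p J) = affine_fold lam J + \<alpha> p"
proof -
  have J: "finite J" "J \<subseteq> I" using adm by (auto simp: admissible_iff)
  let ?n = "wall_num J p" and ?k = "raise_pos p J" and ?s = "sign_at J p" and ?f = "fold_at J p"
  have word: "step_word ?n ?s ?f" by (rule admissible_step_word[OF adm p])
  have pos: "step_level ?s ?f ?n < step_max ?n ?s ?f" using eps by (simp add: eps_def phi_def)
  note k = last_max_step[OF word pos, folded raise_pos_def]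
  note up = raise_step[OF word pos, folded raise_pos_def]
  show kn: "?k < ?n" by (rule k(1))
  note flip = flip_walls_steps[OF J p kn] and list = flip_walls_list[OF J p kn]
  show "admissible I \<beta> (raise_op p J)"
    unfolding raise_op_def using flip_walls_admissible[OF J p kn adm up(1)] k(4) by blast
  show phi: "phi p (raise_op p J) = phi p J + 1"
    unfolding phi_def raise_op_def list flip(2) by (rule up(3))
  show "eps p (raise_op p J) = eps p J - 1"
    unfolding eps_def phi using flip(1)[of ?n] up(2)[of ?n] kn by (simp add: raise_op_def list)
  have "lower_pos p (raise_op p J) = ?k"
    unfolding lower_pos_def raise_op_def list flip(4) up(4) by simp
  then show "lower_op p (raise_op p J) = J"
    unfolding lower_op_def using flip_walls_involutive[OF J p kn] by (simp add: raise_op_def)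
  have "step_level ?s ?f ?k = step_max ?n ?s ?f" using last_max(2) by (simp add: raise_pos_def)
  \<comment> \<open>At the last wall the partner is the end of the word, one level below the
    maximum, so the single reflection also moves the weight by \<open>\<alpha> p\<close>.\<close>
  moreover have "step_level ?s ?f ?n = step_level ?s ?f (Suc ?k)" if "\<not> Suc ?k < ?n"
    using that kn by (metis Suc_lessI)
  ultimately show "affine_fold lam (raise_op p J) = affine_fold lam J + \<alpha> p"
    unfolding raise_op_def flip_walls_weight[OF J p kn] using up(2)[of "Suc ?k"] k(5) kn by simp
qed

lemma lower_op:
  assumes adm: "admissible I \<beta> J" and p: "p \<in> {1..r}" and phi: "phi p J > 0"
  shows "lower_pos p J < wall_num J p" "admissible I \<beta> (lower_op p J)"
    "phi p (lower_op p J) = phi p J - 1" "eps p (lower_op p J) = eps p J + 1"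
    "raise_op p (lower_op p J) = J" "affine_fold lam (lower_op p J) = affine_fold lam J - \<alpha> p"
proof -
  have J: "finite J" "J \<subseteq> I" using adm by (auto simp: admissible_iff)
  let ?n = "wall_num J p" and ?k = "lower_pos p J" and ?s = "sign_at J p" and ?f = "fold_at J p"
  have word: "step_word ?n ?s ?f" by (rule admissible_step_word[OF adm p])
  have pos: "step_max ?n ?s ?f > 0" using phi by (simp add: phi_def)
  note k = first_max_step[OF word pos, folded lower_pos_def]
  note down = lower_step[OF word pos, folded lower_pos_def]
  show kn: "?k < ?n" by (rule k(2))
  note flip = flip_walls_steps[OF J p kn] and list = flip_walls_list[OF J p kn]
  show "admissible I \<beta> (lower_op p J)"
    unfolding lower_op_def using flip_walls_admissible[OF J p kn adm down(1)] k(3,4) by blast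
  show phi': "phi p (lower_op p J) = phi p J - 1"
    unfolding phi_def lower_op_def list flip(2) by (rule down(3))
  show "eps p (lower_op p J) = eps p J + 1"
    unfolding eps_def phi' using flip(1)[of ?n] down(2)[of ?n] kn by (simp add: lower_op_def list)
  have "raise_pos p (lower_op p J) = ?k"
    unfolding raise_pos_def lower_op_def list flip(3) by (rule down(4))
  then show "raise_op p (lower_op p J) = J"
    unfolding raise_op_def using flip_walls_involutive[OF J p kn] by (simp add: lower_op_def)
  have top: "step_level ?s ?f (Suc ?k) = step_max ?n ?s ?f" using first_max(2)[where n = ?n] k(1) by metis
  moreover have "step_level ?s ?f ?n = step_level ?s ?f (Suc ?k)" if "\<not> Suc ?k < ?n"
    using that kn by (metis Suc_lessI)
  ultimately show "affine_fold lam (lower_op p J) = affine_fold lam J - \<alpha> p"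
    unfolding lower_op_def flip_walls_weight[OF J p kn] using down(2)[of "Suc ?k"] k(6) kn by simp
qed

end

subsection \<open>The sign-reversing involution\<close>

text \<open>Reflects every string of the operators \<open>e\<close> and \<open>f\<close>, after removing the \<open>N\<close> last elements.\<close>

lemma string_involution:
  fixes eps phi :: "'a \<Rightarrow> int" and wt :: "'a \<Rightarrow> 'v::real_vector" and N :: int
  assumes nonneg: "\<And>x. x \<in> B \<Longrightarrow> N \<le> eps x" "\<And>x. x \<in> B \<Longrightarrow> 0 \<le> phi x"
    and raise: "\<And>x. x \<in> B \<Longrightarrow> N < eps x \<Longrightarrow>
      e x \<in> B \<and> eps (e x) = eps x - 1 \<and> phi (e x) = phi x + 1 \<and> f (e x) = x \<and> wt (e x) = wt x + a"
    and lower: "\<And>x. x \<in> B \<Longrightarrow> 0 < phi x \<Longrightarrow>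
      f x \<in> B \<and> eps (f x) = eps x + 1 \<and> phi (f x) = phi x - 1 \<and> e (f x) = x \<and> wt (f x) = wt x - a"
  shows "\<exists>T. \<forall>x\<in>B. T x \<in> B \<and> T (T x) = x \<and> wt (T x) = wt x + real_of_int (eps x - phi x - N) *\<^sub>R a"
proof -
  have up: "(e ^^ c) x \<in> B \<and> eps ((e ^^ c) x) = eps x - int c \<and> phi ((e ^^ c) x) = phi x + int c \<and>
      (f ^^ c) ((e ^^ c) x) = x \<and> wt ((e ^^ c) x) = wt x + real c *\<^sub>R a"
    if "x \<in> B" "int c \<le> eps x - N" for x c
    using that(2)
  proof (induction c)
    case (Suc c)
    then show ?case
      using raise[of "(e ^^ c) x"] funpow_swap1[of f c] by (simp add: scaleR_add_left)
  qed (simp add: that)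
  have down: "(f ^^ c) x \<in> B \<and> eps ((f ^^ c) x) = eps x + int c \<and> phi ((f ^^ c) x) = phi x - int c \<and>
      (e ^^ c) ((f ^^ c) x) = x \<and> wt ((f ^^ c) x) = wt x - real c *\<^sub>R a"
    if "x \<in> B" "int c \<le> phi x" for x c
    using that(2)
  proof (induction c)
    case (Suc c)
    then show ?case
      using lower[of "(f ^^ c) x"] funpow_swap1[of e c] by (simp add: scaleR_add_left)
  qed (simp add: that)
  \<comment> \<open>The signed distance to the mirror image in the truncated string. After these
    steps \<open>phi\<close> and \<open>eps - N\<close> have changed places, so \<open>C\<close>
    changes sign and \<open>T\<close> undoes itself.\<close>
  define C where "C x = eps x - phi x - N" for x
  define T where "T x = (if C x \<ge> 0 then (e ^^ nat (C x)) x else (f ^^ nat (- C x)) x)" for x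
  have "T x \<in> B \<and> T (T x) = x \<and> wt (T x) = wt x + real_of_int (C x) *\<^sub>R a" if x: "x \<in> B" for x
  proof (cases "C x \<ge> 0")
    case True
    then have T: "T x = (e ^^ nat (C x)) x" and le: "int (nat (C x)) \<le> eps x - N"
      using nonneg(2)[OF x] by (simp_all add: T_def C_def)
    note u = up[OF x le]
    have "C (T x) = - C x" using u True unfolding C_def[of "T x"] T by (simp add: C_def)
    then have "T (T x) = (f ^^ nat (C x)) (T x)"
      using True by (cases "C x = 0") (simp_all add: T_def[of "T x"])
    then show ?thesis using u True by (simp add: T)
  next
    case False
    then have T: "T x = (f ^^ nat (- C x)) x" and le: "int (nat (- C x)) \<le> phi x"
      using nonneg(1)[OF x] by (simp_all add: T_def C_def)
    note d = down[OF x le]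
    have "C (T x) = - C x" using d False unfolding C_def[of "T x"] T by (simp add: C_def)
    then have "T (T x) = (e ^^ nat (- C x)) (T x)"
      using False by (simp add: T_def[of "T x"])
    then show ?thesis using d False by (simp add: T)
  qed
  then show ?thesis unfolding C_def by blast
qed

lemma sum_involution_zero:
  fixes g :: "'a \<Rightarrow> int"
  assumes "\<And>x. x \<in> A \<Longrightarrow> t x \<in> A \<and> t (t x) = x \<and> g (t x) = - g x"
  shows "sum g A = 0"
proof -
  have "sum g A = (\<Sum>x\<in>A. g (t x))"
    using assms by (intro sum.reindex_bij_witness[of _ t t]) auto
  also have "\<dots> = - sum g A" using assms by (simp add: sum_negf)
  finally show ?thesis by simp
qed

text \<open>A negative state has a predecessor of higher level. Read contrapositively, a negative
  end forces \<open>eps\<close> to be nonzero.\<close>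

lemma step_word_last_sign:
  assumes "step_word n s f" "step_level s f n = step_max n s f" shows "s n"
proof (cases n)
  case 0
  then show ?thesis using assms by (simp add: step_word_def)
next
  case (Suc i)
  have "step_level s f i \<le> step_level s f n" using step_max_ge[of i n s f] assms(2) Suc by simp
  then show ?thesis
    using assms(1) Suc by (auto simp: step_word_def step_level_def step_height_Suc split: if_splits)
qed

section \<open>Weights of admissible subsets: local finiteness and Weyl group invariance\<close>

context root_chain
begin

abbreviation admissibles :: "'i set set" where
  "admissibles \<equiv> {J. admissible I \<beta> J}"

lemma admissible_empty: "admissible I \<beta> {}"
  by (simp add: admissible_iff)

lemma affine_fold_weights:
  "finite J \<Longrightarrow> J \<subseteq> I \<Longrightarrow> v \<in> weights \<Longrightarrow> affine_fold v J \<in> weights"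
proof (induction J arbitrary: v rule: finite_linorder_max_induct)
  case (insert k A)
  have k: "\<beta> k \<in> roots" using beta_roots insert.prems by simp
  have "reflection (\<beta> k) v \<in> weights"
    using weyl_group_weights[OF reflection_in_weyl_group[OF k]] insert.prems by simp
  moreover have "\<beta> k \<in> weights"
    using root_pairing_int[OF k] simple_roots by (auto simp: weights_def)
  ultimately have "reflection_hat I \<beta> k v \<in> weights"
    unfolding reflection_hat_eq by (auto simp: weights_def intro!: Ints_add Ints_mult)
  then show ?case using insert by (subst affine_fold_insert_max) auto
qed simp

lemma admissible_weight: "admissible I \<beta> J \<Longrightarrow> affine_fold lam J \<in> weights"
  using affine_fold_weights dominant_weights[OF dominant_lam] by (auto simp: admissible_iff)

text \<open>The largest folding acts first on \<open>lam\<close> and subtracts \<open>c\<close>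
  copies of \<open>\<beta> k\<close>, where \<open>c\<close> counts the indices from
  \<open>k\<close> on with this root. As \<open>k\<close> is one of them,
  \<open>c \<ge> 1\<close>.\<close>

lemma admissible_remove_max:
  assumes "admissible I \<beta> (insert k K)" "\<And>j. j \<in> K \<Longrightarrow> j < k"
  shows "admissible I \<beta> K" "folded_root K k \<in> pos_roots"
    "ht (affine_fold lam (insert k K)) \<le> ht (affine_fold lam K) - ht (folded_root K k)"
proof -
  have K: "finite K" "K \<subseteq> I" "k \<in> I" using assms by (auto simp: admissible_iff)
  have init: "insert k K \<inter> {..<j} = K \<inter> {..<j}" if "j \<in> insert k K" for j
    using that assms(2) by (auto dest: order.asym)
  then show "admissible I \<beta> K" using assms(1) by (auto simp: admissible_iff)
  have "folded_root (insert k K) k = folded_root K k" by (rule folded_root_cong) (use init in auto)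
  then show pos: "folded_root K k \<in> pos_roots"
    using admissible_folded_root_pos[OF assms(1), of k] by simp
  have "K \<inter> {..<k} = K" using assms(2) by auto
  then have root: "folded_root K k = fold_product K (\<beta> k)" by (simp add: folded_root_def)
  define c where "c = root_count UNIV (\<beta> k) - root_count {..<k} (\<beta> k)"
  have "k \<in> {j \<in> I \<inter> (UNIV - {..<k}). \<beta> j = \<beta> k}" using K by simp
  moreover have "finite {j \<in> I \<inter> (UNIV - {..<k}). \<beta> j = \<beta> k}"
    by (rule finite_subset[OF _ finite_root_fibre[of "\<beta> k"]]) auto
  ultimately have "0 < card {j \<in> I \<inter> (UNIV - {..<k}). \<beta> j = \<beta> k}" using card_gt_0_iff by blast
  then have "root_count (UNIV - {..<k}) (\<beta> k) \<ge> 1" unfolding root_count_def by linarith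
  then have c: "c \<ge> 1" using root_count_split[of "{..<k}" UNIV "\<beta> k"] by (simp add: c_def)
  note w = fold_product_weyl[OF K(1,2)]
  have "affine_fold lam (insert k K) = affine_fold (reflection_hat I \<beta> k lam) K"
    using assms(2) K by (subst affine_fold_insert_max) auto
  also have "reflection_hat I \<beta> k lam = lam - real_of_int c *\<^sub>R \<beta> k"
    using root_count_UNIV[OF beta_pos[OF K(3)]]
    by (simp add: reflection_hat_eq reflection_def c_def scaleR_diff_left)
  also have "affine_fold (lam - real_of_int c *\<^sub>R \<beta> k) K = affine_fold lam K - real_of_int c *\<^sub>R folded_root K k"
    using affine_fold_linear_part[OF K(1,2), of lam] affine_fold_linear_part[OF K(1,2), of "lam - real_of_int c *\<^sub>R \<beta> k"]
    by (simp add: root weyl_group_diff[OF w] weyl_group_scale[OF w])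
  finally have "ht (affine_fold lam (insert k K)) = ht (affine_fold lam K) - real_of_int c * ht (folded_root K k)"
    by (simp add: ht_simps)
  moreover have "1 * ht (folded_root K k) \<le> real_of_int c * ht (folded_root K k)"
    using c pos_root_ht[OF pos] by (intro mult_right_mono) auto
  ultimately show "ht (affine_fold lam (insert k K)) \<le> ht (affine_fold lam K) - ht (folded_root K k)" by simp
qed

lemma admissible_ht: "admissible I \<beta> J \<Longrightarrow> ht (affine_fold lam J) \<le> ht lam - card J"
proof -
  assume "admissible I \<beta> J"
  then have "finite J" by (rule admissible_finite)
  then show ?thesis using \<open>admissible I \<beta> J\<close>
  proof (induction J rule: finite_linorder_max_induct)
    case (insert k A)
    have "j < k" if "j \<in> A" for j using insert.hyps(2) that by blast
    note rm = admissible_remove_max[OF insert.prems this]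
    have "k \<notin> A" using insert.hyps(2) by auto
    then show ?case using insert.IH[OF rm(1)] rm(3) pos_root_ht[OF rm(2)] insert.hyps(1) by simp
  qed simp
qed

text \<open>Subsets are built by adding largest elements. Each addition costs the height of its
  folded root, so a bound on the height limits both the number of additions and the choices for
  each.\<close>

lemma finite_admissible_ht: "finite {J \<in> admissibles. ht (affine_fold lam J) \<ge> h}"
proof -
  let ?A = "\<lambda>n. {J \<in> admissibles. card J = n \<and> ht (affine_fold lam J) \<ge> h}"
  have fin: "finite (?A n)" for n
  proof (induction n)
    case 0
    have "?A 0 \<subseteq> {{}}" by (auto simp: admissible_iff)
    then show ?case by (rule finite_subset) simp
  next
    case (Suc n)
    let ?R = "{a \<in> pos_roots. ht a \<le> ht lam - h}"
    let ?K = "\<lambda>K. {k \<in> I. folded_root K k \<in> ?R}"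
    have "?A (Suc n) \<subseteq> (\<lambda>(K, k). insert k K) ` (SIGMA K : ?A n. ?K K)"
    proof
      fix J assume J: "J \<in> ?A (Suc n)"
      then have fJ: "finite J" "J \<noteq> {}" "J \<subseteq> I" by (auto simp: admissible_iff)
      define k K where "k = Max J" and "K = J - {k}"
      have JK: "J = insert k K" "k \<notin> K" using Max_in[OF fJ(1,2)] by (auto simp: k_def K_def)
      have less: "j < k" if "j \<in> K" for j
      proof -
        have "j \<in> J" "j \<noteq> k" using that by (auto simp: K_def)
        then show ?thesis using Max_ge[OF fJ(1), of j] by (simp add: k_def)
      qed
      have "admissible I \<beta> (insert k K)" using J JK by simp
      note rm = admissible_remove_max[OF this less]
      have "finite K" using fJ by (simp add: K_def)
      then have cK: "card K = n" using J JK by simp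
      have "ht (affine_fold lam K) \<le> ht lam" using admissible_ht[OF rm(1)] by simp
      moreover have "h \<le> ht (affine_fold lam (insert k K))" using J JK by simp
      ultimately have "K \<in> ?A n" "k \<in> ?K K"
        using rm cK pos_root_ht[OF rm(2)] fJ JK by auto
      then show "J \<in> (\<lambda>(K, k). insert k K) ` (SIGMA K : ?A n. ?K K)"
        using JK by (intro image_eqI[of _ _ "(K, k)"]) auto
    qed
    moreover have "finite (SIGMA K : ?A n. ?K K)"
    proof (rule finite_SigmaI[OF Suc])
      fix K assume "K \<in> ?A n"
      then have K: "finite K" "K \<subseteq> I" by (auto simp: admissible_iff)
      have "?K K = (\<Union>a\<in>?R. {k \<in> I. folded_root K k = a})" by auto
      then show "finite (?K K)"
        using finite_pos_roots_ht[of "ht lam - h"] finite_folded_root_fibre[OF K] by simp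
    qed
    ultimately show ?case by (meson finite_imageI finite_subset)
  qed
  have "{J \<in> admissibles. ht (affine_fold lam J) \<ge> h} \<subseteq> (\<Union>n\<le>nat \<lceil>ht lam - h\<rceil>. ?A n)"
  proof
    fix J assume J: "J \<in> {J \<in> admissibles. ht (affine_fold lam J) \<ge> h}"
    then have "real (card J) \<le> ht lam - h" using admissible_ht[of J] by auto
    then have "card J \<le> nat \<lceil>ht lam - h\<rceil>" using real_nat_ceiling_ge[of "ht lam - h"] by linarith
    then show "J \<in> (\<Union>n\<le>nat \<lceil>ht lam - h\<rceil>. ?A n)" using J by auto
  qed
  then show ?thesis by (rule finite_subset) (use fin in auto)
qed

text \<open>With \<open>N = 0\<close> whole strings are reversed.\<close>

lemma admissible_reflection:
  assumes p: "p \<in> {1..r}"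
  shows "\<exists>T. bij_betw T admissibles admissibles \<and>
    (\<forall>J\<in>admissibles. affine_fold lam (T J) = reflection (\<alpha> p) (affine_fold lam J))"
proof -
  have "\<exists>T. \<forall>J\<in>admissibles. T J \<in> admissibles \<and> T (T J) = J \<and>
      affine_fold lam (T J) = affine_fold lam J + real_of_int (eps p J - phi p J - 0) *\<^sub>R \<alpha> p"
    by (rule string_involution[where e = "raise_op p" and f = "lower_op p"])
      (use eps_nonneg phi_nonneg p raise_op lower_op in auto)
  then obtain T where T: "\<And>J. admissible I \<beta> J \<Longrightarrow> admissible I \<beta> (T J) \<and> T (T J) = J \<and>
      affine_fold lam (T J) = affine_fold lam J + real_of_int (eps p J - phi p J) *\<^sub>R \<alpha> p"
    by auto
  show ?thesis
  proof (intro exI[of _ T] conjI ballI)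
    show "bij_betw T admissibles admissibles"
      by (rule bij_betw_byWitness[where f' = T]) (use T in auto)
    fix J assume "J \<in> admissibles"
    then have J: "admissible I \<beta> J" by simp
    have "form (affine_fold lam J) (coroot (\<alpha> p)) = real_of_int (phi p J - eps p J)"
      using weight_phi_eps[OF admissible_finite[OF J] admissible_subset[OF J] p] .
    then show "affine_fold lam (T J) = reflection (\<alpha> p) (affine_fold lam J)"
      using T[OF J] by (simp add: reflection_def scaleR_diff_left)
  qed
qed

lemma admissible_weyl_group:
  assumes "w \<in> weyl_group"
  shows "\<exists>T. bij_betw T admissibles admissibles \<and> (\<forall>J\<in>admissibles. affine_fold lam (T J) = w (affine_fold lam J))"
  using assms
proof (induction rule: weyl_group_induct)
  case id
  show ?case by (rule exI[of _ id], rule conjI, rule bij_betw_id, simp)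
next
  case (step p w)
  obtain T where T: "bij_betw T admissibles admissibles" "\<forall>J\<in>admissibles. affine_fold lam (T J) = w (affine_fold lam J)"
    using step.IH by blast
  obtain S where S: "bij_betw S admissibles admissibles"
    "\<forall>J\<in>admissibles. affine_fold lam (S J) = reflection (\<alpha> p) (affine_fold lam J)"
    using admissible_reflection[OF step(1)] by blast
  have "T J \<in> admissibles" if "J \<in> admissibles" for J using T(1) that by (rule bij_betwE[rule_format])
  then show ?case
    using T(2) S(2) by (intro exI[of _ "S \<circ> T"] conjI bij_betw_trans[OF T(1) S(1)]) auto
qed

text \<open>The right partner of the raised wall is one level below the maximum; if it were the end
  at infinity, \<open>eps\<close> would be 1.\<close>

lemma raise_flip_bound:
  assumes adm: "admissible I \<beta> J" and p: "p \<in> {1..r}" and eps: "eps p J > 1"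
  shows "Suc (raise_pos p J) < wall_num J p"
    "wall_level J {..<wall_list J p ! Suc (raise_pos p J)} p - wall_level J UNIV p = eps p J - 1"
proof -
  have J: "finite J" "J \<subseteq> I" using adm by (auto simp: admissible_iff)
  let ?n = "wall_num J p" and ?k = "raise_pos p J" and ?s = "sign_at J p" and ?f = "fold_at J p"
  have word: "step_word ?n ?s ?f" by (rule admissible_step_word[OF adm p])
  have pos: "step_level ?s ?f ?n < step_max ?n ?s ?f" using eps by (simp add: eps_def phi_def)
  note k = last_max_step[OF word pos, folded raise_pos_def]
  show less: "Suc ?k < ?n"
  proof (rule ccontr)
    assume "\<not> ?thesis"
    then have "?n = Suc ?k" using k(1) by simp
    then show False using k(5) eps by (simp add: eps_def phi_def)
  qed
  show "wall_level J {..<wall_list J p ! Suc ?k} p - wall_level J UNIV p = eps p J - 1"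
    using wall_level_cut[OF J p, of "Suc ?k"] wall_level_cut[OF J p, of ?n] less k(5)
    by (simp add: cut_def eps_def phi_def)
qed

text \<open>Measured from infinity, the level at \<open>j\<close> depends only on the folded chain
  from \<open>j\<close> on and on the final product.\<close>

lemma wall_level_tail:
  assumes J: "finite J" "J \<subseteq> I" and J': "finite J'" "J' \<subseteq> I" and q: "q \<in> {1..r}"
    and same: "\<And>i. i \<ge> j \<Longrightarrow> folded_root J' i = folded_root J i \<and> (i \<in> J' \<longleftrightarrow> i \<in> J)"
    and "fold_product J' = fold_product J" and wall: "j \<in> walls J q"
  shows "wall_level J' {..<j} q - wall_level J' UNIV q = wall_level J {..<j} q - wall_level J UNIV q"
proof -
  have split: "net_count K UNIV a = net_count K {..<j} a + net_count K (UNIV - {..<j}) a"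
    if "finite K" "K \<subseteq> I" for K a
    using fold_count_split[OF that, of "{..<j}" UNIV] by (simp add: net_count_def)
  have "{i \<in> I \<inter> (UNIV - {..<j}) - J'. folded_root J' i = a} = {i \<in> I \<inter> (UNIV - {..<j}) - J. folded_root J i = a}" for a
    using same by auto
  then have "net_count J' (UNIV - {..<j}) (\<alpha> q) = net_count J (UNIV - {..<j}) (\<alpha> q)"
    by (simp add: net_count_def fold_count_def)
  moreover have "j \<in> walls J' q" using wall same[of j] by (simp add: walls_def)
  then have "wall_state J' {..<j} q \<longleftrightarrow> wall_state J {..<j} q"
    using wall_state_iff[OF J q wall] wall_state_iff[OF J' q] same[of j] by simp
  moreover have "wall_state J' UNIV q \<longleftrightarrow> wall_state J UNIV q"
    using assms(7) by (simp add: wall_state_def)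
  ultimately show ?thesis
    using split[OF J, of "\<alpha> q"] split[OF J', of "\<alpha> q"] by (simp add: wall_level_def)
qed

end

section \<open>Violations and their cancellation\<close>

locale tensor_chain = root_chain form r \<alpha> \<rho> ht lam I \<beta>
  for form :: "'v::real_vector \<Rightarrow> 'v \<Rightarrow> real" and r :: nat and \<alpha> :: "nat \<Rightarrow> 'v" and \<rho> :: 'v
    and ht :: "'v \<Rightarrow> real" and lam :: 'v and I :: "'i::linorder set" and \<beta> :: "'i \<Rightarrow> 'v" +
  fixes \<nu> :: 'v
  assumes dominant_nu: "dominant \<nu>"
begin

definition nu_pairing :: "nat \<Rightarrow> int" where
  "nu_pairing p = \<lfloor>form \<nu> (coroot (\<alpha> p))\<rfloor>"

lemma nu_pairing:
  assumes "p \<in> {1..r}" shows "form \<nu> (coroot (\<alpha> p)) = real_of_int (nu_pairing p)" "nu_pairing p \<ge> 0"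
  using assms dominant_nu simple_pos_roots[OF assms]
  by (auto simp: nu_pairing_def dominant_def weights_def)

text \<open>The inequality is stated for the level relative to infinity, the form that ignores
  changes further left.\<close>

definition violation :: "'i set \<Rightarrow> 'i \<Rightarrow> bool" where
  "violation J i \<longleftrightarrow> (\<exists>p\<in>{1..r}. i \<in> walls J p \<and> wall_level J {..<i} p - wall_level J UNIV p > nu_pairing p)"

lemma walls_unique:
  assumes "p \<in> {1..r}" "q \<in> {1..r}" "i \<in> walls J p" "i \<in> walls J q" shows "p = q"
proof -
  have "\<alpha> p = \<alpha> q"
    using assms simple_neq_uminus[of p q] simple_neq_uminus[of q p] by (auto simp: walls_def)
  then show ?thesis using simple_roots_independent(1) assms(1,2) by (auto dest: inj_onD)
qed

text \<open>If \<open>eps\<close> is positive, the maximum is attained at an actual wall; otherwise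
  dominance of \<nu> gives the bound.\<close>

lemma eps_le_iff:
  assumes adm: "admissible I \<beta> J" and p: "p \<in> {1..r}"
  shows "eps p J \<le> nu_pairing p \<longleftrightarrow> (\<forall>i\<in>walls J p. wall_level J {..<i} p - wall_level J UNIV p \<le> nu_pairing p)"
proof -
  have J: "finite J" "J \<subseteq> I" using adm by (auto simp: admissible_iff)
  let ?n = "wall_num J p" and ?s = "sign_at J p" and ?f = "fold_at J p"
  have UNIV: "wall_level J UNIV p = phi p J - eps p J"
    using wall_level_cut[OF J p, of ?n] by (simp add: cut_def eps_def)
  have at: "wall_level J {..<wall_list J p ! k} p = step_level ?s ?f k" if "k < ?n" for k
    using wall_level_cut[OF J p, of k] that by (simp add: cut_def)
  show ?thesis
  proof
    assume le: "eps p J \<le> nu_pairing p"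
    show "\<forall>i\<in>walls J p. wall_level J {..<i} p - wall_level J UNIV p \<le> nu_pairing p"
    proof
      fix i assume "i \<in> walls J p"
      then obtain k where "k < ?n" "i = wall_list J p ! k" using wallsE[OF J] by blast
      then show "wall_level J {..<i} p - wall_level J UNIV p \<le> nu_pairing p"
        using at step_max_ge[of k ?n ?s ?f] le UNIV by (simp add: phi_def)
    qed
  next
    assume all: "\<forall>i\<in>walls J p. wall_level J {..<i} p - wall_level J UNIV p \<le> nu_pairing p"
    show "eps p J \<le> nu_pairing p"
    proof (cases "eps p J > 0")
      case True
      note k = raise_op(1)[OF adm p True]
      have "step_level ?s ?f (raise_pos p J) = phi p J"
        using last_max(2) by (simp add: raise_pos_def phi_def)
      then show ?thesis using all wall_list_nth[OF J k] at[OF k] UNIV by fastforce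
    next
      case False
      then show ?thesis using nu_pairing[OF p] by simp
    qed
  qed
qed

lemma no_violation_iff:
  "admissible I \<beta> J \<Longrightarrow> (\<forall>i. \<not> violation J i) \<longleftrightarrow> (\<forall>p\<in>{1..r}. eps p J \<le> nu_pairing p)"
  using eps_le_iff by (fastforce simp: violation_def not_less)

text \<open>The pairing of the weight, one of the members of the maximum, never exceeds the bound
  because \<nu> is dominant; only the walls remain.\<close>

lemma max_level_iff:
  assumes adm: "admissible I \<beta> J"
  shows "(\<forall>p\<in>{1..r}. form (\<nu> + affine_fold lam J) (coroot (\<alpha> p)) \<ge> max_level lam I \<beta> J p) \<longleftrightarrow>
    (\<forall>i. \<not> violation J i)"
proof -
  have J: "finite J" "J \<subseteq> I" using adm by (auto simp: admissible_iff)
  have "form (\<nu> + affine_fold lam J) (coroot (\<alpha> p)) \<ge> max_level lam I \<beta> J p \<longleftrightarrow>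
      (\<forall>i\<in>walls J p. wall_level J {..<i} p - wall_level J UNIV p \<le> nu_pairing p)" if p: "p \<in> {1..r}" for p
  proof -
    have "simple_indices I (folding \<beta> J) p = walls J p"
      by (simp add: simple_indices_def walls_def folding_fst[OF J(1)])
    then have "form (\<nu> + affine_fold lam J) (coroot (\<alpha> p)) \<ge> max_level lam I \<beta> J p \<longleftrightarrow>
      (\<forall>i\<in>walls J p. real_of_int (level I (folding \<beta> J) i) \<le> form (\<nu> + affine_fold lam J) (coroot (\<alpha> p)))"
      using finite_walls[OF J] nu_pairing[OF p] by (simp add: max_level_def Max_le_iff)
    also have "\<dots> \<longleftrightarrow> (\<forall>i\<in>walls J p. wall_level J {..<i} p - wall_level J UNIV p \<le> nu_pairing p)"
      using level_folding[OF J p] weight_pairing[OF J p] nu_pairing(1)[OF p]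
      by (intro ball_cong refl) (simp, linarith)
    finally show ?thesis .
  qed
  then show ?thesis by (fastforce simp: violation_def not_less)
qed

text \<open>Fixing the position together with its simple root gives classes on each of which a
  single pair of operators acts.\<close>

definition last_violation :: "nat \<Rightarrow> 'i \<Rightarrow> 'i set set" where
  "last_violation p i = {J. admissible I \<beta> J \<and> i \<in> walls J p \<and> violation J i \<and> (\<forall>j>i. \<not> violation J j)}"

text \<open>Everything to the right of the last violation is kept by a flip to its left.\<close>

lemma flip_last_violation:
  assumes p: "p \<in> {1..r}" and J: "J \<in> last_violation p i" and k: "Suc k < wall_num J p"
    and i: "wall_list J p ! Suc k \<le> i" and adm': "admissible I \<beta> (flip_walls J p k)"
    and shift: "\<And>j. k < j \<Longrightarrow> j \<le> wall_num J p \<Longrightarrow>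
      step_level (flip_state k (sign_at J p)) (flip_fold k (fold_at J p)) j = step_level (sign_at J p) (fold_at J p) j + d"
  shows "flip_walls J p k \<in> last_violation p i"
proof -
  let ?J = "flip_walls J p k" and ?n = "wall_num J p" and ?b = "wall_list J p ! Suc k"
  have adm: "admissible I \<beta> J" and wall: "i \<in> walls J p" and viol: "violation J i" "\<forall>j>i. \<not> violation J j"
    using J by (auto simp: last_violation_def)
  have fin: "finite J" "J \<subseteq> I" using adm by (auto simp: admissible_iff)
  have k': "k < ?n" using k by simp
  note flip = flip_walls_subset[OF fin p k']
  have ab: "wall_list J p ! k < ?b" using wall_list_less_iff[OF k' k] by simp
  have same: "folded_root ?J j = folded_root J j \<and> (j \<in> ?J \<longleftrightarrow> j \<in> J)" if "j > ?b" for j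
  proof -
    have "fold_product (?J \<inter> {..<j}) = fold_product (J \<inter> {..<j})"
      using fold_product_flip[OF fin p k' lower_simps(1), of j] that k ab by simp
    then show ?thesis
      using flip_walls_mem[OF fin p k', of j] that ab by (auto simp: folded_root_def)
  qed
  have prod: "fold_product ?J = fold_product J"
    using fold_product_flip[OF fin p k' lower_simps(3)] k by simp
  have "violation ?J j \<longleftrightarrow> violation J j" if j: "j > i" for j
  proof -
    have jb: "j > ?b" using i j by simp
    have "j \<in> walls ?J q \<longleftrightarrow> j \<in> walls J q" for q using same[OF jb] by (simp add: walls_def)
    moreover have "wall_level ?J {..<j} q - wall_level ?J UNIV q = wall_level J {..<j} q - wall_level J UNIV q"
      if "q \<in> {1..r}" "j \<in> walls J q" for q
      using wall_level_tail[OF fin flip that(1) _ prod that(2)] same jb by (meson less_le_trans)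
    ultimately show ?thesis by (auto simp: violation_def)
  qed
  moreover have "violation ?J i"
  proof -
    obtain t where t: "t < ?n" "i = wall_list J p ! t" using wallsE[OF fin wall] by blast
    have "k < t" using i t wall_list_less_iff[OF t(1) k] by (metis not_less_eq leD)
    \<comment> \<open>The index \<open>i\<close> may be the right partner itself, where the chain
      does change; but its level and that at infinity shift by the same \<open>d\<close>.\<close>
    have level: "wall_level ?J (cut J p j) p = step_level (sign_at J p) (fold_at J p) j + d" if "k < j" "j \<le> ?n" for j
      using wall_level_cut[OF flip p, of j] flip_walls_steps(1)[OF fin p k' that(2)] shift[OF that] that
      by (simp add: flip_walls_list[OF fin p k'])
    have "wall_level ?J {..<i} p - wall_level ?J UNIV p = wall_level J {..<i} p - wall_level J UNIV p"
      using level[OF \<open>k < t\<close>] level[OF k'] wall_level_cut[OF fin p, of t] wall_level_cut[OF fin p, of ?n] t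
      by (simp add: cut_def)
    moreover have "wall_level J {..<i} p - wall_level J UNIV p > nu_pairing p"
      using viol(1) wall walls_unique[OF p] unfolding violation_def by blast
    ultimately show ?thesis
      using wall p flip_walls_walls[OF fin p k'] by (auto simp: violation_def)
  qed
  ultimately show ?thesis
    using viol(2) wall adm' flip_walls_walls[OF fin p k'] by (auto simp: last_violation_def)
qed

lemma last_violation_eps:
  assumes p: "p \<in> {1..r}" and J: "J \<in> last_violation p i" shows "eps p J > nu_pairing p"
proof -
  have adm: "admissible I \<beta> J" and wall: "i \<in> walls J p" and "violation J i"
    using J by (auto simp: last_violation_def)
  then have "wall_level J {..<i} p - wall_level J UNIV p > nu_pairing p"
    using walls_unique[OF p] unfolding violation_def by blast
  then show ?thesis using eps_le_iff[OF adm p] wall by (meson not_less)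
qed

lemma violation_le:
  assumes "J \<in> last_violation p i" "violation J j" shows "j \<le> i"
  using assms by (auto simp: last_violation_def not_less)

text \<open>The right partner, one below the maximum, is still a violation and therefore not to the
  right of \<open>i\<close>.\<close>

lemma raise_last_violation:
  assumes p: "p \<in> {1..r}" and J: "J \<in> last_violation p i" and eps: "nu_pairing p + 1 < eps p J"
  shows "raise_op p J \<in> last_violation p i"
proof -
  have adm: "admissible I \<beta> J" using J by (auto simp: last_violation_def)
  have fin: "finite J" "J \<subseteq> I" using adm by (auto simp: admissible_iff)
  have eps': "eps p J > 1" "eps p J > 0" using eps nu_pairing(2)[OF p] by auto
  note b = raise_flip_bound[OF adm p eps'(1)]
  have "violation J (wall_list J p ! Suc (raise_pos p J))"
    unfolding violation_def using b wall_list_nth[OF fin b(1)] p eps by (intro bexI[of _ p]) auto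
  then have "wall_list J p ! Suc (raise_pos p J) \<le> i" by (rule violation_le[OF J])
  moreover have "step_level (sign_at J p) (fold_at J p) (wall_num J p) < step_max (wall_num J p) (sign_at J p) (fold_at J p)"
    using eps' by (simp add: eps_def phi_def)
  note raise_step(2)[OF admissible_step_word[OF adm p] this, folded raise_pos_def]
  ultimately show ?thesis
    unfolding raise_op_def
    using raise_op(2)[OF adm p eps'(2)] flip_last_violation[OF p J b(1)] by (simp add: raise_op_def)
qed

text \<open>Here the right partner is the first maximum itself, which is a violation because
  \<open>eps\<close> exceeds \<open>nu_pairing p\<close>.\<close>

lemma lower_last_violation:
  assumes p: "p \<in> {1..r}" and J: "J \<in> last_violation p i" and phi: "phi p J > 0"
  shows "lower_op p J \<in> last_violation p i"
proof -
  have adm: "admissible I \<beta> J" using J by (auto simp: last_violation_def)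
  have fin: "finite J" "J \<subseteq> I" using adm by (auto simp: admissible_iff)
  let ?n = "wall_num J p" and ?k = "lower_pos p J" and ?s = "sign_at J p" and ?f = "fold_at J p"
  have pos: "step_max ?n ?s ?f > 0" using phi by (simp add: phi_def)
  note word = admissible_step_word[OF adm p]
  note k = first_max_step[OF word pos, folded lower_pos_def]
  have top: "step_level ?s ?f (Suc ?k) = phi p J" using first_max(2)[where n = ?n] k(1) by (metis phi_def)
  have eps: "eps p J > nu_pairing p" by (rule last_violation_eps[OF p J])
  have less: "Suc ?k < ?n"
  proof (rule ccontr)
    assume "\<not> ?thesis"
    then have "Suc ?k = ?n" using k(2) by simp
    then have "eps p J = 0" using top by (simp add: eps_def)
    then show False using eps nu_pairing(2)[OF p] by simp
  qed
  have "wall_level J {..<wall_list J p ! Suc ?k} p - wall_level J UNIV p = eps p J"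
    using wall_level_cut[OF fin p, of "Suc ?k"] wall_level_cut[OF fin p, of ?n] less top
    by (simp add: cut_def eps_def)
  then have "violation J (wall_list J p ! Suc ?k)"
    unfolding violation_def using wall_list_nth[OF fin less] p eps by (intro bexI[of _ p]) auto
  then have "wall_list J p ! Suc ?k \<le> i" by (rule violation_le[OF J])
  moreover have "step_level (flip_state ?k ?s) (flip_fold ?k ?f) j = step_level ?s ?f j + (- 2)" if "?k < j" "j \<le> ?n" for j
    using lower_step(2)[OF word pos, folded lower_pos_def, OF that] by simp
  ultimately show ?thesis
    unfolding lower_op_def
    using lower_op(2)[OF adm p phi] flip_last_violation[OF p J less] by (simp add: lower_op_def)
qed

text \<open>With \<open>N = nu_pairing p + 1\<close>, the quantity \<open>eps - phi - N\<close> is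
  minus the pairing of \<open>\<nu> + \<mu>(J) + \<rho>\<close>, so reversing the truncated string
  reflects this vector.\<close>

lemma last_violation_involution:
  assumes p: "p \<in> {1..r}"
  shows "\<exists>T. \<forall>J\<in>last_violation p i. T J \<in> last_violation p i \<and> T (T J) = J \<and>
    \<nu> + affine_fold lam (T J) + \<rho> = reflection (\<alpha> p) (\<nu> + affine_fold lam J + \<rho>)"
proof -
  have adm: "admissible I \<beta> J" if "J \<in> last_violation p i" for J
    using that by (simp add: last_violation_def)
  have "\<exists>T. \<forall>J\<in>last_violation p i. T J \<in> last_violation p i \<and> T (T J) = J \<and>
      affine_fold lam (T J) = affine_fold lam J + real_of_int (eps p J - phi p J - (nu_pairing p + 1)) *\<^sub>R \<alpha> p"
  proof (rule string_involution[where e = "raise_op p" and f = "lower_op p"])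
    fix J assume J: "J \<in> last_violation p i"
    show "nu_pairing p + 1 \<le> eps p J" using last_violation_eps[OF p J] by simp
    show "0 \<le> phi p J" by (rule phi_nonneg[OF adm[OF J] p])
    show "raise_op p J \<in> last_violation p i \<and> eps p (raise_op p J) = eps p J - 1 \<and>
        phi p (raise_op p J) = phi p J + 1 \<and> lower_op p (raise_op p J) = J \<and>
        affine_fold lam (raise_op p J) = affine_fold lam J + \<alpha> p" if "nu_pairing p + 1 < eps p J"
      using raise_last_violation[OF p J that] raise_op[OF adm[OF J] p] that nu_pairing(2)[OF p] by auto
    show "lower_op p J \<in> last_violation p i \<and> eps p (lower_op p J) = eps p J + 1 \<and>
        phi p (lower_op p J) = phi p J - 1 \<and> raise_op p (lower_op p J) = J \<and>
        affine_fold lam (lower_op p J) = affine_fold lam J - \<alpha> p" if "0 < phi p J"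
      using lower_last_violation[OF p J that] lower_op[OF adm[OF J] p that] by auto
  qed
  then obtain T where T: "\<And>J. J \<in> last_violation p i \<Longrightarrow> T J \<in> last_violation p i \<and> T (T J) = J \<and>
      affine_fold lam (T J) = affine_fold lam J + real_of_int (eps p J - phi p J - (nu_pairing p + 1)) *\<^sub>R \<alpha> p"
    by blast
  have "\<nu> + affine_fold lam (T J) + \<rho> = reflection (\<alpha> p) (\<nu> + affine_fold lam J + \<rho>)"
    if J: "J \<in> last_violation p i" for J
  proof -
    define c where "c = real_of_int (eps p J - phi p J - (nu_pairing p + 1))"
    have "form \<rho> (coroot (\<alpha> p)) = 1" using rho_pairing[OF p] by (simp only: coroot_def)
    then have "form (\<nu> + affine_fold lam J + \<rho>) (coroot (\<alpha> p)) = - c"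
      unfolding c_def
      using nu_pairing(1)[OF p] weight_phi_eps[OF admissible_finite[OF adm[OF J]] admissible_subset[OF adm[OF J]] p] by simp
    then have "reflection (\<alpha> p) (\<nu> + affine_fold lam J + \<rho>) = \<nu> + affine_fold lam J + \<rho> - (- c) *\<^sub>R \<alpha> p"
      by (simp only: reflection_def)
    moreover have "affine_fold lam (T J) = affine_fold lam J + c *\<^sub>R \<alpha> p"
      using T[OF J] by (simp only: c_def)
    ultimately show ?thesis by simp
  qed
  then show ?thesis using T by blast
qed

lemma last_violation_exists:
  assumes adm: "admissible I \<beta> J" and viol: "violation J j"
  shows "\<exists>p i. p \<in> {1..r} \<and> J \<in> last_violation p i"
proof -
  have J: "finite J" "J \<subseteq> I" using adm by (auto simp: admissible_iff)
  have "{i. violation J i} \<subseteq> (\<Union>p\<in>{1..r}. walls J p)" by (auto simp: violation_def)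
  then have fin: "finite {i. violation J i}" by (rule finite_subset) (use finite_walls[OF J] in auto)
  define i where "i = Max {i. violation J i}"
  have i: "violation J i" using Max_in[OF fin] viol by (auto simp: i_def)
  have "\<not> violation J j" if "j > i" for j
    using Max_ge[OF fin, of j] that by (auto simp: i_def)
  moreover obtain p where "p \<in> {1..r}" "i \<in> walls J p" using i by (auto simp: violation_def)
  ultimately show ?thesis using adm i by (auto simp: last_violation_def)
qed

lemma last_violation_unique:
  assumes "p \<in> {1..r}" "q \<in> {1..r}" "J \<in> last_violation p i" "J \<in> last_violation q j"
  shows "i = j" "p = q"
proof -
  have "i \<le> j" "j \<le> i"
    using violation_le[OF assms(3), of j] violation_le[OF assms(4), of i] assms(3,4) by (auto simp: last_violation_def)
  then show "i = j" by simp
  then show "p = q" using walls_unique[OF assms(1,2)] assms(3,4) by (auto simp: last_violation_def)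
qed

lemma violation_involution:
  "\<exists>T P. \<forall>J. admissible I \<beta> J \<and> (\<exists>i. violation J i) \<longrightarrow>
    P J \<in> {1..r} \<and> admissible I \<beta> (T J) \<and> (\<exists>i. violation (T J) i) \<and> T (T J) = J \<and> P (T J) = P J \<and>
    \<nu> + affine_fold lam (T J) + \<rho> = reflection (\<alpha> (P J)) (\<nu> + affine_fold lam J + \<rho>)"
proof -
  \<comment> \<open>One involution is chosen per class, so that a subset and its image are treated
    by the same one.\<close>
  define S where "S y = (SOME T. \<forall>J\<in>last_violation (fst y) (snd y). T J \<in> last_violation (fst y) (snd y) \<and>
    T (T J) = J \<and> \<nu> + affine_fold lam (T J) + \<rho> = reflection (\<alpha> (fst y)) (\<nu> + affine_fold lam J + \<rho>))" for y
  have S: "S (p, i) J \<in> last_violation p i \<and> S (p, i) (S (p, i) J) = J \<and>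
      \<nu> + affine_fold lam (S (p, i) J) + \<rho> = reflection (\<alpha> p) (\<nu> + affine_fold lam J + \<rho>)"
    if "p \<in> {1..r}" "J \<in> last_violation p i" for p i J
    using someI_ex[OF last_violation_involution[OF that(1), of i]] that(2) unfolding S_def fst_conv snd_conv by blast
  define x where "x J = (SOME x. fst x \<in> {1..r} \<and> J \<in> last_violation (fst x) (snd x))" for J
  have x_eq: "x J = (p, i)" if "p \<in> {1..r}" "J \<in> last_violation p i" for p i J
    unfolding x_def
  proof (rule some_equality)
    fix y assume y: "fst y \<in> {1..r} \<and> J \<in> last_violation (fst y) (snd y)"
    show "y = (p, i)"
      using last_violation_unique[OF that(1) conjunct1[OF y] that(2) conjunct2[OF y]] by (simp add: prod_eq_iff)
  qed (use that in simp)
  show ?thesis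
  proof (rule exI[of _ "\<lambda>J. S (x J) J"], rule exI[of _ "\<lambda>J. fst (x J)"], intro allI impI)
    fix J assume "admissible I \<beta> J \<and> (\<exists>i. violation J i)"
    then obtain p i where pi: "p \<in> {1..r}" "J \<in> last_violation p i" using last_violation_exists by blast
    have xJ: "x J = (p, i)" "x (S (p, i) J) = (p, i)"
      using x_eq[OF pi] x_eq[OF pi(1) conjunct1[OF S[OF pi]]] by simp_all
    have "admissible I \<beta> (S (p, i) J)" "violation (S (p, i) J) i"
      using S[OF pi] by (auto simp: last_violation_def)
    then show "fst (x J) \<in> {1..r} \<and> admissible I \<beta> (S (x J) J) \<and> (\<exists>i. violation (S (x J) J) i) \<and>
        S (x (S (x J) J)) (S (x J) J) = J \<and> fst (x (S (x J) J)) = fst (x J) \<and>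
        \<nu> + affine_fold lam (S (x J) J) + \<rho> = reflection (\<alpha> (fst (x J))) (\<nu> + affine_fold lam J + \<rho>)"
      unfolding xJ fst_conv using S[OF pi] pi(1) by blast
  qed
qed

end

section \<open>Weight multiplicities and their product with an alternating sum\<close>

context root_chain
begin

definition weight_count :: "'v \<Rightarrow> int" where
  "weight_count \<kappa> = int (card {J \<in> admissibles. affine_fold lam J = \<kappa>})"

lemma weight_count_nonzero:
  assumes "weight_count \<kappa> \<noteq> 0"
  obtains J where "admissible I \<beta> J" "affine_fold lam J = \<kappa>"
proof -
  have "{J \<in> admissibles. affine_fold lam J = \<kappa>} \<noteq> {}"
    using assms unfolding weight_count_def by (metis card.empty of_nat_0)
  then show ?thesis using that by blast
qed

lemma weight_count_closed: "weight_count \<in> carrier char_ring"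
  unfolding char_ring_carrier
proof (intro conjI allI impI)
  fix \<kappa> assume "weight_count \<kappa> \<noteq> 0"
  then show "\<kappa> \<in> weights" using admissible_weight by (metis weight_count_nonzero)
next
  fix h
  have "{\<kappa>. weight_count \<kappa> \<noteq> 0 \<and> h < ht \<kappa>} \<subseteq> affine_fold lam ` {J \<in> admissibles. ht (affine_fold lam J) \<ge> h}"
  proof clarify
    fix \<kappa> assume "weight_count \<kappa> \<noteq> 0" and h: "h < ht \<kappa>"
    from this(1) obtain J where "admissible I \<beta> J" "affine_fold lam J = \<kappa>" by (rule weight_count_nonzero)
    then show "\<kappa> \<in> affine_fold lam ` {J \<in> admissibles. ht (affine_fold lam J) \<ge> h}"
      using h by (intro image_eqI[of _ _ J]) auto
  qed
  then show "finite {\<kappa>. weight_count \<kappa> \<noteq> 0 \<and> h < ht \<kappa>}"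
    by (rule finite_subset) (intro finite_imageI finite_admissible_ht)
qed

end

context tensor_chain
begin

definition good :: "'i set set" where
  "good = {J \<in> admissibles. \<forall>i. \<not> violation J i}"

text \<open>Without violations \<open>eps\<close> is at most the pairing of \<nu>, which leaves a
  total pairing of at least \<open>phi\<close>.\<close>

lemma good_dominant:
  assumes "J \<in> good" shows "dominant (\<nu> + affine_fold lam J)"
proof (rule dominantI)
  have adm: "admissible I \<beta> J" and nv: "\<forall>i. \<not> violation J i" using assms by (auto simp: good_def)
  then have J: "finite J" "J \<subseteq> I" by (auto simp: admissible_iff)
  show "\<nu> + affine_fold lam J \<in> weights"
    using weights_add[OF dominant_weights[OF dominant_nu] admissible_weight[OF adm]] .
  fix p assume p: "p \<in> {1..r}"
  have "eps p J \<le> nu_pairing p" using no_violation_iff[OF adm] nv p by blast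
  then show "0 \<le> form (\<nu> + affine_fold lam J) (coroot (\<alpha> p))"
    using weight_phi_eps[OF J p] nu_pairing(1)[OF p] phi_nonneg[OF adm p] by simp
qed

lemma weight_count_mult_alternant:
  "formal_sum_of (weight_count \<otimes>\<^bsub>char_ring\<^esub> alternant \<nu>) (\<lambda>J. alternant (\<nu> + affine_fold lam J)) good"
  unfolding formal_sum_of_def
proof
  fix \<kappa>
  let ?\<mu> = "affine_fold lam" and ?sgn = "\<lambda>w. (-1) ^ wlength w :: int"
  \<comment> \<open>\<open>Q\<close> indexes the terms of the product; in \<open>P\<close> the
    weight of the subset has moved inside the Weyl group element. Invariance of the weights matches
    the two for each fixed element.\<close>
  define Q where "Q = {x. fst x \<in> weyl_group \<and> admissible I \<beta> (snd x) \<and> fst x (\<nu> + \<rho>) - \<rho> + ?\<mu> (snd x) = \<kappa>}"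
  define P where "P = {x. fst x \<in> weyl_group \<and> admissible I \<beta> (snd x) \<and> fst x (\<nu> + ?\<mu> (snd x) + \<rho>) - \<rho> = \<kappa>}"
  have fin_Q: "finite Q"
  proof (rule finite_subset)
    show "Q \<subseteq> {w \<in> weyl_group. ht (w (\<nu> + \<rho>)) \<ge> ht \<kappa> + ht \<rho> - ht lam} \<times> {J \<in> admissibles. ht (?\<mu> J) \<ge> ht \<kappa> - ht \<nu>}"
    proof
      fix x assume x: "x \<in> Q"
      then have w: "fst x \<in> weyl_group" and adm: "admissible I \<beta> (snd x)"
        and "ht (fst x (\<nu> + \<rho>)) - ht \<rho> + ht (?\<mu> (snd x)) = ht \<kappa>"
        by (auto simp: Q_def simp flip: ht_simps)
      moreover have "ht (?\<mu> (snd x)) \<le> ht lam" using admissible_ht[OF adm] by simp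
      moreover have "ht (fst x (\<nu> + \<rho>)) \<le> ht \<nu> + ht \<rho>"
        using ht_weyl_group[OF dominant_shift[OF dominant_nu] w] by (simp add: ht_simps)
      ultimately have "fst x \<in> {w \<in> weyl_group. ht (w (\<nu> + \<rho>)) \<ge> ht \<kappa> + ht \<rho> - ht lam}"
        "snd x \<in> {J \<in> admissibles. ht (?\<mu> J) \<ge> ht \<kappa> - ht \<nu>}" by auto
      then show "x \<in> {w \<in> weyl_group. ht (w (\<nu> + \<rho>)) \<ge> ht \<kappa> + ht \<rho> - ht lam} \<times> {J \<in> admissibles. ht (?\<mu> J) \<ge> ht \<kappa> - ht \<nu>}"
        by (simp add: mem_Times_iff)
    qed
  qed (intro finite_cartesian_product finite_weyl_group_ht dominant_nu finite_admissible_ht)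

  have bij: "\<exists>b. bij_betw b P Q \<and> (\<forall>x. fst (b x) = fst x)"
  proof -
    obtain B where B: "\<forall>w\<in>weyl_group. bij_betw (B w) admissibles admissibles \<and> (\<forall>J\<in>admissibles. ?\<mu> (B w J) = w (?\<mu> J))"
      using bchoice[of weyl_group "\<lambda>w T. bij_betw T admissibles admissibles \<and> (\<forall>J\<in>admissibles. ?\<mu> (T J) = w (?\<mu> J))"]
        admissible_weyl_group by blast
    have mem: "(w, J) \<in> P \<longleftrightarrow> (w, B w J) \<in> Q" if w: "w \<in> weyl_group" and J: "admissible I \<beta> J" for w J
    proof -
      have "admissible I \<beta> (B w J)" "?\<mu> (B w J) = w (?\<mu> J)"
        using B w J by (auto dest: bij_betwE)
      then show ?thesis using w J by (simp add: P_def Q_def weyl_group_add[OF w] algebra_simps)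
    qed
    have "bij_betw (\<lambda>x. (fst x, B (fst x) (snd x))) P Q"
    proof (rule bij_betw_imageI)
      show "inj_on (\<lambda>x. (fst x, B (fst x) (snd x))) P"
      proof (rule inj_onI)
        fix x y assume x: "x \<in> P" and y: "y \<in> P" and eq: "(fst x, B (fst x) (snd x)) = (fst y, B (fst y) (snd y))"
        from eq have 1: "fst x = fst y" by (simp only: prod.inject)
        with eq have 2: "B (fst x) (snd x) = B (fst x) (snd y)" by (simp only: prod.inject)
        have w: "fst x \<in> weyl_group" and mem: "snd x \<in> admissibles" "snd y \<in> admissibles"
          using x y by (simp_all add: P_def)
        have "inj_on (B (fst x)) admissibles" using bspec[OF B w] bij_betw_imp_inj_on by blast
        then have "snd x = snd y" using 2 mem by (rule inj_onD)
        then show "x = y" using 1 by (simp add: prod_eq_iff)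
      qed
      show "(\<lambda>x. (fst x, B (fst x) (snd x))) ` P = Q"
      proof (intro equalityI subsetI)
        fix z assume "z \<in> (\<lambda>x. (fst x, B (fst x) (snd x))) ` P"
        then obtain x where x: "x \<in> P" "z = (fst x, B (fst x) (snd x))" by blast
        then have "fst x \<in> weyl_group" "admissible I \<beta> (snd x)" by (simp_all add: P_def)
        then show "z \<in> Q" using mem[of "fst x" "snd x"] x by simp
      next
        fix z assume z: "z \<in> Q"
        then have w: "fst z \<in> weyl_group" "snd z \<in> admissibles" by (simp_all add: Q_def)
        have "snd z \<in> B (fst z) ` admissibles"
          using bspec[OF B w(1)] w(2) bij_betw_imp_surj_on by blast
        then obtain J where J: "admissible I \<beta> J" "snd z = B (fst z) J" by blast
        have "(fst z, J) \<in> P" using mem[OF w(1) J(1)] z by (simp flip: J(2))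
        then show "z \<in> (\<lambda>x. (fst x, B (fst x) (snd x))) ` P"
          by (rule rev_image_eqI) (simp add: J(2)[symmetric])
      qed
    qed
    then show ?thesis by (intro exI[of _ "\<lambda>x. (fst x, B (fst x) (snd x))"]) simp
  qed
  then obtain b where b: "bij_betw b P Q" "\<And>x. fst (b x) = fst x" by blast
  have fin_P: "finite P" using b(1) fin_Q bij_betw_finite by blast
  have "(weight_count \<otimes>\<^bsub>char_ring\<^esub> alternant \<nu>) \<kappa> = (\<Sum>x\<in>Q. ?sgn (fst x))"
  proof -
    let ?T = "(\<lambda>x. ?\<mu> (snd x)) ` Q"
    have "(weight_count \<otimes>\<^bsub>char_ring\<^esub> alternant \<nu>) \<kappa> = (\<Sum>m\<in>?T. weight_count m * alternant \<nu> (\<kappa> - m))"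
    proof (rule char_ring_mult_eq)
      show "{m. weight_count m \<noteq> 0 \<and> alternant \<nu> (\<kappa> - m) \<noteq> 0} \<subseteq> ?T"
      proof clarify
        fix m assume "weight_count m \<noteq> 0" "alternant \<nu> (\<kappa> - m) \<noteq> 0"
        from this(1) obtain J where J: "admissible I \<beta> J" "?\<mu> J = m" by (rule weight_count_nonzero)
        from \<open>alternant \<nu> (\<kappa> - m) \<noteq> 0\<close> obtain w where "w \<in> weyl_group" "w (\<nu> + \<rho>) - \<rho> = \<kappa> - m"
          by (rule alternant_nonzero)
        then have "(w, J) \<in> Q" using J by (simp add: Q_def)
        then show "m \<in> ?T" using J by (intro image_eqI[of _ _ "(w, J)"]) auto
      qed
    qed (use fin_Q in simp)
    also have "\<dots> = (\<Sum>m\<in>?T. \<Sum>x | x \<in> Q \<and> ?\<mu> (snd x) = m. ?sgn (fst x))"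
    proof (rule sum.cong[OF refl])
      fix m
      let ?W = "{w. w \<in> weyl_group \<and> w (\<nu> + \<rho>) - \<rho> = \<kappa> - m}" and ?J = "{J \<in> admissibles. ?\<mu> J = m}"
      have "{x. x \<in> Q \<and> ?\<mu> (snd x) = m} = ?W \<times> ?J"
        by (auto simp: Q_def algebra_simps)
      then have "(\<Sum>x | x \<in> Q \<and> ?\<mu> (snd x) = m. ?sgn (fst x)) = (\<Sum>w\<in>?W. \<Sum>J\<in>?J. ?sgn w)"
        by (simp only: sum.cartesian_product case_prod_unfold)
      then show "weight_count m * alternant \<nu> (\<kappa> - m) = (\<Sum>x | x \<in> Q \<and> ?\<mu> (snd x) = m. ?sgn (fst x))"
        by (simp add: weight_count_def alternant_def sum_distrib_left)
    qed
    also have "\<dots> = (\<Sum>x\<in>Q. ?sgn (fst x))"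
      using fin_Q by (intro sum.group) auto
    finally show ?thesis .
  qed

  also have "\<dots> = (\<Sum>x\<in>P. ?sgn (fst x))"
    using sum.reindex_bij_betw[OF b(1), of "\<lambda>x. ?sgn (fst x)"] by (simp add: b(2))
  also have "\<dots> = (\<Sum>x | x \<in> P \<and> snd x \<in> good. ?sgn (fst x)) + (\<Sum>x | x \<in> P \<and> snd x \<notin> good. ?sgn (fst x))"
    using fin_P by (subst sum.union_disjoint[symmetric]) (auto intro!: sum.cong)
  also have "(\<Sum>x | x \<in> P \<and> snd x \<notin> good. ?sgn (fst x)) = 0"
  proof -
    obtain T p where T: "\<forall>J. admissible I \<beta> J \<and> (\<exists>i. violation J i) \<longrightarrow>
        p J \<in> {1..r} \<and> admissible I \<beta> (T J) \<and> (\<exists>i. violation (T J) i) \<and> T (T J) = J \<and> p (T J) = p J \<and>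
        \<nu> + ?\<mu> (T J) + \<rho> = reflection (\<alpha> (p J)) (\<nu> + ?\<mu> J + \<rho>)"
      using violation_involution by (elim exE)
    \<comment> \<open>Right multiplication by the reflection undoes the reflection of the shifted
      weight, so the exponent is kept while the sign changes.\<close>
    define t where "t x = (fst x \<circ> reflection (\<alpha> (p (snd x))), T (snd x))" for x :: "('v \<Rightarrow> 'v) \<times> 'i set"
    show ?thesis
    proof (rule sum_involution_zero[where t = t])
      fix x assume "x \<in> {x. x \<in> P \<and> snd x \<notin> good}"
      then have w: "fst x \<in> weyl_group" and J: "admissible I \<beta> (snd x)" "\<exists>i. violation (snd x) i"
        and \<kappa>: "fst x (\<nu> + ?\<mu> (snd x) + \<rho>) - \<rho> = \<kappa>" by (auto simp: P_def good_def)
      note TJ = T[rule_format, OF conjI, OF J]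
      have pJ: "p (snd x) \<in> {1..r}" using TJ by blast
      note inv = reflection_involutive[OF simple_norm_nonzero[OF pJ]]
      have "t x \<in> P"
        using TJ weyl_group_reflection[OF w simple_roots[OF pJ]] \<kappa> inv by (simp add: P_def t_def)
      moreover have "snd (t x) \<notin> good" using TJ by (simp add: t_def good_def)
      moreover have "t (t x) = x"
        using TJ inv by (simp add: t_def prod_eq_iff fun_eq_iff)
      moreover have "?sgn (fst (t x)) = - ?sgn (fst x)"
        using wlength_parity_simple[OF w pJ] by (simp add: t_def)
      ultimately show "t x \<in> {x. x \<in> P \<and> snd x \<notin> good} \<and> t (t x) = x \<and> ?sgn (fst (t x)) = - ?sgn (fst x)"
        by simp
    qed
  qed
  \<comment> \<open>Collecting the terms of each \<open>J\<close> restores an alternating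
    sum.\<close>
  also have "(\<Sum>x | x \<in> P \<and> snd x \<in> good. ?sgn (fst x)) + 0 =
      (\<Sum>J\<in>snd ` {x. x \<in> P \<and> snd x \<in> good}. alternant (\<nu> + ?\<mu> J) \<kappa>)"
  proof -
    let ?P = "{x. x \<in> P \<and> snd x \<in> good}"
    have "(\<Sum>J\<in>snd ` ?P. alternant (\<nu> + ?\<mu> J) \<kappa>) = (\<Sum>J\<in>snd ` ?P. \<Sum>x | x \<in> ?P \<and> snd x = J. ?sgn (fst x))"
    proof (rule sum.cong[OF refl])
      fix J assume "J \<in> snd ` ?P"
      then have "{x. x \<in> ?P \<and> snd x = J} = {w. w \<in> weyl_group \<and> w (\<nu> + ?\<mu> J + \<rho>) - \<rho> = \<kappa>} \<times> {J}"
        by (auto simp: P_def good_def)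
      then show "alternant (\<nu> + ?\<mu> J) \<kappa> = (\<Sum>x | x \<in> ?P \<and> snd x = J. ?sgn (fst x))"
        unfolding alternant_def
        by (simp only:) (rule sum.reindex_bij_witness[of _ fst "\<lambda>w. (w, J)"]; auto)
    qed
    also have "\<dots> = (\<Sum>x\<in>?P. ?sgn (fst x))"
      using fin_P by (intro sum.group) auto
    finally show ?thesis by simp
  qed
  finally have eq: "(weight_count \<otimes>\<^bsub>char_ring\<^esub> alternant \<nu>) \<kappa> =
      (\<Sum>J\<in>snd ` {x. x \<in> P \<and> snd x \<in> good}. alternant (\<nu> + ?\<mu> J) \<kappa>)" .
  have sub: "{J \<in> good. alternant (\<nu> + ?\<mu> J) \<kappa> \<noteq> 0} \<subseteq> snd ` {x. x \<in> P \<and> snd x \<in> good}"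
  proof clarify
    fix J assume J: "J \<in> good" and "alternant (\<nu> + ?\<mu> J) \<kappa> \<noteq> 0"
    from this(2) obtain w where "w \<in> weyl_group" "w (\<nu> + ?\<mu> J + \<rho>) - \<rho> = \<kappa>" by (rule alternant_nonzero)
    then have "(w, J) \<in> P" using J by (simp add: P_def good_def)
    then show "J \<in> snd ` {x. x \<in> P \<and> snd x \<in> good}" using J by (intro image_eqI[of _ _ "(w, J)"]) auto
  qed
  have fin: "finite (snd ` {x. x \<in> P \<and> snd x \<in> good})" using fin_P by simp
  have "(\<Sum>J\<in>snd ` {x. x \<in> P \<and> snd x \<in> good}. alternant (\<nu> + ?\<mu> J) \<kappa>) =
      (\<Sum>J | J \<in> good \<and> alternant (\<nu> + ?\<mu> J) \<kappa> \<noteq> 0. alternant (\<nu> + ?\<mu> J) \<kappa>)"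
    using fin sub by (intro sum.mono_neutral_right) auto
  then show "finite {J \<in> good. alternant (\<nu> + ?\<mu> J) \<kappa> \<noteq> 0} \<and> (weight_count \<otimes>\<^bsub>char_ring\<^esub> alternant \<nu>) \<kappa> =
      (\<Sum>J | J \<in> good \<and> alternant (\<nu> + ?\<mu> J) \<kappa> \<noteq> 0. alternant (\<nu> + ?\<mu> J) \<kappa>)"
    using eq finite_subset[OF sub fin] by simp
qed

end

section \<open>Characters and the Littlewood-Richardson rule\<close>

context root_chain
begin

text \<open>The final product of a nonempty admissible \<open>J\<close> has positive length. A left
  descent \<open>p\<close> of it puts the end of the word on the negative side, so
  \<open>eps p J\<close> exceeds 0, which for \<nu> = 0 means a violation.\<close>

lemma good_zero: "tensor_chain.good form r \<alpha> I \<beta> 0 = {{}}"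
proof -
  interpret zero: tensor_chain form r \<alpha> \<rho> ht lam I \<beta> 0
    by unfold_locales (rule dominant_zero)
  have nu: "zero.nu_pairing p = 0" for p by (simp add: zero.nu_pairing_def)
  have "J = {}" if adm: "admissible I \<beta> J" and nv: "\<forall>i. \<not> zero.violation J i" for J
  proof (rule ccontr)
    assume "J \<noteq> {}"
    have J: "finite J" "J \<subseteq> I" using adm by (auto simp: admissible_iff)
    define k where "k = Max J"
    have k: "k \<in> J" "insert k (J \<inter> {..<k}) = J"
      using Max_in[OF J(1) \<open>J \<noteq> {}\<close>] Max_ge[OF J(1)] by (auto simp: k_def order_less_le)
    then have "fold_product J = fold_product (J \<inter> {..<k}) \<circ> reflection (\<beta> k)"
      using fold_product_insert_max[of "J \<inter> {..<k}" k] J(1) by simp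
    then have pos: "wlength (fold_product J) > 0" using admissible_cover[OF adm k(1)] by simp
    have w: "fold_product J \<in> weyl_group" by (rule fold_product_weyl[OF J])
    obtain ps where ps: "ps \<in> lists {1..r}" "simple_word ps = fold_product J" "length ps = wlength (fold_product J)"
      using w by (rule reduced_word)
    obtain p qs where pq: "ps = p # qs" using ps(3) pos by (cases ps) auto
    have p: "p \<in> {1..r}" and qs: "qs \<in> lists {1..r}" using ps(1) pq by auto
    have "reflection (\<alpha> p) \<circ> fold_product J = simple_word qs"
      using reflection_involutive[OF simple_norm_nonzero[OF p]] by (auto simp: ps(2)[symmetric] pq fun_eq_iff)
    then have "wlength (reflection (\<alpha> p) \<circ> fold_product J) < wlength (fold_product J)"
      using wlength_le[OF qs] ps(3) pq by simp
    then have "\<not> wall_state J UNIV p"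
      using wlength_simple_left_up[OF w p] by (auto simp: wall_state_def)
    then have "\<not> sign_at J p (wall_num J p)" by (simp add: sign_at_def cut_def)
    then have "eps p J \<noteq> 0"
      using step_word_last_sign[OF admissible_step_word[OF adm p]] by (auto simp: eps_def phi_def)
    then show False using zero.no_violation_iff[OF adm] nv p nu eps_nonneg[of p J] by fastforce
  qed
  moreover have "\<not> zero.violation {} i" for i
  proof -
    \<comment> \<open>Without foldings the state is always positive and the level can only
      climb.\<close>
    have "wall_level {} {..<i} p \<le> wall_level {} UNIV p" if p: "p \<in> {1..r}" for p
    proof -
      have count: "net_count {} C (\<alpha> p) = root_count C (\<alpha> p)" for C
        using net_count_beyond[of "{}" C "\<alpha> p"] root_count_nonpos[OF uminus_pos_roots[OF simple_pos_roots[OF p]]] by simp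
      have "wall_state {} C p" for C using simple_pos_roots[OF p] by (simp add: wall_state_def)
      moreover have "root_count {..<i} (\<alpha> p) \<le> root_count UNIV (\<alpha> p)"
        using root_count_split[of "{..<i}" UNIV "\<alpha> p"] by (simp add: root_count_def)
      ultimately show ?thesis by (simp add: wall_level_def count)
    qed
    then show ?thesis using nu by (auto simp: zero.violation_def not_less)
  qed
  ultimately show ?thesis using admissible_empty unfolding zero.good_def by blast
qed

lemma character_eq_weight_count: "character lam = weight_count"
proof -
  interpret zero: tensor_chain form r \<alpha> \<rho> ht lam I \<beta> 0
    by unfold_locales (rule dominant_zero)
  interpret char_ring: cring char_ring by (rule char_ring_cring)
  obtain u where u: "u \<in> carrier char_ring" "alternant 0 \<otimes>\<^bsub>char_ring\<^esub> u = \<one>\<^bsub>char_ring\<^esub>"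
    "\<forall>lam. character lam = alternant lam \<otimes>\<^bsub>char_ring\<^esub> u"
    using weyl_denominator_unit by blast
  have "(weight_count \<otimes>\<^bsub>char_ring\<^esub> alternant 0) \<kappa> = alternant lam \<kappa>" for \<kappa>
  proof -
    have "(weight_count \<otimes>\<^bsub>char_ring\<^esub> alternant 0) \<kappa> =
        (\<Sum>J | J \<in> {{}} \<and> alternant (0 + affine_fold lam J) \<kappa> \<noteq> 0. alternant (0 + affine_fold lam J) \<kappa>)"
      using zero.weight_count_mult_alternant unfolding formal_sum_of_def good_zero by blast
    also have "\<dots> = (\<Sum>J\<in>{{}}. alternant (0 + affine_fold lam J) \<kappa>)"
      by (rule sum.mono_neutral_left) auto
    finally show ?thesis by simp
  qed
  then have "weight_count \<otimes>\<^bsub>char_ring\<^esub> alternant 0 = alternant lam" by (rule ext)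
  then have "character lam = weight_count \<otimes>\<^bsub>char_ring\<^esub> alternant 0 \<otimes>\<^bsub>char_ring\<^esub> u" by (simp add: u(3))
  then show ?thesis
    using weight_count_closed alternant_closed[OF dominant_zero] u by (simp add: char_ring.m_assoc)
qed

end

text \<open>Dominance of \<open>\<nu> + \<mu>(J)\<close> makes its height the largest in its
  alternating sum; these bounds allow termwise multiplication by the inverse denominator.\<close>

lemma (in tensor_chain) littlewood_richardson:
  "formal_sum_of (character lam \<otimes>\<^bsub>char_ring\<^esub> character \<nu>) (\<lambda>J. character (\<nu> + affine_fold lam J)) good"
proof -
  interpret char_ring: cring char_ring by (rule char_ring_cring)
  obtain u where u: "u \<in> carrier char_ring" "\<forall>\<nu>. u \<nu> \<noteq> 0 \<longrightarrow> ht \<nu> \<le> 0"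
    "\<forall>lam. character lam = alternant lam \<otimes>\<^bsub>char_ring\<^esub> u"
    using weyl_denominator_unit by blast
  have "formal_sum_of (weight_count \<otimes>\<^bsub>char_ring\<^esub> alternant \<nu> \<otimes>\<^bsub>char_ring\<^esub> u)
      (\<lambda>J. alternant (\<nu> + affine_fold lam J) \<otimes>\<^bsub>char_ring\<^esub> u) good"
  proof (rule formal_sum_mult[where b = "\<lambda>J. ht (\<nu> + affine_fold lam J)"])
    show "finite {J \<in> good. h \<le> ht (\<nu> + affine_fold lam J)}" for h
      by (rule finite_subset[OF _ finite_admissible_ht[of "h - ht \<nu>"]]) (auto simp: good_def ht_simps)
  qed (use weight_count_mult_alternant alternant_closed alternant_ht good_dominant u in blast)+
  moreover have "character lam \<otimes>\<^bsub>char_ring\<^esub> character \<nu> = weight_count \<otimes>\<^bsub>char_ring\<^esub> alternant \<nu> \<otimes>\<^bsub>char_ring\<^esub> u"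
    using weight_count_closed alternant_closed[OF dominant_nu] u(1)
    by (simp add: character_eq_weight_count u(3)[rule_format, of \<nu>] char_ring.m_assoc)
  moreover have "(\<lambda>J. character (\<nu> + affine_fold lam J)) = (\<lambda>J. alternant (\<nu> + affine_fold lam J) \<otimes>\<^bsub>char_ring\<^esub> u)"
    using u(3) by blast
  ultimately show ?thesis by simp
qed

theorem corollary8p3:
  fixes form :: "'v::real_vector \<Rightarrow> 'v \<Rightarrow> real"
    and r :: nat
    and \<alpha> :: "nat \<Rightarrow> 'v"
    and \<rho> :: 'v
    and ht :: "'v \<Rightarrow> real"
    and lam \<nu> :: 'v
    and I :: "'i::linorder set"
    and \<beta> :: "'i \<Rightarrow> 'v"
  assumes "kac_moody_roots form r \<alpha> \<rho> ht"
    and "kac_moody_roots.dominant form r \<alpha> lam"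
    and "kac_moody_roots.dominant form r \<alpha> \<nu>"
    and "kac_moody_roots.lambda_chain form r \<alpha> lam I \<beta>"
  shows "formal_sum_of
    (kac_moody_roots.character form r \<alpha> \<rho> ht lam
      \<otimes>\<^bsub>kac_moody_roots.char_ring form r \<alpha> ht\<^esub> kac_moody_roots.character form r \<alpha> \<rho> ht \<nu>)
    (\<lambda>J. kac_moody_roots.character form r \<alpha> \<rho> ht (\<nu> + kac_moody_roots.subset_weight form lam I \<beta> J))
    {J. kac_moody_roots.admissible form r \<alpha> I \<beta> J \<and>
        (\<forall>p\<in>{1..r}. form (\<nu> + kac_moody_roots.subset_weight form lam I \<beta> J)
                       (kac_moody_roots.coroot form (\<alpha> p))
                  \<ge> kac_moody_roots.max_level form r \<alpha> \<rho> lam I \<beta> J p)}"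
proof -
  interpret kac_moody_roots form r \<alpha> \<rho> ht by (rule assms(1))
  interpret tensor_chain form r \<alpha> \<rho> ht lam I \<beta> \<nu>
    by unfold_locales (use assms in auto)
  have "{J. admissible I \<beta> J \<and> (\<forall>p\<in>{1..r}. max_level lam I \<beta> J p \<le> form (\<nu> + subset_weight lam I \<beta> J) (coroot (\<alpha> p)))} = good"
    using max_level_iff by (auto simp: good_def)
  then show ?thesis
    using littlewood_richardson by simp
qed

end
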